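(* Let $n$ be odd and let $D$ be a bounded domain in $\mathbb{R}^n$ with infinitely smooth boundary. Suppose that the volume function $V_D(\xi,t)$ is a rational function with respect to $t$, that is, $$V_D(\xi,t)=\frac{A(\xi,t)}{B(\xi,t)},\qquad A,B\in C(S^{n-1})[t],$$ for all $(\xi,t)$ in the natural domain of definition of $V_D$, and that it has no real poles in the following sense: $B(\xi,t)\neq0$ for all $\xi\in S^{n-1}$, $t\in\mathbb{R}$, and $b_k(\xi)\ne0$ for all $\xi\in S^{n-1}$, where $b_k(\xi)$ is the leading coefficient of $B(\xi,t)$ as a polynomial in $t$. Then $D$ is an ellipsoid.
   Context: For a bounded domain $D\subset\mathbb{R}^n$, the volume function is $$V_D(\xi,t)=\mathrm{vol}_n\big(D\cap\{x:\langle \xi,x\rangle\le t\}\big),\qquad \xi\in S^{n-1},\ t\in\mathbb{R},$$ considered on its natural domain of definition: those $(\xi,t)$ for which the hyperplane $\{\langle\xi,x\rangle=t\}$ meets $D$. $C(S^{n-1})[t]$ is the ring of polynomials in $t$ whose coefficients are continuous functions on the unit sphere $S^{n-1}$. An ellipsoid means the (solid) image of the unit ball of $\mathbb{R}^n$ under a non-degenerate affine transformation. *)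

theory Defs
  imports "HOL-Analysis.Analysis"
begin

text \<open>
  On an open set \<open>S\<close>, \<open>Ck_on k f S\<close> is \<open>f \<in> C\<^sup>k(S)\<close>: \<open>f\<close> is differentiable at every point of \<open>S\<close> and
  each directional derivative is of class \<open>C\<^sup>k\<^sup>-\<^sup>1\<close>.  Only the values of \<open>f\<close> on \<open>S\<close> matter.
\<close>

primrec Ck_on :: "nat \<Rightarrow> ('a::euclidean_space \<Rightarrow> real) \<Rightarrow> 'a set \<Rightarrow> bool" where
  "Ck_on 0 f S \<longleftrightarrow> continuous_on S f"
| "Ck_on (Suc k) f S \<longleftrightarrow>
     (\<forall>x\<in>S. f differentiable (at x)) \<and>
     (\<forall>v. Ck_on k (\<lambda>x. frechet_derivative f (at x) v) S)"

definition smooth_on :: "('a::euclidean_space \<Rightarrow> real) \<Rightarrow> 'a set \<Rightarrow> bool" where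
  "smooth_on f S \<longleftrightarrow> (\<forall>k. Ck_on k f S)"

definition bounded_domain :: "'a::euclidean_space set \<Rightarrow> bool" where
  "bounded_domain D \<longleftrightarrow> open D \<and> connected D \<and> D \<noteq> {} \<and> bounded D"

text \<open>
  Near each boundary point, \<open>D\<close> is the sublevel set of a smooth function \<open>\<rho>\<close> without critical points;
  for open \<open>D\<close> this makes \<open>frontier D \<inter> U\<close> the regular hypersurface \<open>\<rho> = 0\<close>.
\<close>

definition has_smooth_boundary :: "'a::euclidean_space set \<Rightarrow> bool" where
  "has_smooth_boundary D \<longleftrightarrow>
     (\<forall>p\<in>frontier D. \<exists>U \<rho>. open U \<and> p \<in> U \<and> smooth_on \<rho> U \<and>
        (\<forall>x\<in>U. frechet_derivative \<rho> (at x) \<noteq> (\<lambda>v. 0)) \<and>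
        D \<inter> U = {x\<in>U. \<rho> x < 0})"

definition volume_function :: "'a::euclidean_space set \<Rightarrow> 'a \<Rightarrow> real \<Rightarrow> real" where
  "volume_function D \<xi> t = measure lebesgue (D \<inter> {x. \<xi> \<bullet> x \<le> t})"

definition volume_domain :: "'a::euclidean_space set \<Rightarrow> ('a \<times> real) set" where
  "volume_domain D = {(\<xi>, t). \<xi> \<in> sphere 0 1 \<and> {x. \<xi> \<bullet> x = t} \<inter> D \<noteq> {}}"

text \<open>Domains being open, the ellipsoid is the image of the open unit ball.\<close>

definition is_ellipsoid :: "'a::euclidean_space set \<Rightarrow> bool" where
  "is_ellipsoid E \<longleftrightarrow> (\<exists>(L :: 'a \<Rightarrow> 'a) c. linear L \<and> bij L \<and> E = (\<lambda>x. c + L x) ` ball 0 1)"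

text \<open>
  An element of \<open>C(S\<^sup>n\<^sup>-\<^sup>1)[t]\<close> is given by a degree bound \<open>m\<close> and its coefficient functions
  \<open>a 0, \<dots>, a m\<close>, of which only the restrictions to the unit sphere are used.
\<close>

definition sphere_poly_coeffs :: "nat \<Rightarrow> (nat \<Rightarrow> 'a::euclidean_space \<Rightarrow> real) \<Rightarrow> bool" where
  "sphere_poly_coeffs m a \<longleftrightarrow> (\<forall>i\<le>m. continuous_on (sphere 0 1) (a i))"

definition sphere_poly_eval ::
    "nat \<Rightarrow> (nat \<Rightarrow> 'a::euclidean_space \<Rightarrow> real) \<Rightarrow> 'a \<Rightarrow> real \<Rightarrow> real" where
  "sphere_poly_eval m a \<xi> t = (\<Sum>i\<le>m. a i \<xi> * t ^ i)"

end

theory Submission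
  imports Defs
    "HOL-Complex_Analysis.Complex_Analysis"
    "HOL-Computational_Algebra.Fundamental_Theorem_Algebra"
    "HOL-Probability.Distribution_Functions"
begin

text \<open>
  Let \<open>h\<^sub>+(\<xi>)\<close> and \<open>h\<^sub>-(\<xi>)\<close> be the supremum and the infimum of \<open>\<xi> \<bullet> x\<close> over \<open>D\<close>, where \<open>0 \<in> D\<close> without
  loss of generality.  The moments \<open>\<integral>\<^sub>D (\<xi> \<bullet> x)\<^sup>j dx\<close> are polynomials in \<open>\<xi>\<close>; on a line \<open>\<xi> + s \<eta>\<close> they
  become polynomials \<open>M\<^sub>j(s)\<close>.  On the other hand they are the moments of the rational density
  \<open>V' = A/B\<close> on \<open>[h\<^sub>-, h\<^sub>+]\<close>, so \<open>f\<^sub>s(w) = \<Sum> M\<^sub>j(s) w\<^sup>j\<close> has the form \<open>\<alpha> L + c\<close> divided by \<open>\<beta>\<close>, with polynomials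
  \<open>\<alpha>\<close>, \<open>\<beta>\<close>, \<open>c\<close> of bounded degree in \<open>w\<close> and \<open>L = log ((1 - h\<^sub>- w) / (1 - h\<^sub>+ w))\<close>.  Since \<open>L\<close> is
  transcendental, \<open>f\<^sub>s\<close> satisfies an essentially unique equation \<open>p f' + q f = r\<close>, and by linear algebra
  \<open>p\<close> and \<open>q\<close> can be taken polynomial in \<open>s\<close>.  The roots of \<open>\<beta>\<close> are roots of \<open>w p\<close>, so multiplying
  \<open>f\<^sub>s\<close> by a power of \<open>w p\<close> and differentiating often enough gives a series with coefficients polynomial in
  \<open>s\<close> that is a rational function of \<open>w\<close> with poles only at \<open>1/h\<^sub>+\<close> and \<open>1/h\<^sub>-\<close>.  Its minimal
  denominator, again chosen polynomial in \<open>s\<close>, is \<open>(1 - h\<^sub>+ w)\<^sup>m (1 - h\<^sub>- w)\<^sup>k\<close> up to a factor depending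
  on \<open>s\<close>.  For generic complex \<open>s\<close> it has no roots in the disc of convergence, of radius at least a multiple
  of \<open>1/(1 + |s|)\<close>, which forces the normalised coefficients to be polynomials in \<open>s\<close> of the expected
  degree.  Continuity in \<open>s\<close> and the limits \<open>s \<rightarrow> \<plusminus>\<infinity>\<close> give \<open>m = k\<close>.

  Hence \<open>h\<^sub>+ + h\<^sub>-\<close> is linear and \<open>(h\<^sub>+ - h\<^sub>-)\<^sup>2\<close> is a quadratic form, so after an affine map \<open>h\<^sub>\<plusminus>(\<xi>) = \<plusminus>|\<xi>|\<close>.
  Then \<open>D\<close> lies in the unit ball and the unit sphere lies in its boundary; as the boundary is smooth, \<open>D\<close>
  coincides with the ball near the sphere.  In odd dimension the caps of the ball have polynomial volume, so
  the rational function \<open>V\<^sub>D\<close> agrees with the volume function of the ball everywhere, and \<open>D\<close> is the ball.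
\<close>

unbundle no vec_syntax
unbundle fps_syntax

section \<open>Power series with coefficients polynomial in a parameter\<close>

text \<open>Gaussian elimination over the polynomial ring. A pivot that is a nonzero polynomial
  vanishes at finitely many parameters only, so the pointwise systems stay solvable for infinitely
  many \<open>s\<close> once the last unknown has been eliminated. The number of equations may be
  infinite.\<close>

lemma poly_solution_of_pointwise_solutions:
  fixes v :: "'r \<Rightarrow> nat \<Rightarrow> 'a::field poly"
  assumes "infinite S"
    and "\<And>s. s \<in> S \<Longrightarrow> \<exists>c. (\<exists>i<L. c i \<noteq> 0) \<and> (\<forall>j. (\<Sum>i<L. c i * poly (v j i) s) = 0)"
  shows "\<exists>c. (\<exists>i<L. c i \<noteq> 0) \<and> (\<forall>j. (\<Sum>i<L. c i * v j i) = 0)"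
  using assms
proof (induction L arbitrary: v S)
  case 0
  then show ?case by (metis finite.emptyI ex_in_conv less_nat_zero_code)
next
  case (Suc L)
  show ?case
  proof (cases "\<forall>j. v j L = 0")
    case True
    then show ?thesis
      by (intro exI[of _ "\<lambda>i. if i = L then 1 else 0"]) (auto intro!: sum.neutral)
  next
    case False
    then obtain j0 where j0: "v j0 L \<noteq> 0" by blast
    \<comment> \<open>Cross-multiplication with the pivot \<open>v j0 L\<close> eliminates the
      unknown \<open>L\<close> from row \<open>j\<close> without leaving the polynomial
      ring.\<close>
    define v' where "v' j i = v j0 L * v j i - v j L * v j0 i" for j i
    have "infinite (S - {s. poly (v j0 L) s = 0})"
      using Suc.prems(1) poly_roots_finite[OF j0] by simp
    moreover have "\<exists>c. (\<exists>i<L. c i \<noteq> 0) \<and> (\<forall>j. (\<Sum>i<L. c i * poly (v' j i) s) = 0)"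
      if s: "s \<in> S - {s. poly (v j0 L) s = 0}" for s
    proof -
      obtain c where c: "\<exists>i<Suc L. c i \<noteq> 0" "\<And>j. (\<Sum>i<Suc L. c i * poly (v j i) s) = 0"
        using Suc.prems(2) s by blast
      have "(\<Sum>i<L. c i * poly (v' j i) s) = 0" for j
      proof -
        have "(\<Sum>i<L. c i * poly (v' j i) s) = poly (v j0 L) s * (\<Sum>i<L. c i * poly (v j i) s)
               - poly (v j L) s * (\<Sum>i<L. c i * poly (v j0 i) s)"
          by (simp add: v'_def algebra_simps sum_distrib_left sum_subtractf)
        also have "(\<Sum>i<L. c i * poly (v j i) s) = - c L * poly (v j L) s"
          using c(2)[of j] by (simp add: eq_neg_iff_add_eq_0)
        also have "(\<Sum>i<L. c i * poly (v j0 i) s) = - c L * poly (v j0 L) s"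
          using c(2)[of j0] by (simp add: eq_neg_iff_add_eq_0)
        finally show ?thesis by simp
      qed
      moreover have "\<exists>i<L. c i \<noteq> 0"
      proof (rule ccontr)
        assume "\<not> ?thesis"
        then have "\<And>i. i < L \<Longrightarrow> c i = 0" by blast
        with c(2)[of j0] s have "c L = 0" by simp
        with \<open>\<And>i. i < L \<Longrightarrow> c i = 0\<close> c(1) show False by (metis less_Suc_eq)
      qed
      ultimately show ?thesis by blast
    qed
    ultimately have "\<exists>c. (\<exists>i<L. c i \<noteq> 0) \<and> (\<forall>j. (\<Sum>i<L. c i * v' j i) = 0)"
      by (rule Suc.IH)
    then obtain c where c: "\<exists>i<L. c i \<noteq> 0" "\<And>j. (\<Sum>i<L. c i * v' j i) = 0"
      by blast
    \<comment> \<open>Back substitution: the other unknowns are scaled by the pivot, so that row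
      \<open>j0\<close> can be solved for the last one without division.\<close>
    define c' where "c' i = (if i = L then - (\<Sum>i<L. c i * v j0 i) else v j0 L * c i)" for i
    have "(\<Sum>i<Suc L. c' i * v j i) = 0" for j
    proof -
      have "(\<Sum>i<Suc L. c' i * v j i) = (\<Sum>i<L. c i * v' j i)"
        by (simp add: c'_def v'_def algebra_simps sum_distrib_left sum_subtractf)
      then show ?thesis using c(2) by simp
    qed
    moreover have "\<exists>i<Suc L. c' i \<noteq> 0"
      using c(1) j0 by (auto simp: c'_def intro: less_SucI)
    ultimately show ?thesis by blast
  qed
qed

text \<open>The degree of the polynomial may grow with the index \<open>j\<close> of the
  coefficient; no uniform bound is implied.\<close>

definition poly_family :: "('a::comm_ring_1 \<Rightarrow> 'a fps) \<Rightarrow> bool" where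
  "poly_family F \<longleftrightarrow> (\<forall>j. \<exists>c. \<forall>s. F s $ j = poly c s)"

lemma poly_familyI: "(\<And>j s. F s $ j = poly (c j) s) \<Longrightarrow> poly_family F"
  unfolding poly_family_def by blast

lemma poly_familyE:
  assumes "poly_family F"
  obtains c where "\<And>j s. F s $ j = poly (c j) s"
  using assms unfolding poly_family_def by metis

lemma poly_family_const: "poly_family (\<lambda>_. f)"
  by (rule poly_familyI[where c = "\<lambda>j. [:f $ j:]"]) simp

lemma poly_family_mult:
  assumes "poly_family F" "poly_family G"
  shows "poly_family (\<lambda>s. F s * G s)"
proof -
  obtain a b where "\<And>j s. F s $ j = poly (a j) s" "\<And>j s. G s $ j = poly (b j) s"
    using assms by (auto elim!: poly_familyE)
  then show ?thesis
    by (intro poly_familyI[where c = "\<lambda>j. \<Sum>i=0..j. a i * b (j - i)"])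
       (simp add: fps_mult_nth poly_sum)
qed

lemma poly_family_power: "poly_family F \<Longrightarrow> poly_family (\<lambda>s. F s ^ n)"
  by (induction n) (auto intro: poly_family_const poly_family_mult)

lemma poly_family_deriv:
  assumes "poly_family F"
  shows "poly_family (\<lambda>s. fps_deriv (F s))"
proof -
  obtain a where "\<And>j s. F s $ j = poly (a j) s"
    using assms by (auto elim!: poly_familyE)
  then show ?thesis
    by (intro poly_familyI[where c = "\<lambda>j. of_nat (j+1) * a (j + 1)"]) simp
qed

lemma poly_family_deriv_funpow: "poly_family F \<Longrightarrow> poly_family (\<lambda>s. (fps_deriv ^^ n) (F s))"
  by (induction n) (auto intro: poly_family_deriv)

definition wpoly :: "nat \<Rightarrow> (nat \<Rightarrow> 'a::comm_ring_1 poly) \<Rightarrow> 'a \<Rightarrow> 'a poly" where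
  "wpoly L c s = (\<Sum>i<L. monom (poly (c i) s) i)"

lemma coeff_wpoly: "coeff (wpoly L c s) i = (if i < L then poly (c i) s else 0)"
  by (simp add: wpoly_def coeff_sum)

lemma poly_family_wpoly: "poly_family (\<lambda>s. fps_of_poly (wpoly L c s))"
  by (rule poly_familyI[where c = "\<lambda>j. if j < L then c j else 0"]) (simp add: coeff_wpoly)

text \<open>In this form, being a polynomial of degree at most \<open>n\<close> is a system of
  linear equations in the coefficients, to which elimination applies.\<close>

definition fps_bdd_poly :: "nat \<Rightarrow> 'a::zero fps \<Rightarrow> bool" where
  "fps_bdd_poly n F \<longleftrightarrow> (\<forall>j>n. F $ j = 0)"

lemma fps_bdd_poly_iff: "fps_bdd_poly n (F::'a::comm_ring_1 fps) \<longleftrightarrow> (\<exists>r. degree r \<le> n \<and> F = fps_of_poly r)"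
proof
  assume F: "fps_bdd_poly n F"
  define r where "r = (\<Sum>i\<le>n. monom (F $ i) i)"
  have c: "coeff r i = (if i \<le> n then F $ i else 0)" for i
    by (simp add: r_def coeff_sum)
  have "F = fps_of_poly r"
    using F by (intro fps_ext) (auto simp: c fps_bdd_poly_def)
  moreover have "degree r \<le> n" by (rule degree_le) (auto simp: c)
  ultimately show "\<exists>r. degree r \<le> n \<and> F = fps_of_poly r" by blast
next
  assume "\<exists>r. degree r \<le> n \<and> F = fps_of_poly r"
  then show "fps_bdd_poly n F"
    by (auto simp: fps_bdd_poly_def coeff_eq_0)
qed

text \<open>Vanishing of all coefficients beyond \<open>n\<close> is a homogeneous linear system for
  the \<open>c i\<close> whose entries are polynomials in \<open>s\<close>. A polynomial solution
  satisfies it identically, hence at every \<open>s\<close> and not merely on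
  \<open>S\<close>.\<close>

lemma poly_family_combination:
  fixes F :: "nat \<Rightarrow> 'a::field \<Rightarrow> 'a fps"
  assumes "\<And>i. poly_family (F i)" and "infinite S"
    and "\<And>s. s \<in> S \<Longrightarrow> \<exists>c. (\<exists>i<L. c i \<noteq> 0) \<and> fps_bdd_poly n (\<Sum>i<L. fps_const (c i) * F i s)"
  obtains c where "\<exists>i<L. c i \<noteq> 0"
    "\<And>s. fps_bdd_poly n (\<Sum>i<L. fps_const (poly (c i) s) * F i s)"
proof -
  obtain a where a: "\<And>i j s. F i s $ j = poly (a i j) s"
    using assms(1) unfolding poly_family_def by metis
  define v where "v j i = a i (n + 1 + j)" for i j
  have eq: "fps_bdd_poly n (\<Sum>i<L. fps_const (c i) * F i s) \<longleftrightarrow>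
      (\<forall>j. (\<Sum>i<L. c i * poly (v j i) s) = 0)" (is "?l \<longleftrightarrow> ?r") for c s
  proof -
    have nth: "(\<Sum>i<L. fps_const (c i) * F i s) $ j = (\<Sum>i<L. c i * poly (a i j) s)" for j
      by (simp add: fps_sum_nth a)
    have "?l \<longleftrightarrow> (\<forall>j>n. (\<Sum>i<L. c i * poly (a i j) s) = 0)"
      unfolding fps_bdd_poly_def nth ..
    also have "\<dots> \<longleftrightarrow> ?r"
    proof
      assume r: ?r
      show "\<forall>j>n. (\<Sum>i<L. c i * poly (a i j) s) = 0"
      proof (intro allI impI)
        fix j assume "n < j"
        then have "j = n + 1 + (j - n - 1)" by simp
        with r show "(\<Sum>i<L. c i * poly (a i j) s) = 0" unfolding v_def by metis
      qed
    qed (simp add: v_def)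
    finally show ?thesis .
  qed
  obtain c where c: "\<exists>i<L. c i \<noteq> 0" "\<And>j. (\<Sum>i<L. c i * v j i) = 0"
    using poly_solution_of_pointwise_solutions[OF assms(2), of L v] assms(3) unfolding eq by blast
  have "(\<Sum>i<L. poly (c i) s * poly (v j i) s) = 0" for j s
    using arg_cong[OF c(2)[of j], of "\<lambda>p. poly p s"] by (simp add: poly_sum)
  then have "fps_bdd_poly n (\<Sum>i<L. fps_const (poly (c i) s) * F i s)" for s
    unfolding eq by blast
  with c(1) show thesis by (rule that)
qed

text \<open>The logarithm \<open>log ((1 - b w) / (1 - a w))\<close>.\<close>

definition log_fps :: "complex \<Rightarrow> complex \<Rightarrow> complex fps" where
  "log_fps a b = Abs_fps (\<lambda>j. (a ^ j - b ^ j) / of_nat j)"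

definition lin2 :: "complex \<Rightarrow> complex \<Rightarrow> complex poly" where
  "lin2 a b = [:1, -a:] * [:1, -b:]"

lemma fps_lin_mult_nth:
  "(fps_of_poly [:1, -a:] * G) $ j = G $ j - (if j = 0 then 0 else a * G $ (j - 1))"
  for a :: complex
proof -
  have "fps_of_poly [:1, -a:] = 1 - fps_const a * fps_X"
    by (rule fps_ext) (auto simp: coeff_pCons fps_X_nth split: nat.split)
  then have "fps_of_poly [:1, -a:] * G = G - fps_const a * (fps_X * G)"
    by (simp only: left_diff_distrib mult.assoc mult_1)
  then show ?thesis
    by simp
qed

text \<open>The derivative of the logarithm is \<open>a / (1 - a w) - b / (1 - b w)\<close>, and
  \<open>lin2 a b\<close> is the common denominator.\<close>

lemma fps_deriv_log_fps: "fps_of_poly (lin2 a b) * fps_deriv (log_fps a b) = fps_const (a - b)"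
proof (rule fps_ext)
  fix j :: nat
  have d: "fps_deriv (log_fps a b) $ j = a ^ (j+1) - b ^ (j+1)" for j
    by (simp add: log_fps_def del: of_nat_Suc)
  have e: "fps_of_poly (lin2 a b) * fps_deriv (log_fps a b) =
      fps_of_poly [:1, -a:] * (fps_of_poly [:1, -b:] * fps_deriv (log_fps a b))"
    by (simp only: lin2_def fps_of_poly_mult mult.assoc)
  show "(fps_of_poly (lin2 a b) * fps_deriv (log_fps a b)) $ j = fps_const (a - b) $ j"
    unfolding e fps_lin_mult_nth d
    by (cases j; cases "j - 1") (simp_all add: algebra_simps)
qed

section \<open>Series of the form logarithm times rational function\<close>

lemma fps_of_poly_mult_cancel:
  fixes p q r :: "complex poly"
  assumes "p \<noteq> 0" "fps_of_poly (p * q) * F = fps_of_poly (p * r)"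
  shows "fps_of_poly q * F = fps_of_poly r"
  using assms by (simp add: fps_of_poly_mult mult.assoc)

lemma pderiv_linear_power_mult:
  fixes y :: "complex poly"
  shows "pderiv ([:-z, 1:] ^ Suc k * y) = [:-z, 1:] ^ k * (smult (of_nat (Suc k)) y + [:-z, 1:] * pderiv y)"
proof -
  have "pderiv ([:-z, 1:] ^ Suc k) = smult (of_nat (Suc k)) ([:-z, 1:] ^ k)"
    by (simp add: pderiv_power_Suc pderiv_pCons del: power_Suc of_nat_Suc)
  then have "pderiv ([:-z, 1:] ^ Suc k * y) =
      [:-z, 1:] ^ Suc k * pderiv y + y * smult (of_nat (Suc k)) ([:-z, 1:] ^ k)"
    by (simp only: pderiv_mult)
  then show ?thesis
    by (simp only: power_Suc2 ring_distribs mult_smult_left mult_smult_right mult_ac add.commute)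
qed

lemma root_multiplicity_decomp:
  fixes p :: "complex poly"
  assumes "p \<noteq> 0" "poly p z = 0"
  obtains k y where "p = [:-z, 1:] ^ Suc k * y" "poly y z \<noteq> 0"
proof -
  obtain y where y: "p = [:-z, 1:] ^ order z p * y" "\<not> [:-z, 1:] dvd y"
    using order_decomp[OF assms(1)] by blast
  have "order z p \<noteq> 0" using assms order_root by blast
  then obtain k where "order z p = Suc k" using not0_implies_Suc by blast
  with y that show thesis by (auto simp: poly_eq_0_iff_dvd)
qed

lemma lin2_root:
  assumes "a \<noteq> 0"
  shows "lin2 a b = [:- inverse a, 1:] * smult (-a) [:1, -b:]"
  using assms by (simp add: lin2_def)

lemma fps_const_eq_of_poly: "fps_const c = fps_of_poly [:c:]"
  by (simp add: fps_of_poly_const)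

text \<open>Compare orders of vanishing at the singularity \<open>1 / a\<close>. The differentiated
  relation forces \<open>\<alpha>\<close> to vanish there. If \<open>\<beta>\<close> vanishes as
  well, a common factor can be cancelled and the degree of \<open>\<alpha>\<close> drops; otherwise
  the orders of the two sides disagree.\<close>

lemma log_fps_transcendental:
  fixes a b :: complex
  assumes ab: "a \<noteq> 0" "a \<noteq> b"
    and eq: "fps_of_poly \<alpha> * log_fps a b = fps_of_poly \<beta>"
  shows "\<alpha> = 0"
  using eq
proof (induction "degree \<alpha>" arbitrary: \<alpha> \<beta> rule: less_induct)
  case less
  define z where "z = inverse a"
  define x where "x = [:-z, 1:]"
  have x0: "x \<noteq> 0" and xz: "poly x z = 0" by (simp_all add: x_def)
  define e where "e = lin2 a b"
  have e: "e = x * smult (-a) [:1, -b:]"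
    unfolding e_def x_def z_def by (rule lin2_root[OF ab(1)])
  show ?case
  proof (rule ccontr)
    assume "\<alpha> \<noteq> 0"
    \<comment> \<open>Differentiate \<open>\<alpha> L = \<beta>\<close> and eliminate
      \<open>L\<close> itself; only its rational derivative remains.\<close>
    have *: "smult (a - b) (\<alpha> * \<alpha>) = (pderiv \<beta> * \<alpha> - pderiv \<alpha> * \<beta>) * e"
    proof -
      let ?L = "log_fps a b"
      have "fps_of_poly (pderiv \<beta>) = fps_deriv (fps_of_poly \<alpha> * ?L)"
        unfolding less.prems by (simp add: fps_of_poly_pderiv)
      then have "fps_of_poly (pderiv \<beta>) = fps_of_poly \<alpha> * fps_deriv ?L + fps_of_poly (pderiv \<alpha>) * ?L"
        by (simp add: fps_of_poly_pderiv)
      then have "fps_of_poly (pderiv \<beta> * \<alpha> * e) = fps_of_poly (\<alpha> * \<alpha>) * (fps_of_poly e * fps_deriv ?L)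
          + fps_of_poly (pderiv \<alpha> * e) * (fps_of_poly \<alpha> * ?L)"
        by (simp add: fps_of_poly_mult algebra_simps)
      then have "fps_of_poly (pderiv \<beta> * \<alpha> * e) =
          fps_of_poly (\<alpha> * \<alpha> * [:a - b:] + pderiv \<alpha> * e * \<beta>)"
        unfolding e_def fps_deriv_log_fps less.prems
        by (simp add: fps_const_eq_of_poly fps_of_poly_mult fps_of_poly_add)
      then have "pderiv \<beta> * \<alpha> * e = \<alpha> * \<alpha> * [:a - b:] + pderiv \<alpha> * e * \<beta>"
        by (simp only: fps_of_poly_eq_iff)
      then show ?thesis by (simp add: algebra_simps)
    qed
    have "(a - b) * poly \<alpha> z ^ 2 = 0"
      using arg_cong[OF *, of "\<lambda>p. poly p z"] by (simp add: e xz power2_eq_square)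
    then have az: "poly \<alpha> z = 0" using ab by simp
    obtain k y where y: "\<alpha> = x ^ Suc k * y" "poly y z \<noteq> 0"
      using root_multiplicity_decomp[OF \<open>\<alpha> \<noteq> 0\<close> az] unfolding x_def by metis
    show False
    proof (cases "poly \<beta> z = 0")
      case True
      then obtain \<beta>' where b': "\<beta> = x * \<beta>'"
        unfolding x_def poly_eq_0_iff_dvd by (auto elim: dvdE)
      define \<alpha>' where "\<alpha>' = x ^ k * y"
      have a': "\<alpha> = x * \<alpha>'" by (simp add: y \<alpha>'_def)
      have "\<alpha>' \<noteq> 0" using \<open>\<alpha> \<noteq> 0\<close> a' by auto
      have "degree \<alpha>' < degree \<alpha>"
        unfolding a' using \<open>\<alpha>' \<noteq> 0\<close> x0 by (subst degree_mult_eq) (auto simp: x_def)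
      moreover have "fps_of_poly \<alpha>' * log_fps a b = fps_of_poly \<beta>'"
        using less.prems unfolding a' b' by (rule fps_of_poly_mult_cancel[OF x0])
      ultimately have "\<alpha>' = 0" by (rule less.hyps)
      with \<open>\<alpha>' \<noteq> 0\<close> show False ..
    next
      case False
      \<comment> \<open>\<open>w\<close> is the cofactor in
        \<open>pderiv \<alpha> = x ^ k * w\<close> and does not vanish at \<open>z\<close>. The left
        side of \<open>*\<close> has order \<open>2 * (k + 1)\<close> at \<open>z\<close>, the right
        side only \<open>k + 1\<close>.\<close>
      define w where "w = smult (of_nat (Suc k)) y + x * pderiv y"
      have pd: "pderiv \<alpha> = x ^ k * w"
        unfolding y w_def x_def by (rule pderiv_linear_power_mult)
      have "x ^ Suc k * smult (a - b) (x ^ Suc k * y * y) =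
          x ^ Suc k * ((pderiv \<beta> * x * y - w * \<beta>) * smult (-a) [:1, -b:])"
        using * unfolding pd e unfolding y by (simp add: algebra_simps)
      then have "smult (a - b) (x ^ Suc k * y * y) = (pderiv \<beta> * x * y - w * \<beta>) * smult (-a) [:1, -b:]"
        using x0 by (simp only: mult_cancel_left) auto
      from arg_cong[OF this, of "\<lambda>p. poly p z"]
      have "0 = - (poly w z * poly \<beta> z) * (- a * (1 - b * z))"
        by (simp only: poly_smult poly_mult poly_diff xz poly_power)
           (simp add: xz algebra_simps)
      moreover have "1 - b * z \<noteq> 0" using ab by (auto simp: z_def field_simps)
      moreover have "poly w z \<noteq> 0" using y(2) by (simp add: w_def xz del: of_nat_Suc)
      ultimately show False using False ab by simp
    qed
  qed
qed

text \<open>Solve for \<open>L = (\<beta> f - c) / \<alpha>\<close>, differentiate, and clear the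
  denominators \<open>\<alpha>\<close> squared and \<open>lin2 a b\<close>.\<close>

lemma log_rational_ode:
  fixes f :: "complex fps"
  assumes f: "fps_of_poly \<beta> * f = fps_of_poly \<alpha> * log_fps a b + fps_of_poly c"
  shows "fps_of_poly (lin2 a b * \<alpha> * \<beta>) * fps_deriv f
       + fps_of_poly (lin2 a b * (\<alpha> * pderiv \<beta> - pderiv \<alpha> * \<beta>)) * f
       = fps_of_poly (lin2 a b * (\<alpha> * pderiv c - pderiv \<alpha> * c) + smult (a - b) (\<alpha> * \<alpha>))"
proof -
  let ?L = "log_fps a b" and ?p = fps_of_poly
  have "fps_deriv (?p \<beta> * f) = fps_deriv (?p \<alpha> * ?L + ?p c)"
    unfolding f ..
  then have d: "?p \<beta> * fps_deriv f + ?p (pderiv \<beta>) * f =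
      ?p \<alpha> * fps_deriv ?L + ?p (pderiv \<alpha>) * ?L + ?p (pderiv c)"
    by (simp add: fps_of_poly_pderiv)
  have "?p (lin2 a b * \<alpha> * \<beta>) * fps_deriv f + ?p (lin2 a b * (\<alpha> * pderiv \<beta> - pderiv \<alpha> * \<beta>)) * f
     = ?p (lin2 a b) * ?p \<alpha> * (?p \<beta> * fps_deriv f + ?p (pderiv \<beta>) * f) - ?p (lin2 a b) * ?p (pderiv \<alpha>) * (?p \<beta> * f)"
    by (simp add: fps_of_poly_mult fps_of_poly_diff algebra_simps)
  also have "\<dots> = ?p \<alpha> * ?p \<alpha> * (?p (lin2 a b) * fps_deriv ?L) + ?p (lin2 a b) * (?p \<alpha> * ?p (pderiv c) - ?p (pderiv \<alpha>) * ?p c)"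
    unfolding d f by (simp add: algebra_simps)
  also have "\<dots> = ?p \<alpha> * ?p \<alpha> * ?p [:a - b:] + ?p (lin2 a b) * (?p \<alpha> * ?p (pderiv c) - ?p (pderiv \<alpha>) * ?p c)"
    unfolding fps_deriv_log_fps fps_const_eq_of_poly ..
  also have "\<dots> = ?p (\<alpha> * \<alpha> * [:a - b:] + lin2 a b * (\<alpha> * pderiv c - pderiv \<alpha> * c))"
    by (simp only: fps_of_poly_mult fps_of_poly_diff fps_of_poly_add)
  also have "\<alpha> * \<alpha> * [:a - b:] = smult (a - b) (\<alpha> * \<alpha>)" by simp
  finally show ?thesis by (simp only: add.commute)
qed

text \<open>If \<open>f\<close> were rational, the logarithm would be rational too.\<close>

lemma log_rational_transcendental:
  fixes f :: "complex fps"
  assumes ab: "a \<noteq> 0" "a \<noteq> b" and "\<alpha> \<noteq> 0"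
    and f: "fps_of_poly \<beta> * f = fps_of_poly \<alpha> * log_fps a b + fps_of_poly c"
    and uv: "fps_of_poly u * f = fps_of_poly v"
  shows "u = 0"
proof -
  let ?p = fps_of_poly
  have "?p u * (?p \<beta> * f) = ?p \<beta> * (?p u * f)" by (simp only: mult_ac)
  then have "?p (u * \<alpha>) * log_fps a b = ?p (\<beta> * v - u * c)"
    unfolding f uv by (simp add: fps_of_poly_mult fps_of_poly_diff algebra_simps)
  then have "u * \<alpha> = 0" using log_fps_transcendental ab by blast
  with \<open>\<alpha> \<noteq> 0\<close> show ?thesis by simp
qed

text \<open>Eliminating \<open>f'\<close> between this equation and that of
  \<open>log_rational_ode\<close> leaves a polynomial multiple of \<open>f\<close> equal to a
  polynomial, so the multiplier is zero. Thus \<open>q / p\<close> has to be the logarithmic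
  derivative of \<open>\<beta> / \<alpha>\<close>.\<close>

lemma log_rational_ode_unique:
  fixes f :: "complex fps"
  assumes ab: "a \<noteq> 0" "a \<noteq> b" and nz: "\<alpha> \<noteq> 0" "\<beta> \<noteq> 0"
    and f: "fps_of_poly \<beta> * f = fps_of_poly \<alpha> * log_fps a b + fps_of_poly c"
    and ode: "fps_of_poly p * fps_deriv f + fps_of_poly q * f = fps_of_poly r"
  shows "q * (\<alpha> * \<beta>) = p * (\<alpha> * pderiv \<beta> - pderiv \<alpha> * \<beta>)"
proof -
  let ?p = fps_of_poly
  define e where "e = lin2 a b"
  have "e \<noteq> 0" by (simp add: e_def lin2_def)
  define w where "w = \<alpha> * pderiv \<beta> - pderiv \<alpha> * \<beta>"
  obtain s where s: "?p (e * \<alpha> * \<beta>) * fps_deriv f + ?p (e * w) * f = ?p s"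
    using log_rational_ode[OF f] unfolding e_def w_def by blast
  have "?p (q * (e * \<alpha> * \<beta>) - p * (e * w)) * f =
     ?p (e * \<alpha> * \<beta>) * (?p p * fps_deriv f + ?p q * f) - ?p p * (?p (e * \<alpha> * \<beta>) * fps_deriv f + ?p (e * w) * f)"
    by (simp add: fps_of_poly_mult fps_of_poly_diff algebra_simps)
  also have "\<dots> = ?p (e * \<alpha> * \<beta> * r - p * s)"
    unfolding ode s by (simp add: fps_of_poly_mult fps_of_poly_diff)
  finally have "q * (e * \<alpha> * \<beta>) - p * (e * w) = 0"
    using log_rational_transcendental[OF ab nz(1) f] by blast
  then have "e * (q * (\<alpha> * \<beta>)) = e * (p * w)" by (simp add: algebra_simps)
  with \<open>e \<noteq> 0\<close> show ?thesis by (simp add: w_def)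
qed

text \<open>At such a root the logarithmic derivative of \<open>\<beta> / \<alpha>\<close> has a
  simple pole, which only a root of the denominator \<open>p\<close> can produce.\<close>

lemma log_derivative_pole:
  fixes p q \<alpha> \<beta> :: "complex poly"
  assumes eq: "q * (\<alpha> * \<beta>) = p * (\<alpha> * pderiv \<beta> - pderiv \<alpha> * \<beta>)"
    and "\<beta> \<noteq> 0" "poly \<beta> z = 0" "poly \<alpha> z \<noteq> 0"
  shows "poly p z = 0"
proof -
  define x where "x = [:-z, 1:]"
  have x0: "x \<noteq> 0" and xz: "poly x z = 0" by (simp_all add: x_def)
  obtain k y where y: "\<beta> = x ^ Suc k * y" "poly y z \<noteq> 0"
    using root_multiplicity_decomp[OF assms(2,3)] unfolding x_def by metis
  define w where "w = smult (of_nat (Suc k)) y + x * pderiv y"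
  have pd: "pderiv \<beta> = x ^ k * w"
    unfolding y w_def x_def by (rule pderiv_linear_power_mult)
  have "x ^ k * (q * \<alpha> * x * y) = x ^ k * (p * (\<alpha> * w - pderiv \<alpha> * x * y))"
    using eq unfolding pd unfolding y by (simp add: algebra_simps)
  then have "q * \<alpha> * x * y = p * (\<alpha> * w - pderiv \<alpha> * x * y)"
    using x0 by (simp only: mult_cancel_left) auto
  then have "0 = poly p z * (poly \<alpha> z * poly w z)"
    by (auto dest: arg_cong[where f = "\<lambda>p. poly p z"] simp: xz)
  moreover have "poly w z \<noteq> 0" using y(2) by (simp add: w_def xz del: of_nat_Suc)
  ultimately show ?thesis using assms(4) by simp
qed

text \<open>By Leibniz, the logarithm keeps the factor \<open>(pderiv ^^ n) \<eta>\<close>, which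
  vanishes for \<open>n > degree \<eta>\<close>. All other terms contain a derivative of
  \<open>L\<close> and have poles of order at most \<open>n\<close> at \<open>1 / a\<close> and
  \<open>1 / b\<close>.\<close>

lemma lin2_power_deriv_log:
  fixes \<eta> :: "complex poly"
  shows "\<exists>r. degree r \<le> degree \<eta> + 2 * n \<and>
     fps_of_poly (lin2 a b ^ n) * (fps_deriv ^^ n) (fps_of_poly \<eta> * log_fps a b) =
     fps_of_poly (lin2 a b ^ n * (pderiv ^^ n) \<eta>) * log_fps a b + fps_of_poly r"
proof (induction n)
  case 0
  then show ?case by (intro exI[of _ 0]) simp
next
  case (Suc n)
  let ?p = fps_of_poly and ?L = "log_fps a b"
  define e where "e = lin2 a b"
  define F where "F = (fps_deriv ^^ n) (?p \<eta> * ?L)"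
  define h where "h = (pderiv ^^ n) \<eta>"
  obtain r where r: "degree r \<le> degree \<eta> + 2 * n" "?p (e ^ n) * F = ?p (e ^ n * h) * ?L + ?p r"
    using Suc unfolding e_def F_def h_def by blast
  \<comment> \<open>Chosen so that \<open>e * pderiv (e ^ n) = w * e ^ n\<close>: one further factor
    \<open>e\<close> clears the denominators after each differentiation.\<close>
  define w where "w = smult (of_nat n) (pderiv e)"
  define r' where "r' = smult (a - b) (e ^ n * h) + e * pderiv r - w * r"
  have eL: "?p e * fps_deriv ?L = ?p [:a-b:]"
    unfolding e_def fps_deriv_log_fps fps_const_eq_of_poly ..
  have pe: "e * pderiv (e ^ n) = w * e ^ n"
    unfolding w_def by (cases n) (simp_all add: pderiv_power_Suc mult_ac del: of_nat_Suc power_Suc, simp add: mult_ac)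
  have hdeg: "degree h \<le> degree \<eta>"
    unfolding h_def by (induction n) (auto simp: degree_pderiv)
  have d: "?p (e ^ n) * fps_deriv F + ?p (pderiv (e^n)) * F =
      ?p (e^n * h) * fps_deriv ?L + ?p (pderiv (e ^ n) * h + e ^ n * pderiv h) * ?L + ?p (pderiv r)"
    using arg_cong[OF r(2), of fps_deriv]
    by (simp only: fps_deriv_mult fps_deriv_add fps_of_poly_pderiv[symmetric] pderiv_mult)
       (simp add: fps_of_poly_add fps_of_poly_mult algebra_simps)
  have "?p (e ^ Suc n) * fps_deriv F =
     ?p e * (?p (e ^ n) * fps_deriv F + ?p (pderiv (e^n)) * F) - ?p (e * pderiv (e ^ n)) * F"
    by (simp add: fps_of_poly_mult algebra_simps)
  also have "\<dots> = ?p (e^n * h) * (?p e * fps_deriv ?L) + ?p (e * pderiv (e ^ n) * h + e ^ Suc n * pderiv h) * ?L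
       + ?p (e * pderiv r) - ?p w * (?p (e ^ n) * F)"
    unfolding d pe fps_of_poly_mult fps_of_poly_add power_Suc
    using arg_cong[OF pe, of "\<lambda>p. ?p p * ?p h * ?L"]
    by (simp add: fps_of_poly_mult algebra_simps)
  also have "\<dots> = ?p (e ^ Suc n * pderiv h) * ?L + ?p r'"
    unfolding eL r(2) pe r'_def
    by (simp add: fps_of_poly_mult fps_of_poly_add fps_of_poly_diff algebra_simps fps_of_poly_smult fps_of_poly_const)
  finally have "?p (e ^ Suc n) * fps_deriv F = ?p (e ^ Suc n * pderiv h) * ?L + ?p r'" .
  moreover have "degree r' \<le> degree \<eta> + 2 * Suc n"
  proof -
    have de: "degree e \<le> 2" by (simp add: e_def lin2_def)
    have "degree (e ^ n * h) \<le> 2 * n + degree \<eta>"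
      using degree_mult_le[of "e^n" h] degree_power_le[of e n] de hdeg
      by (metis (no_types, lifting) add_mono le_trans mult.commute mult_le_mono1)
    moreover have "degree (e * pderiv r) \<le> 2 + degree r"
      using degree_mult_le[of e "pderiv r"] de by (simp add: degree_pderiv)
    moreover have "degree (w * r) \<le> 2 + degree r"
      using degree_mult_le[of w r] degree_smult_le[of "of_nat n" "pderiv e"] de
      by (simp add: degree_pderiv w_def)
    ultimately show ?thesis using r(1) unfolding r'_def
      by (intro degree_diff_le degree_add_le) (auto intro: order_trans[OF degree_smult_le])
  qed
  ultimately show ?case
    by (intro exI[of _ r']) (simp add: e_def F_def h_def)
qed

section \<open>Minimal denominators\<close>

lemma cofinite_continuous_le:
  fixes f g :: "complex \<Rightarrow> real"
  assumes "finite X" "continuous_on UNIV f" "continuous_on UNIV g" "\<And>s. s \<notin> X \<Longrightarrow> f s \<le> g s"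
  shows "f s \<le> g s"
proof -
  have "closure (- X) = UNIV"
    using assms(1) by (simp add: closure_complement empty_interior_finite)
  moreover have "continuous_on (closure (- X)) (\<lambda>s. g s - f s)"
    using assms(2,3) by (auto intro!: continuous_on_diff intro: continuous_on_subset)
  moreover have "(\<lambda>s. g s - f s) ` (- X) \<subseteq> {0..}" using assms(4) by auto
  ultimately have "range (\<lambda>s. g s - f s) \<subseteq> {0..}"
    using image_closure_subset[of "- X" "\<lambda>s. g s - f s" "{0..}"] by auto
  then show ?thesis by (auto simp: image_subset_iff)
qed

lemma poly_root_exists:
  fixes p :: "complex poly"
  assumes "Suc n = degree p"
  shows "\<exists>z. poly p z = 0"
  using assms by (intro fundamental_theorem_of_algebra) (simp add: constant_degree)

text \<open>Liouville's theorem for polynomial growth; outside the unit disc the bound is at most a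
  multiple of \<open>|s| ^ i\<close>.\<close>

lemma poly_growth_degree:
  assumes "\<And>s. cmod (poly e s) \<le> C * (1 + cmod s) ^ i"
  shows "degree e \<le> i"
proof -
  have C: "C \<ge> 0" using order_trans[OF norm_ge_zero assms[of 0]] by simp
  have "cmod (poly e s) \<le> (C * 2 ^ i) * cmod s ^ i" if "1 \<le> cmod s" for s
  proof -
    have "(1 + cmod s) ^ i \<le> (2 * cmod s) ^ i" using that by (intro power_mono) auto
    then have "C * (1 + cmod s) ^ i \<le> C * (2 * cmod s) ^ i" using C by (intro mult_left_mono)
    then show ?thesis using assms[of s] by (simp add: power_mult_distrib mult.assoc)
  qed
  then have "poly e s = (\<Sum>k\<le>i. (deriv ^^ k) (poly e) 0 / fact k * s ^ k)" for s
    by (intro Liouville_polynomial) (auto intro: holomorphic_intros)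
  then have "poly e = poly (\<Sum>k\<le>i. monom ((deriv ^^ k) (poly e) 0 / fact k) k)"
    by (auto simp: poly_sum poly_monom fun_eq_iff)
  then have e: "e = (\<Sum>k\<le>i. monom ((deriv ^^ k) (poly e) 0 / fact k) k)"
    by (simp only: poly_eq_poly_eq_iff)
  show ?thesis
    by (subst e, rule degree_sum_le) (auto intro: order_trans[OF degree_monom_le])
qed

text \<open>The quotient \<open>a / b\<close> stays bounded near the roots of \<open>b\<close>, so
  it is entire, and of polynomial growth. The induction removes one root of \<open>b\<close> at a
  time; cancelling a linear factor costs the inequality at that root, which is why a finite
  exceptional set is carried along and filled in by continuity.\<close>

lemma poly_growth_dvd:
  assumes "b \<noteq> 0" "finite X" "\<And>s. s \<notin> X \<Longrightarrow> cmod (poly a s) \<le> C * (1 + cmod s) ^ i * cmod (poly b s)"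
  shows "\<exists>e. a = b * e \<and> degree e \<le> i"
  using assms
proof (induction "degree b" arbitrary: a b X)
  case 0
  then obtain c where c: "b = [:c:]" "c \<noteq> 0" by (metis degree_eq_zeroE pCons_0_0)
  have "cmod (poly a s) \<le> C * (1 + cmod s) ^ i * cmod (poly b s)" for s
    by (rule cofinite_continuous_le[OF 0(3)]) (auto intro!: continuous_intros 0(4))
  then have "cmod (poly (smult (inverse c) a) s) \<le> C * (1 + cmod s) ^ i" for s
    using c by (simp add: norm_mult norm_inverse norm_divide field_simps)
  then have "degree (smult (inverse c) a) \<le> i" by (rule poly_growth_degree)
  then show ?case using c by (intro exI[of _ "smult (inverse c) a"]) simp
next
  case (Suc n)
  have bd: "cmod (poly a s) \<le> C * (1 + cmod s) ^ i * cmod (poly b s)" for s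
    by (rule cofinite_continuous_le[OF Suc.prems(2)]) (auto intro!: continuous_intros Suc.prems(3))
  obtain z where z: "poly b z = 0"
    using poly_root_exists Suc.hyps(2) by metis
  have "poly a z = 0" using bd[of z] z by simp
  with z obtain a' b' where ab: "a = [:-z, 1:] * a'" "b = [:-z, 1:] * b'"
    unfolding poly_eq_0_iff_dvd by (meson dvdE)
  have "b' \<noteq> 0" using Suc.prems(1) ab by auto
  then have "degree b = Suc (degree b')" unfolding ab by (subst degree_mult_eq) auto
  then have "n = degree b'" using Suc.hyps(2) by simp
  moreover have "cmod (poly a' s) \<le> C * (1 + cmod s) ^ i * cmod (poly b' s)" if "s \<notin> {z}" for s
  proof -
    have "cmod (s - z) * cmod (poly a' s) \<le> cmod (s - z) * (C * (1 + cmod s) ^ i * cmod (poly b' s))"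
      using bd[of s] unfolding ab poly_mult by (simp add: norm_mult mult_ac)
    then show ?thesis using that by (subst (asm) mult_le_cancel_left_pos) auto
  qed
  ultimately obtain e where "a' = b' * e" "degree e \<le> i"
    using Suc.hyps(1)[of b' "{z}" a'] \<open>b' \<noteq> 0\<close> by auto
  then show ?case unfolding ab by (intro exI[of _ e]) (simp only: mult.assoc simp_thms)
qed

text \<open>Relative to the constant coefficient, the others are elementary symmetric functions of
  the reciprocal roots, up to sign. These have modulus at most \<open>R\<close>, and there are at
  most \<open>2 ^ degree p\<close> products.\<close>

lemma coeff_bound_of_large_roots:
  fixes p :: "complex poly"
  assumes "p \<noteq> 0" "R \<ge> 0" "\<And>z. poly p z = 0 \<Longrightarrow> 1 \<le> R * cmod z"
  shows "cmod (coeff p i) \<le> 2 ^ degree p * R ^ i * cmod (coeff p 0)"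
  using assms(1,3)
proof (induction "degree p" arbitrary: p i)
  case 0
  then obtain c where c: "p = [:c:]" by (metis degree_eq_zeroE)
  show ?case using c \<open>R \<ge> 0\<close> by (cases i) auto
next
  case (Suc n)
  obtain z where z: "poly p z = 0"
    using poly_root_exists Suc.hyps(2) by metis
  then obtain q0 where q0: "p = [:-z, 1:] * q0"
    unfolding poly_eq_0_iff_dvd by (meson dvdE)
  have Rz: "1 \<le> R * cmod z" using Suc.prems z by blast
  then have "z \<noteq> 0" by auto
  define u where "u = inverse z"
  define q where "q = smult (-z) q0"
  have "[:-z, 1:] = smult (-z) [:1, -u:]" using \<open>z \<noteq> 0\<close> by (simp add: u_def)
  then have p: "p = [:1, -u:] * q" unfolding q0 q_def by (simp only: mult_smult_left mult_smult_right)
  have u: "cmod u \<le> R" using Rz \<open>z \<noteq> 0\<close> by (simp add: u_def norm_inverse norm_divide field_simps)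
  have "q \<noteq> 0" using p Suc.prems by auto
  have "u \<noteq> 0" using \<open>z \<noteq> 0\<close> by (simp add: u_def)
  have dp: "degree p = Suc (degree q)" unfolding p using \<open>q \<noteq> 0\<close> \<open>u \<noteq> 0\<close> by (subst degree_mult_eq) auto
  have IH: "cmod (coeff q i) \<le> 2 ^ degree q * R ^ i * cmod (coeff q 0)" for i
    using Suc.hyps dp \<open>q \<noteq> 0\<close> Suc.prems(2) by (auto simp: p)
  show ?case
  proof (cases i)
    case 0
    then show ?thesis using one_le_power[of "2::real" "Suc (degree q)"] unfolding dp
      by (simp add: p mult_le_cancel_right1)
  next
    case (Suc j)
    have "cmod (coeff p i) = cmod (coeff q i - u * coeff q j)"
      by (simp add: p Suc)
    also have "\<dots> \<le> cmod (coeff q i) + cmod u * cmod (coeff q j)"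
      by (metis norm_mult norm_triangle_ineq4)
    also have "\<dots> \<le> 2 ^ degree q * R ^ i * cmod (coeff q 0) + R * (2 ^ degree q * R ^ j * cmod (coeff q 0))"
      using IH u \<open>R \<ge> 0\<close> by (intro add_mono mult_mono) auto
    also have "\<dots> = 2 ^ degree p * R ^ i * cmod (coeff p 0)"
      unfolding dp by (simp add: Suc p algebra_simps)
    finally show ?thesis .
  qed
qed

lemma remove_common_root:
  fixes g :: "complex fps"
  assumes "fps_of_poly \<gamma> * g = fps_of_poly \<delta>" "\<gamma> \<noteq> 0" "poly \<gamma> z = 0" "poly \<delta> z = 0"
  obtains \<gamma>' \<delta>' where "\<gamma>' \<noteq> 0" "degree \<gamma>' < degree \<gamma>" "fps_of_poly \<gamma>' * g = fps_of_poly \<delta>'" "degree \<delta>' \<le> degree \<delta>"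
proof -
  obtain \<gamma>' \<delta>' where eq: "\<gamma> = [:-z, 1:] * \<gamma>'" "\<delta> = [:-z, 1:] * \<delta>'"
    using assms(3,4) unfolding poly_eq_0_iff_dvd by (meson dvdE)
  have "\<gamma>' \<noteq> 0" using assms(2) eq by auto
  moreover have "degree \<gamma> = Suc (degree \<gamma>')"
    unfolding eq using \<open>\<gamma>' \<noteq> 0\<close> by (subst degree_mult_eq) auto
  moreover have "fps_of_poly \<gamma>' * g = fps_of_poly \<delta>'"
    using assms(1) unfolding eq by (rule fps_of_poly_mult_cancel[rotated]) simp
  moreover have "degree \<delta>' \<le> degree \<delta>"
    unfolding eq by (cases "\<delta>' = 0") (auto simp: degree_mult_eq simp del: mult_pCons_left)
  ultimately show thesis by (intro that) auto
qed

text \<open>The bound \<open>n\<close> on the degree of the numerator is fixed in advance, so that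
  for a bounded degree of \<open>\<gamma>\<close> the condition is linear in finitely many
  unknowns.\<close>

definition denominator_of :: "nat \<Rightarrow> complex fps \<Rightarrow> complex poly \<Rightarrow> bool" where
  "denominator_of n g \<gamma> \<longleftrightarrow> \<gamma> \<noteq> 0 \<and> fps_bdd_poly n (fps_of_poly \<gamma> * g)"

definition minimal_denominator :: "nat \<Rightarrow> complex fps \<Rightarrow> complex poly \<Rightarrow> bool" where
  "minimal_denominator n g \<gamma> \<longleftrightarrow> denominator_of n g \<gamma> \<and> (\<forall>\<gamma>'. denominator_of n g \<gamma>' \<longrightarrow> degree \<gamma> \<le> degree \<gamma>')"

lemma minimal_denominator_no_common_root:
  assumes "minimal_denominator n g \<gamma>" "poly \<gamma> z = 0" "fps_of_poly \<gamma> * g = fps_of_poly \<delta>"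
  shows "poly \<delta> z \<noteq> 0"
proof
  assume dz: "poly \<delta> z = 0"
  have "\<gamma> \<noteq> 0" and bd: "fps_bdd_poly n (fps_of_poly \<gamma> * g)"
    using assms(1) by (auto simp: minimal_denominator_def denominator_of_def)
  then have "degree \<delta> \<le> n" using assms(3) by (auto simp: fps_bdd_poly_iff)
  obtain \<gamma>' \<delta>' where *: "\<gamma>' \<noteq> 0" "degree \<gamma>' < degree \<gamma>" "fps_of_poly \<gamma>' * g = fps_of_poly \<delta>'" "degree \<delta>' \<le> degree \<delta>"
    using remove_common_root[OF assms(3) \<open>\<gamma> \<noteq> 0\<close> assms(2) dz] .
  then have "denominator_of n g \<gamma>'"
    using \<open>degree \<delta> \<le> n\<close> by (auto simp: denominator_of_def fps_bdd_poly_iff intro!: exI[of _ \<delta>'])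
  then show False using * assms(1) by (auto simp: minimal_denominator_def)
qed

text \<open>Inside the disc of convergence the numerator equals \<open>\<gamma>\<close> times the
  finite value of \<open>g\<close>, so a root of \<open>\<gamma>\<close> there would be a common
  root and could be cancelled.\<close>

lemma minimal_denominator_root_ge_conv_radius:
  assumes "minimal_denominator n g \<gamma>" "poly \<gamma> z = 0"
  shows "ereal (cmod z) \<ge> fps_conv_radius g"
proof (rule ccontr)
  assume "\<not> ?thesis"
  then have z: "ereal (cmod z) < fps_conv_radius g" by simp
  obtain \<delta> where \<delta>: "fps_of_poly \<gamma> * g = fps_of_poly \<delta>"
    using assms(1) by (auto simp: minimal_denominator_def denominator_of_def fps_bdd_poly_iff)
  have "poly \<delta> z = eval_fps (fps_of_poly \<gamma> * g) z" by (simp add: \<delta>)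
  also have "\<dots> = 0" using z assms(2) by (subst eval_fps_mult) auto
  finally show False
    using minimal_denominator_no_common_root[OF assms \<delta>] by simp
qed

lemma sum_lessThan_add: "(\<Sum>i<n+m. f i) = (\<Sum>i<n. f i) + (\<Sum>i<m. f (n + i))"
  for f :: "nat \<Rightarrow> 'a::comm_monoid_add"
  by (induction m) (simp_all add: add.assoc)

lemma fps_of_poly_sum_monom_mult:
  "fps_of_poly (\<Sum>i<L. monom (c i) i) * g = (\<Sum>i<L. fps_const (c i) * (fps_X ^ i * g))"
  for g :: "complex fps"
  by (simp add: fps_of_poly_sum sum_distrib_right fps_of_poly_monom mult.assoc)

lemma poly_eq_sum_monom: "degree p < L \<Longrightarrow> p = (\<Sum>i<L. monom (coeff p i) i)"
  for p :: "complex poly"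
  by (rule poly_eqI) (auto simp: coeff_sum coeff_eq_0)

text \<open>\<open>d\<close> is the least bound on the degree of a denominator that is met for
  infinitely many \<open>s\<close>. Outside a finite set it is the minimal degree, and elimination
  gives a denominator with coefficients \<open>c i\<close> polynomial in \<open>s\<close>. Its roots
  are not inside the disc of convergence, which bounds \<open>c i / c 0\<close> by a multiple of
  \<open>(1 + |s|) ^ i\<close>; so these quotients are polynomials of degree at most
  \<open>i\<close>.\<close>

lemma generic_minimal_denominator:
  fixes g :: "complex \<Rightarrow> complex fps"
  assumes fam: "poly_family g" and C: "C > 0"
    and conv: "\<And>s. fps_conv_radius (g s) \<ge> ereal (1 / (C * (1 + cmod s)))"
    and "infinite S" and S: "\<And>s. s \<in> S \<Longrightarrow> \<exists>\<gamma>. denominator_of n (g s) \<gamma> \<and> degree \<gamma> \<le> d0"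
  obtains d X E where "finite X" "\<And>i. degree (E i) \<le> i"
    "\<And>s. s \<notin> X \<Longrightarrow> \<exists>\<gamma>. minimal_denominator n (g s) \<gamma> \<and> degree \<gamma> = d \<and> coeff \<gamma> 0 = 1
        \<and> (\<forall>i. coeff \<gamma> i = poly (E i) s)"
proof -
  define T where "T d = {s. \<exists>\<gamma>. denominator_of n (g s) \<gamma> \<and> degree \<gamma> \<le> d}" for d
  have "infinite (T d0)" using S by (intro infinite_super[OF _ \<open>infinite S\<close>]) (auto simp: T_def)
  define d where "d = (LEAST d. infinite (T d))"
  have Td: "infinite (T d)" unfolding d_def by (rule LeastI) fact
  have small: "finite {s. \<exists>\<gamma>. denominator_of n (g s) \<gamma> \<and> degree \<gamma> < d}" (is "finite ?X1")
  proof (cases d)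
    case (Suc e)
    have "finite (T e)" using not_less_Least[of e "\<lambda>d. infinite (T d)"] Suc d_def by auto
    moreover have "?X1 = T e" by (auto simp: T_def Suc less_Suc_eq_le)
    ultimately show ?thesis by simp
  qed simp
  define F where "F i s = fps_X ^ i * g s" for i s
  have "poly_family (F i)" for i
    unfolding F_def by (intro poly_family_mult poly_family_const fam)
  moreover have "\<exists>c. (\<exists>i<Suc d. c i \<noteq> 0) \<and> fps_bdd_poly n (\<Sum>i<Suc d. fps_const (c i) * F i s)"
    if sT: "s \<in> T d" for s
  proof -
    obtain \<gamma> where \<gamma>: "\<gamma> \<noteq> 0" "fps_bdd_poly n (fps_of_poly \<gamma> * g s)" "degree \<gamma> \<le> d"
      using sT by (auto simp: T_def denominator_of_def)
    have eq: "\<gamma> = (\<Sum>i<Suc d. monom (coeff \<gamma> i) i)"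
      using \<gamma>(3) by (intro poly_eq_sum_monom) auto
    have "fps_bdd_poly n (\<Sum>i<Suc d. fps_const (coeff \<gamma> i) * F i s)"
      using \<gamma>(2) by (subst (asm) eq) (simp only: fps_of_poly_sum_monom_mult F_def)
    moreover have "\<exists>i<Suc d. coeff \<gamma> i \<noteq> 0"
      using \<gamma>(1,3) by (intro exI[of _ "degree \<gamma>"]) auto
    ultimately show ?thesis by (intro exI[of _ "coeff \<gamma>"]) simp
  qed
  ultimately obtain c where c: "\<exists>i<Suc d. c i \<noteq> 0"
    and bdd: "\<And>s. fps_bdd_poly n (\<Sum>i<Suc d. fps_const (poly (c i) s) * F i s)"
    by (rule poly_family_combination[OF _ Td]) auto
  obtain i0 where i0: "i0 < Suc d" "c i0 \<noteq> 0" using c by blast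
  define \<gamma> where "\<gamma> = wpoly (Suc d) c"
  define X where "X = ?X1 \<union> {s. poly (c i0) s = 0}"
  have "finite X" using small poly_roots_finite[OF i0(2)] by (simp add: X_def)
  have deg: "degree (\<gamma> s) \<le> d" for s
    by (rule degree_le) (simp add: \<gamma>_def coeff_wpoly)
  have den: "denominator_of n (g s) (\<gamma> s)" if "s \<notin> X" for s
  proof -
    have "coeff (\<gamma> s) i0 \<noteq> 0" using that i0 by (simp add: X_def \<gamma>_def coeff_wpoly)
    then have "\<gamma> s \<noteq> 0" by auto
    moreover have "fps_bdd_poly n (fps_of_poly (\<gamma> s) * g s)"
      using bdd[of s] by (simp only: \<gamma>_def wpoly_def fps_of_poly_sum_monom_mult F_def)
    ultimately show ?thesis by (simp add: denominator_of_def)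
  qed
  have mind: "minimal_denominator n (g s) (\<gamma> s)" if "s \<notin> X" for s
    unfolding minimal_denominator_def
  proof (intro conjI den that allI impI)
    fix \<gamma>' assume "denominator_of n (g s) \<gamma>'"
    then have "\<not> degree \<gamma>' < d" using that by (auto simp: X_def)
    then show "degree (\<gamma> s) \<le> degree \<gamma>'" using deg[of s] by simp
  qed
  have degeq: "degree (\<gamma> s) = d" if "s \<notin> X" for s
  proof -
    have "\<not> degree (\<gamma> s) < d" using den[OF that] that by (auto simp: X_def)
    then show ?thesis using deg[of s] by simp
  qed
  have bound: "cmod (coeff (\<gamma> s) i) \<le> 2 ^ d * (C * (1 + cmod s)) ^ i * cmod (coeff (\<gamma> s) 0)" if "s \<notin> X" for s i
  proof -
    have "\<gamma> s \<noteq> 0" using den[OF that] by (auto simp: denominator_of_def)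
    moreover have "1 \<le> C * (1 + cmod s) * cmod z" if "poly (\<gamma> s) z = 0" for z
    proof -
      have "ereal (1 / (C * (1 + cmod s))) \<le> ereal (cmod z)"
        using minimal_denominator_root_ge_conv_radius[OF mind[OF \<open>s \<notin> X\<close>] that] conv[of s] order_trans by blast
      moreover have "C * (1 + cmod s) > 0" using C by (simp add: add_pos_nonneg)
      ultimately show ?thesis by (simp add: field_simps)
    qed
    ultimately have "cmod (coeff (\<gamma> s) i) \<le> 2 ^ degree (\<gamma> s) * (C * (1 + cmod s)) ^ i * cmod (coeff (\<gamma> s) 0)"
      using C by (intro coeff_bound_of_large_roots) auto
    then show ?thesis using degeq[OF that] by simp
  qed
  \<comment> \<open>If the constant coefficient were zero identically, the bound would make all
    coefficients vanish.\<close>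
  have c0: "c 0 \<noteq> 0"
  proof
    assume "c 0 = 0"
    obtain s where s: "s \<notin> X"
      using \<open>finite X\<close> ex_new_if_finite infinite_UNIV_char_0 by blast
    have "coeff (\<gamma> s) i0 = 0" using bound[OF s, of i0] \<open>c 0 = 0\<close> by (simp add: \<gamma>_def coeff_wpoly)
    then show False using s i0 by (simp add: X_def \<gamma>_def coeff_wpoly)
  qed
  have "\<exists>e. (if i < Suc d then c i else 0) = c 0 * e \<and> degree e \<le> i" for i
  proof (rule poly_growth_dvd[OF c0 \<open>finite X\<close>])
    fix s assume "s \<notin> X"
    from bound[OF this, of i] show "cmod (poly (if i < Suc d then c i else 0) s)
        \<le> 2 ^ d * C ^ i * (1 + cmod s) ^ i * cmod (poly (c 0) s)"
      by (auto simp: \<gamma>_def coeff_wpoly power_mult_distrib mult_ac split: if_splits)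
  qed
  then obtain E where E: "\<And>i. (if i < Suc d then c i else 0) = c 0 * E i" "\<And>i. degree (E i) \<le> i"
    by metis
  define X' where "X' = X \<union> {s. poly (c 0) s = 0}"
  show thesis
  proof (rule that[of X' E d])
    show "finite X'" using \<open>finite X\<close> poly_roots_finite[OF c0] by (simp add: X'_def)
    fix s assume "s \<notin> X'"
    then have s: "s \<notin> X" "poly (c 0) s \<noteq> 0" by (auto simp: X'_def)
    define h where "h = inverse (poly (c 0) s)"
    have h: "h \<noteq> 0" using s by (simp add: h_def)
    have "minimal_denominator n (g s) (smult h (\<gamma> s))"
      using mind[OF s(1)] h
      by (auto simp: minimal_denominator_def denominator_of_def fps_of_poly_smult mult.assoc fps_bdd_poly_def)
    moreover have "degree (smult h (\<gamma> s)) = d" using degeq[OF s(1)] h by simp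
    moreover have co: "coeff (smult h (\<gamma> s)) i = poly (E i) s" for i
    proof -
      have "coeff (\<gamma> s) i = poly (if i < Suc d then c i else 0) s" by (simp add: \<gamma>_def coeff_wpoly)
      also have "\<dots> = poly (c 0) s * poly (E i) s" unfolding E(1) by simp
      finally show ?thesis using s by (simp add: h_def)
    qed
    moreover have "coeff (smult h (\<gamma> s)) 0 = 1"
      using s by (simp add: \<gamma>_def coeff_wpoly h_def)
    ultimately show "\<exists>\<gamma>. minimal_denominator n (g s) \<gamma> \<and> degree \<gamma> = d \<and> coeff \<gamma> 0 = 1
        \<and> (\<forall>i. coeff \<gamma> i = poly (E i) s)" by blast
  qed (use E in auto)
qed

text \<open>In \<open>\<delta> * lin2 a b ^ N = \<gamma> * \<epsilon>\<close> a root of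
  \<open>\<gamma>\<close> is not a root of \<open>\<delta>\<close>, hence is one of
  \<open>lin2 a b\<close>. So \<open>\<gamma>\<close> splits into the two linear factors, and its
  constant coefficient fixes the scalar.\<close>

lemma minimal_denominator_lin2:
  assumes ab: "a \<noteq> 0" "b \<noteq> 0" and min: "minimal_denominator n g \<gamma>" and c: "coeff \<gamma> 0 = 1"
    and e: "fps_of_poly (lin2 a b ^ N) * g = fps_of_poly \<epsilon>"
  shows "\<exists>m k. \<gamma> = [:1, -a:] ^ m * [:1, -b:] ^ k \<and> degree \<gamma> = m + k"
proof -
  obtain \<delta> where \<delta>: "fps_of_poly \<gamma> * g = fps_of_poly \<delta>"
    using min by (auto simp: minimal_denominator_def denominator_of_def fps_bdd_poly_iff)
  have "fps_of_poly (\<delta> * lin2 a b ^ N) = fps_of_poly \<gamma> * (fps_of_poly (lin2 a b ^ N) * g)"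
    by (simp add: fps_of_poly_mult \<delta>[symmetric] mult_ac)
  then have eq: "\<delta> * lin2 a b ^ N = \<gamma> * \<epsilon>"
    unfolding e fps_of_poly_mult[symmetric] fps_of_poly_eq_iff .
  have "\<gamma> \<noteq> 0" using c by auto
  have root: "a * z = 1 \<or> b * z = 1" if "poly \<gamma> z = 0" for z
  proof -
    have "poly \<delta> z * poly (lin2 a b) z ^ N = 0"
      using arg_cong[OF eq, of "\<lambda>p. poly p z"] that by simp
    then have "poly (lin2 a b) z = 0"
      using minimal_denominator_no_common_root[OF min that \<delta>] by simp
    then show ?thesis unfolding lin2_def poly_mult mult_eq_0_iff by (auto simp: mult_ac)
  qed
  have "\<exists>c m k. c \<noteq> 0 \<and> p = smult c ([:1, -a:] ^ m * [:1, -b:] ^ k) \<and> degree p = m + k"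
    if "p \<noteq> 0" "\<And>z. poly p z = 0 \<Longrightarrow> a * z = 1 \<or> b * z = 1" for p
    using that
  proof (induction "degree p" arbitrary: p)
    case 0
    then obtain c where "p = [:c:]" by (metis degree_eq_zeroE)
    with 0 show ?case by (intro exI[of _ c] exI[of _ 0]) auto
  next
    case (Suc d)
    obtain z where z: "poly p z = 0"
      using poly_root_exists Suc.hyps(2) by metis
    then obtain q0 where q0: "p = [:-z, 1:] * q0" unfolding poly_eq_0_iff_dvd by (meson dvdE)
    have "q0 \<noteq> 0" using Suc.prems(1) q0 by auto
    have dp: "degree p = Suc (degree q0)" unfolding q0 using \<open>q0 \<noteq> 0\<close> by (subst degree_mult_eq) auto
    obtain c m k where IH: "c \<noteq> 0" "q0 = smult c ([:1, -a:] ^ m * [:1, -b:] ^ k)" "degree q0 = m + k"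
      using Suc.hyps(1)[of q0] Suc.hyps(2) dp \<open>q0 \<noteq> 0\<close> Suc.prems(2) by (auto simp: q0)
    have "z \<noteq> 0" using Suc.prems(2)[OF z] by auto
    consider "a * z = 1" | "b * z = 1" using Suc.prems(2)[OF z] by blast
    then show ?case
    proof cases
      case 1
      then have l: "[:-z, 1:] = smult (-z) [:1, -a:]" by (simp add: mult.commute)
      have "p = smult (-z * c) ([:1, -a:] ^ Suc m * [:1, -b:] ^ k)"
        unfolding q0 l IH(2) by (simp only: mult_smult_left mult_smult_right smult_smult power_Suc mult.assoc)
           (simp only: mult.commute)
      moreover have "-z * c \<noteq> 0" "degree p = Suc m + k" using IH dp \<open>z \<noteq> 0\<close> by auto
      ultimately show ?thesis by blast
    next
      case 2
      then have l: "[:-z, 1:] = smult (-z) [:1, -b:]" by (simp add: mult.commute)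
      have "p = smult (-z * c) ([:1, -a:] ^ m * [:1, -b:] ^ Suc k)"
        unfolding q0 l IH(2) by (simp only: mult_smult_left mult_smult_right smult_smult power_Suc mult.left_commute)
           (simp only: mult.commute)
      moreover have "-z * c \<noteq> 0" "degree p = m + Suc k" using IH dp \<open>z \<noteq> 0\<close> by auto
      ultimately show ?thesis by blast
    qed
  qed
  then obtain c' m k where *: "\<gamma> = smult c' ([:1, -a:] ^ m * [:1, -b:] ^ k)" "degree \<gamma> = m + k"
    using \<open>\<gamma> \<noteq> 0\<close> root by blast
  have "coeff ([:1, -a:] ^ m * [:1, -b:] ^ k) 0 = 1"
    by (simp add: coeff_0_power coeff_mult_0)
  then have "c' = 1" using c * by simp
  with * show ?thesis by auto
qed

text \<open>Newton's identities: the coefficients are signed elementary symmetric functions of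
  \<open>m\<close> copies of \<open>a\<close> and \<open>k\<close> copies of \<open>b\<close>,
  expressed here by the first two power sums.\<close>

lemma coeff_lin2_powers:
  fixes a b :: complex
  shows "coeff ([:1, -a:] ^ m * [:1, -b:] ^ k) 0 = 1"
    "coeff ([:1, -a:] ^ m * [:1, -b:] ^ k) 1 = - (of_nat m * a + of_nat k * b)"
    "2 * coeff ([:1, -a:] ^ m * [:1, -b:] ^ k) 2 = (of_nat m * a + of_nat k * b)^2 - (of_nat m * a^2 + of_nat k * b^2)"
proof -
  define Q where "Q q A B \<longleftrightarrow> coeff q 0 = 1 \<and> coeff q 1 = - A \<and> 2 * coeff q 2 = A\<^sup>2 - B"
    for q :: "complex poly" and A B
  have step: "Q ([:1, -u:] * q) (u + A) (u\<^sup>2 + B)" if "Q q A B" for u q A B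
    using that by (auto simp: Q_def numeral_2_eq_2 power2_eq_square algebra_simps)
  have "Q ([:1, -b:] ^ k) (of_nat k * b) (of_nat k * b\<^sup>2)"
  proof (induction k)
    case (Suc k)
    from step[OF this, of b] show ?case by (simp add: ring_distribs)
  qed (simp add: Q_def)
  then have "Q ([:1, -a:] ^ m * [:1, -b:] ^ k) (of_nat m * a + of_nat k * b) (of_nat m * a\<^sup>2 + of_nat k * b\<^sup>2)"
  proof (induction m)
    case (Suc m)
    from step[OF Suc.IH[OF Suc.prems], of a] show ?case
      by (simp only: power_Suc mult.assoc of_nat_Suc ring_distribs mult_1 add.assoc)
  qed simp
  then show "coeff ([:1, -a:] ^ m * [:1, -b:] ^ k) 0 = 1"
    "coeff ([:1, -a:] ^ m * [:1, -b:] ^ k) 1 = - (of_nat m * a + of_nat k * b)"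
    "2 * coeff ([:1, -a:] ^ m * [:1, -b:] ^ k) 2 = (of_nat m * a + of_nat k * b)^2 - (of_nat m * a^2 + of_nat k * b^2)"
    unfolding Q_def by blast+
qed

section \<open>End points of intervals carrying rational densities\<close>

text \<open>When \<open>F\<close> is the series of moments of a density, this sum is the
  \<open>j\<close>-th moment of the density multiplied by the polynomial with coefficients
  \<open>c i\<close>.\<close>

lemma reversed_poly_mult_nth:
  fixes F :: "complex fps"
  shows "(fps_of_poly (\<Sum>i\<le>N. monom (c i) (N - i)) * F) $ (j + N) = (\<Sum>i\<le>N. c i * F $ (j + i))"
proof -
  have "fps_of_poly (\<Sum>i\<le>N. monom (c i) (N - i)) * F = (\<Sum>i\<le>N. fps_const (c i) * (fps_X ^ (N - i) * F))"
    by (simp add: fps_of_poly_sum sum_distrib_right fps_of_poly_monom mult.assoc)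
  then have "(fps_of_poly (\<Sum>i\<le>N. monom (c i) (N - i)) * F) $ (j + N) =
      (\<Sum>i\<le>N. c i * (fps_X ^ (N - i) * F) $ (j + N))"
    by (simp add: fps_sum_nth)
  also have "\<dots> = (\<Sum>i\<le>N. c i * F $ (j + i))"
    by (intro sum.cong refl) (auto simp: fps_X_power_mult_nth intro!: arg_cong[where f = "fps_nth F"])
  finally show ?thesis .
qed

lemma poly_reversed:
  fixes A :: "complex poly"
  assumes "degree A \<le> N" "z \<noteq> 0"
  shows "poly (\<Sum>i\<le>N. monom (coeff A i) (N - i)) z = z ^ N * poly A (inverse z)"
proof -
  have A: "poly A x = (\<Sum>i\<le>N. coeff A i * x ^ i)" for x
  proof -
    have "A = (\<Sum>i<Suc N. monom (coeff A i) i)" using assms(1) by (intro poly_eq_sum_monom) auto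
    then have "poly A x = poly (\<Sum>i<Suc N. monom (coeff A i) i) x" by simp
    then show ?thesis by (simp add: poly_sum poly_monom lessThan_Suc_atMost)
  qed
  have "z ^ (N - i) = z ^ N * inverse z ^ i" if "i \<le> N" for i
    using that assms(2) by (simp add: power_diff field_simps)
  then show ?thesis by (simp add: poly_sum poly_monom A sum_distrib_left mult_ac)
qed

text \<open>
  The assumption \<open>mom\<close> holds for the moments \<open>M\<close> of the density \<open>A/B\<close> on the interval from \<open>b\<close> to \<open>a\<close>; the
  polynomials \<open>\<alpha>\<close> and \<open>\<beta>\<close> are the reversals of \<open>A\<close> and \<open>B\<close>, the latter multiplied by the variable.
\<close>

lemma moment_series_log:
  fixes M :: "nat \<Rightarrow> complex"
  assumes nz: "A \<noteq> 0" "B \<noteq> 0" and deg: "degree A \<le> N" "degree B \<le> N"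
    and ncr: "\<And>z. \<not> (poly A z = 0 \<and> poly B z = 0)"
    and mom: "\<And>j. (\<Sum>i\<le>N. coeff B i * M (j + i)) =
         (\<Sum>i\<le>N. coeff A i * ((a ^ (i + j + 1) - b ^ (i + j + 1)) / of_nat (i + j + 1)))"
  obtains \<alpha> \<beta> c where "\<alpha> \<noteq> 0" "\<beta> \<noteq> 0" "degree \<alpha> \<le> N" "degree \<beta> \<le> N + 1" "degree c \<le> N"
    "fps_of_poly \<beta> * Abs_fps M = fps_of_poly \<alpha> * log_fps a b + fps_of_poly c"
    "\<And>z. z \<noteq> 0 \<Longrightarrow> poly \<beta> z = 0 \<Longrightarrow> poly \<alpha> z \<noteq> 0"
proof -
  define \<alpha> where "\<alpha> = (\<Sum>i\<le>N. monom (coeff A i) (N - i))"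
  define \<beta>0 where "\<beta>0 = (\<Sum>i\<le>N. monom (coeff B i) (N - i))"
  \<comment> \<open>The extra factor of the variable matches the exponent \<open>i + j + 1\<close>
    that arises from integrating \<open>t ^ (i + j)\<close>.\<close>
  define \<beta> where "\<beta> = pCons 0 \<beta>0"
  have degs: "degree \<alpha> \<le> N" "degree \<beta>0 \<le> N" unfolding \<alpha>_def \<beta>0_def
    by (auto intro!: degree_sum_le intro: order_trans[OF degree_monom_le])
  then have "degree \<beta> \<le> N + 1" using degree_pCons_le[of 0 \<beta>0] by (simp add: \<beta>_def)
  have nonzero: "(\<Sum>i\<le>N. monom (coeff P i) (N - i)) \<noteq> 0" if P: "P \<noteq> 0" "degree P \<le> N" for P :: "complex poly"
  proof -
    have "coeff (\<Sum>i\<le>N. monom (coeff P i) (N - i)) (N - degree P) = (\<Sum>i\<le>N. if i = degree P then coeff P i else 0)"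
      unfolding coeff_sum using P(2) by (intro sum.cong refl) (auto simp: coeff_monom)
    also have "\<dots> = lead_coeff P" using P(2) by simp
    finally show ?thesis using P(1) by auto
  qed
  have "\<alpha> \<noteq> 0" unfolding \<alpha>_def by (rule nonzero[OF nz(1) deg(1)])
  moreover have "\<beta> \<noteq> 0" using nonzero[OF nz(2) deg(2)] by (simp add: \<beta>_def \<beta>0_def)
  moreover have "poly \<alpha> z \<noteq> 0" if "z \<noteq> 0" "poly \<beta> z = 0" for z
    using that ncr[of "inverse z"] by (simp add: \<beta>_def \<beta>0_def \<alpha>_def poly_reversed deg)
  moreover have "fps_bdd_poly N (fps_of_poly \<beta> * Abs_fps M - fps_of_poly \<alpha> * log_fps a b)"
    unfolding fps_bdd_poly_def
  proof (intro allI impI)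
    \<comment> \<open>Equality of the coefficients with index \<open>l = j + 1 + N\<close> is
      exactly the relation \<open>mom\<close> for \<open>j\<close>; the lower ones form the
      polynomial \<open>c\<close>.\<close>
    fix l assume "N < l"
    then obtain j where l: "l = Suc j + N" by (metis add.commute add_Suc_right less_iff_Suc_add)
    have X\<beta>: "fps_of_poly \<beta> = fps_X * fps_of_poly \<beta>0" by (simp add: \<beta>_def fps_of_poly_pCons)
    have "(fps_of_poly \<beta> * Abs_fps M) $ l = (fps_of_poly \<beta>0 * Abs_fps M) $ (j + N)"
      unfolding X\<beta> l mult.assoc by simp
    also have "\<dots> = (\<Sum>i\<le>N. coeff B i * M (j + i))"
      unfolding \<beta>0_def reversed_poly_mult_nth by simp
    also have "\<dots> = (fps_of_poly \<alpha> * log_fps a b) $ l"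
      unfolding l \<alpha>_def reversed_poly_mult_nth mom
      by (simp add: log_fps_def add_ac)
    finally show "(fps_of_poly \<beta> * Abs_fps M - fps_of_poly \<alpha> * log_fps a b) $ l = 0" by simp
  qed
  then obtain c where "degree c \<le> N" "fps_of_poly \<beta> * Abs_fps M - fps_of_poly \<alpha> * log_fps a b = fps_of_poly c"
    unfolding fps_bdd_poly_iff by blast
  ultimately show thesis
    using degs \<open>degree \<beta> \<le> N + 1\<close> by (intro that[of \<alpha> \<beta> c]) (auto simp: algebra_simps)
qed

section \<open>A differential equation with coefficients polynomial in the parameter\<close>

lemma degree_lin2: "degree (lin2 a b) \<le> 2"
  by (simp add: lin2_def)

lemma lin2_nonzero: "lin2 a b \<noteq> 0"
  by (simp add: lin2_def)

lemma degree_mult_bound: "degree p \<le> m \<Longrightarrow> degree q \<le> n \<Longrightarrow> degree (p * q) \<le> m + n"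
  for p q :: "complex poly"
  using degree_mult_le[of p q] by linarith

lemma degree_pderiv_bound: "degree p \<le> m \<Longrightarrow> degree (pderiv p) \<le> m" for p :: "complex poly"
  by (simp add: degree_pderiv)

lemma degree_wpoly: "degree (wpoly L c s) \<le> L"
  by (rule degree_le) (auto simp: coeff_wpoly)

text \<open>For each \<open>s\<close> in \<open>S\<close> an equation with coefficients of bounded
  degree exists by \<open>log_rational_ode\<close>. Its existence is a linear system in the
  coefficients of \<open>p\<close> and \<open>q\<close>, so they can be chosen polynomial in
  \<open>s\<close>, although \<open>\<alpha>\<close>, \<open>\<beta>\<close>, \<open>a\<close> and
  \<open>b\<close> depend on \<open>s\<close> in an unknown way.\<close>

lemma generic_ode:
  fixes f :: "complex \<Rightarrow> complex fps"
  assumes fam: "poly_family f" and "infinite S"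
    and S: "\<And>s. s \<in> S \<Longrightarrow> \<exists>a b \<alpha> \<beta> c. \<alpha> \<noteq> 0 \<and> \<beta> \<noteq> 0 \<and> degree \<alpha> \<le> N \<and> degree \<beta> \<le> N + 1 \<and> degree c \<le> N \<and>
      fps_of_poly \<beta> * f s = fps_of_poly \<alpha> * log_fps a b + fps_of_poly c"
  obtains L p q X where "finite X" "\<And>s. s \<notin> X \<Longrightarrow> wpoly L p s \<noteq> 0 \<or> wpoly L q s \<noteq> 0"
    "\<And>s. \<exists>r. fps_of_poly (wpoly L p s) * fps_deriv (f s) + fps_of_poly (wpoly L q s) * f s = fps_of_poly r"
proof -
  \<comment> \<open>The explicit equation has coefficients of degree at most
    \<open>2 * N + 3\<close> and a right-hand side of degree at most
    \<open>2 * N + 2\<close>.\<close>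
  define L where "L = 2 * N + 4"
  \<comment> \<open>The first \<open>L\<close> series carry the unknown coefficients of
    \<open>p\<close>, the other \<open>L\<close> those of \<open>q\<close>.\<close>
  define F where "F i s = (if i < L then fps_X ^ i * fps_deriv (f s) else fps_X ^ (i - L) * f s)" for i s
  have "F i = (\<lambda>s. if i < L then fps_X ^ i * fps_deriv (f s) else fps_X ^ (i - L) * f s)" for i
    by (simp add: F_def fun_eq_iff)
  then have "poly_family (F i)" for i
    using fam by (cases "i < L") (auto intro!: poly_family_mult poly_family_const poly_family_deriv)
  moreover have "\<exists>c. (\<exists>i<L + L. c i \<noteq> 0) \<and> fps_bdd_poly L (\<Sum>i<L + L. fps_const (c i) * F i s)" if sS: "s \<in> S" for s
  proof -
    obtain a b \<alpha> \<beta> c where *: "\<alpha> \<noteq> 0" "\<beta> \<noteq> 0" "degree \<alpha> \<le> N" "degree \<beta> \<le> N + 1" "degree c \<le> N"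
      "fps_of_poly \<beta> * f s = fps_of_poly \<alpha> * log_fps a b + fps_of_poly c"
      using S[OF sS] by blast
    define p where "p = lin2 a b * \<alpha> * \<beta>"
    define q where "q = lin2 a b * (\<alpha> * pderiv \<beta> - pderiv \<alpha> * \<beta>)"
    define r where "r = lin2 a b * (\<alpha> * pderiv c - pderiv \<alpha> * c) + smult (a - b) (\<alpha> * \<alpha>)"
    have "degree p \<le> (2 + N) + (N + 1)" unfolding p_def
      using * by (intro degree_mult_bound degree_lin2)
    then have dp: "degree p < L" by (simp add: L_def)
    have "degree q \<le> 2 + (N + (N + 1))" unfolding q_def
      using * by (intro degree_mult_bound degree_lin2 degree_diff_le degree_pderiv_bound)
    then have dq: "degree q < L" by (simp add: L_def)
    have "degree r \<le> 2 + (N + N)" unfolding r_def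
    proof (intro degree_add_le)
      show "degree (lin2 a b * (\<alpha> * pderiv c - pderiv \<alpha> * c)) \<le> 2 + (N + N)"
        using * by (intro degree_mult_bound degree_lin2 degree_diff_le degree_pderiv_bound)
      show "degree (smult (a - b) (\<alpha> * \<alpha>)) \<le> 2 + (N + N)"
        using degree_smult_le[of "a - b" "\<alpha> * \<alpha>"] degree_mult_bound[OF *(3) *(3)] by linarith
    qed
    then have dr: "degree r \<le> L" by (simp add: L_def)
    have eq: "fps_of_poly p * fps_deriv (f s) + fps_of_poly q * f s = fps_of_poly r"
      unfolding p_def q_def r_def by (rule log_rational_ode[OF *(6)])
    have "p \<noteq> 0" using * by (simp add: p_def lin2_nonzero)
    define c' where "c' i = (if i < L then coeff p i else coeff q (i - L))" for i
    have "(\<Sum>i<L + L. fps_const (c' i) * F i s) =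
       fps_of_poly (\<Sum>i<L. monom (coeff p i) i) * fps_deriv (f s) + fps_of_poly (\<Sum>i<L. monom (coeff q i) i) * f s"
      unfolding sum_lessThan_add fps_of_poly_sum_monom_mult by (simp add: c'_def F_def)
    also have "\<dots> = fps_of_poly r"
      using eq poly_eq_sum_monom[OF dp] poly_eq_sum_monom[OF dq] by simp
    finally have "fps_bdd_poly L (\<Sum>i<L + L. fps_const (c' i) * F i s)"
      using dr by (auto simp: fps_bdd_poly_iff)
    moreover have "c' (degree p) \<noteq> 0" "degree p < L + L" using \<open>p \<noteq> 0\<close> dp by (auto simp: c'_def)
    ultimately show ?thesis by blast
  qed
  ultimately obtain c where c: "\<exists>i<L + L. c i \<noteq> 0"
    and bdd: "\<And>s. fps_bdd_poly L (\<Sum>i<L + L. fps_const (poly (c i) s) * F i s)"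
    by (rule poly_family_combination[OF _ \<open>infinite S\<close>]) auto
  obtain i0 where i0: "i0 < L + L" "c i0 \<noteq> 0" using c by blast
  show thesis
  proof (rule that[of "{s. poly (c i0) s = 0}" L c "\<lambda>i. c (L + i)"])
    show "finite {s. poly (c i0) s = 0}" by (rule poly_roots_finite[OF i0(2)])
    fix s assume s: "s \<notin> {s. poly (c i0) s = 0}"
    show "wpoly L c s \<noteq> 0 \<or> wpoly L (\<lambda>i. c (L + i)) s \<noteq> 0"
    proof (cases "i0 < L")
      case True
      then have "coeff (wpoly L c s) i0 \<noteq> 0" using s by (simp add: coeff_wpoly)
      then show ?thesis by (metis coeff_0)
    next
      case False
      then have "coeff (wpoly L (\<lambda>i. c (L + i)) s) (i0 - L) \<noteq> 0" using s i0 by (simp add: coeff_wpoly)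
      then show ?thesis by (metis coeff_0)
    qed
  next
    fix s
    have "(\<Sum>i<L + L. fps_const (poly (c i) s) * F i s) =
       fps_of_poly (wpoly L c s) * fps_deriv (f s) + fps_of_poly (wpoly L (\<lambda>i. c (L + i)) s) * f s"
      unfolding sum_lessThan_add wpoly_def fps_of_poly_sum_monom_mult by (simp add: F_def)
    then show "\<exists>r. fps_of_poly (wpoly L c s) * fps_deriv (f s) + fps_of_poly (wpoly L (\<lambda>i. c (L + i)) s) * f s = fps_of_poly r"
      using bdd[of s] by (auto simp: fps_bdd_poly_iff)
  qed
qed

section \<open>Removal of the poles of the density and of the logarithm\<close>

lemma fps_conv_radius_deriv_funpow:
  "fps_conv_radius ((fps_deriv ^^ n) f) \<ge> fps_conv_radius f" for f :: "complex fps"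
  by (induction n) (auto intro: order_trans[OF _ fps_conv_radius_deriv])

lemma fps_conv_radius_geometric:
  fixes f :: "complex fps"
  assumes "\<And>j. cmod (f $ j) \<le> K * R ^ j" "R > 0"
  shows "fps_conv_radius f \<ge> ereal (1 / R)"
  unfolding fps_conv_radius_def
proof (rule conv_radius_geI_ex')
  fix r :: real assume r: "0 < r" "ereal r < ereal (1 / R)"
  then have "r * R < 1" using assms(2) by (simp add: field_simps)
  have "summable (\<lambda>n. K * (r * R) ^ n)"
    using \<open>r * R < 1\<close> r assms(2) by (intro summable_mult summable_geometric) auto
  then show "summable (\<lambda>n. f $ n * of_real r ^ n)"
  proof (rule summable_comparison_test'[where N = 0])
    fix n
    have "norm (f $ n * of_real r ^ n) = cmod (f $ n) * r ^ n" using r by (simp add: norm_mult norm_power)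
    also have "\<dots> \<le> K * R ^ n * r ^ n" using r by (intro mult_right_mono assms) auto
    finally show "norm (f $ n * of_real r ^ n) \<le> K * (r * R) ^ n" by (simp add: power_mult_distrib mult_ac)
  qed
qed

lemma degree_pderiv_funpow_eq_0: "degree p < n \<Longrightarrow> (pderiv ^^ n) p = 0" for p :: "complex poly"
proof (induction n arbitrary: p)
  case (Suc n)
  show ?case
  proof (cases "degree p = 0")
    case True
    then have "pderiv p = 0" by (simp add: pderiv_eq_0_iff)
    moreover have "(pderiv ^^ n) 0 = (0 :: complex poly)" by (induction n) auto
    ultimately show ?thesis by (simp add: funpow_Suc_right del: funpow.simps)
  next
    case False
    then show ?thesis using Suc by (simp add: funpow_Suc_right degree_pderiv del: funpow.simps)
  qed
qed simp

lemma fps_deriv_funpow_of_poly: "(fps_deriv ^^ n) (fps_of_poly p) = fps_of_poly ((pderiv ^^ n) p)"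
  by (induction n) (simp_all add: fps_of_poly_pderiv)

lemma fps_deriv_funpow_add: "(fps_deriv ^^ n) (f + g) = (fps_deriv ^^ n) f + (fps_deriv ^^ n) g"
  for f g :: "complex fps"
  by (induction n) simp_all

lemma fps_deriv_funpow_bdd_imp_bdd:
  fixes f :: "complex fps"
  assumes "fps_bdd_poly m ((fps_deriv ^^ n) f)"
  shows "\<exists>r. f = fps_of_poly r"
  using assms
proof (induction n arbitrary: f)
  case 0 then show ?case by (auto simp: fps_bdd_poly_iff)
next
  case (Suc n)
  then obtain r where r: "fps_deriv f = fps_of_poly r"
    by (auto simp: funpow_Suc_right simp del: funpow.simps)
  have "f $ j = 0" if jr: "j > degree r + 1" for j
  proof -
    obtain i where j: "j = Suc i" using jr by (cases j) auto
    have "of_nat (Suc i) * f $ Suc i = fps_deriv f $ i" by simp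
    also have "\<dots> = 0" unfolding r using jr j by (simp add: coeff_eq_0)
    finally show ?thesis unfolding j by (metis mult_eq_0_iff of_nat_eq_0_iff nat.simps(3))
  qed
  then have "fps_bdd_poly (degree r + 1) f" by (simp add: fps_bdd_poly_def)
  then show ?case by (auto simp: fps_bdd_poly_iff)
qed

text \<open>
  The poles of the density are removed by multiplication with a power of the leading coefficient
  of the differential equation, the logarithm by sufficiently many differentiations.
\<close>

lemma log_removed:
  fixes f :: "complex fps"
  assumes ab: "a \<noteq> 0" "a \<noteq> b" and nz: "\<alpha> \<noteq> 0" "\<beta> \<noteq> 0"
    and deg: "degree \<alpha> \<le> N" "degree \<beta> \<le> N + 1" "degree c \<le> N" "degree p \<le> d"
    and f: "fps_of_poly \<beta> * f = fps_of_poly \<alpha> * log_fps a b + fps_of_poly c"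
    and ncr: "\<And>z. z \<noteq> 0 \<Longrightarrow> poly \<beta> z = 0 \<Longrightarrow> poly \<alpha> z \<noteq> 0"
    and ode: "fps_of_poly p * fps_deriv f + fps_of_poly q * f = fps_of_poly r" "p \<noteq> 0 \<or> q \<noteq> 0"
    and n: "n > (d + 1) * (N + 1) + N" and g: "g = (fps_deriv ^^ n) (fps_of_poly (pCons 0 p ^ (N + 1)) * f)"
  shows "\<exists>\<epsilon>. degree \<epsilon> \<le> 4 * n \<and> fps_of_poly (lin2 a b ^ n) * g = fps_of_poly \<epsilon>"
    and "\<not> fps_bdd_poly m g"
proof -
  have eq: "q * (\<alpha> * \<beta>) = p * (\<alpha> * pderiv \<beta> - pderiv \<alpha> * \<beta>)"
    by (rule log_rational_ode_unique[OF ab nz f ode(1)])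
  then have p0: "p \<noteq> 0" using ode(2) nz by auto
  \<comment> \<open>At a nonzero root of \<open>\<beta>\<close> the logarithmic derivative forces
    \<open>p\<close> to vanish; a root at \<open>0\<close> is covered by the factor of the variable
    in \<open>pCons 0 p\<close>.\<close>
  have roots: "poly (pCons 0 p) z = 0" if "poly \<beta> z = 0" for z
    using log_derivative_pole[OF eq nz(2) that] ncr[of z] that by (cases "z = 0") auto
  \<comment> \<open>The Nullstellensatz in one variable; \<open>degree \<beta> \<le> N + 1\<close>
    then makes the exponent independent of the parameter.\<close>
  have "\<beta> dvd pCons 0 p ^ degree \<beta>"
    using nullstellensatz_univariate[of \<beta> "pCons 0 p"] roots nz by auto
  also have "\<dots> dvd pCons 0 p ^ (N + 1)" using deg(2) by (intro le_imp_power_dvd)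
  finally obtain \<tau> where \<tau>: "pCons 0 p ^ (N + 1) = \<beta> * \<tau>" by (auto elim: dvdE)
  have "\<tau> \<noteq> 0" using \<tau> p0 by auto
  have "degree (pCons 0 p) \<le> d + 1" using deg(4) degree_pCons_le[of 0 p] by simp
  then have "degree (pCons 0 p ^ (N + 1)) \<le> (d + 1) * (N + 1)"
    by (metis degree_power_le le_trans mult_le_mono1)
  then have d\<tau>: "degree \<tau> \<le> (d + 1) * (N + 1)"
    unfolding \<tau> using nz(2) \<open>\<tau> \<noteq> 0\<close> by (simp add: degree_mult_eq)
  define \<eta> where "\<eta> = \<tau> * \<alpha>"
  have d\<eta>: "degree \<eta> < n" using degree_mult_bound[OF d\<tau> deg(1)] n by (simp add: \<eta>_def)
  have "\<eta> \<noteq> 0" using nz \<open>\<tau> \<noteq> 0\<close> by (simp add: \<eta>_def)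
  have dc: "degree (\<tau> * c) < n" using degree_mult_bound[OF d\<tau> deg(3)] n by simp
  have Pf: "fps_of_poly (pCons 0 p ^ (N + 1)) * f = fps_of_poly \<eta> * log_fps a b + fps_of_poly (\<tau> * c)"
  proof -
    have "fps_of_poly (pCons 0 p ^ (N + 1)) * f = fps_of_poly \<tau> * (fps_of_poly \<beta> * f)"
      unfolding \<tau> fps_of_poly_mult by (simp only: mult_ac)
    then show ?thesis unfolding f \<eta>_def by (simp add: fps_of_poly_mult algebra_simps)
  qed
  \<comment> \<open>\<open>n\<close> exceeds the degree of \<open>\<tau> * c\<close>, so this
    summand disappears. It also exceeds the degree of \<open>\<eta>\<close>, which removes the
    logarithm below.\<close>
  have g': "g = (fps_deriv ^^ n) (fps_of_poly \<eta> * log_fps a b)"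
    unfolding g Pf fps_deriv_funpow_add fps_deriv_funpow_of_poly using degree_pderiv_funpow_eq_0[OF dc] by simp
  obtain \<epsilon> where "degree \<epsilon> \<le> degree \<eta> + 2 * n"
    "fps_of_poly (lin2 a b ^ n) * g = fps_of_poly (lin2 a b ^ n * (pderiv ^^ n) \<eta>) * log_fps a b + fps_of_poly \<epsilon>"
    using lin2_power_deriv_log[of \<eta> n a b] unfolding g' by blast
  then show "\<exists>\<epsilon>. degree \<epsilon> \<le> 4 * n \<and> fps_of_poly (lin2 a b ^ n) * g = fps_of_poly \<epsilon>"
    using d\<eta> degree_pderiv_funpow_eq_0[OF d\<eta>] by (intro exI[of _ \<epsilon>]) auto
  show "\<not> fps_bdd_poly m g"
  proof
    assume "fps_bdd_poly m g"
    then obtain r where "fps_of_poly \<eta> * log_fps a b = fps_of_poly r"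
      unfolding g' using fps_deriv_funpow_bdd_imp_bdd by blast
    with log_fps_transcendental[OF ab] \<open>\<eta> \<noteq> 0\<close> show False by blast
  qed
qed

text \<open>The generic minimal denominator is
  \<open>(1 - hp s * w) ^ m * (1 - hm s * w) ^ (d - m)\<close>. Its first two coefficients are
  polynomials in \<open>s\<close> of degree at most \<open>1\<close> and \<open>2\<close> and
  determine the power sums of the ends. The limits at the two infinities serve to show
  \<open>d = 2 * m\<close>.\<close>

theorem interval_ends_of_rational_densities:
  fixes M :: "nat \<Rightarrow> complex poly" and hp hm :: "real \<Rightarrow> real"
  assumes C: "C > 0" and growth: "\<And>j s. cmod (poly (M j) s) \<le> K * (C * (1 + cmod s)) ^ j"
    and cont: "continuous_on UNIV hp" "continuous_on UNIV hm"
    and sgn: "\<And>s. hm s < 0" "\<And>s. 0 < hp s"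
    and rat: "\<And>s. \<exists>A B. A \<noteq> 0 \<and> B \<noteq> 0 \<and> degree A \<le> N \<and> degree B \<le> N \<and>
      (\<forall>z. \<not> (poly A z = 0 \<and> poly B z = 0)) \<and>
      (\<forall>j. (\<Sum>i\<le>N. coeff B i * poly (M (j + i)) (of_real s)) =
         (\<Sum>i\<le>N. coeff A i * ((of_real (hp s) ^ (i + j + 1) - of_real (hm s) ^ (i + j + 1)) / of_nat (i + j + 1))))"
    and lims: "((\<lambda>s. hp s / s) \<longlongrightarrow> x) at_top" "((\<lambda>s. hm s / s) \<longlongrightarrow> y) at_top"
      "((\<lambda>s. hp s / s) \<longlongrightarrow> y) at_bot" "((\<lambda>s. hm s / s) \<longlongrightarrow> x) at_bot" "x \<noteq> y"
  shows "\<exists>a b. \<forall>s. hp s + hm s = a + b * s"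
    and "\<exists>a b c. \<forall>s. (hp s)\<^sup>2 + (hm s)\<^sup>2 = a + b * s + c * s\<^sup>2"
proof -
  define f where "f s = Abs_fps (\<lambda>j. poly (M j) s)" for s
  have famf: "poly_family f" by (rule poly_familyI[where c = M]) (simp add: f_def)
  have convf: "fps_conv_radius (f s) \<ge> ereal (1 / (C * (1 + cmod s)))" for s
    by (rule fps_conv_radius_geometric[where K = K])
       (use C in \<open>auto simp: f_def growth intro!: mult_pos_pos add_pos_nonneg\<close>)
  let ?h = "\<lambda>s. of_real (hp s) :: complex" and ?k = "\<lambda>s. of_real (hm s) :: complex"
  have hk: "?h s \<noteq> 0" "?k s \<noteq> 0" "?h s \<noteq> ?k s" for s
    using sgn[of s] by auto
  have logform: "\<exists>\<alpha> \<beta> c. \<alpha> \<noteq> 0 \<and> \<beta> \<noteq> 0 \<and> degree \<alpha> \<le> N \<and> degree \<beta> \<le> N + 1 \<and> degree c \<le> N \<and>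
      fps_of_poly \<beta> * f (of_real s) = fps_of_poly \<alpha> * log_fps (?h s) (?k s) + fps_of_poly c \<and>
      (\<forall>z. z \<noteq> 0 \<longrightarrow> poly \<beta> z = 0 \<longrightarrow> poly \<alpha> z \<noteq> 0)" for s
  proof -
    obtain A B where AB: "A \<noteq> 0" "B \<noteq> 0" "degree A \<le> N" "degree B \<le> N"
      "\<And>z. \<not> (poly A z = 0 \<and> poly B z = 0)"
      "\<And>j. (\<Sum>i\<le>N. coeff B i * poly (M (j + i)) (of_real s)) =
         (\<Sum>i\<le>N. coeff A i * ((?h s ^ (i + j + 1) - ?k s ^ (i + j + 1)) / of_nat (i + j + 1)))"
      using rat[of s] by blast
    show ?thesis
      by (rule moment_series_log[where M = "\<lambda>j. poly (M j) (of_real s)", OF AB]) (auto simp: f_def)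
  qed
  have infR: "infinite (range complex_of_real)"
    using finite_imageD[of complex_of_real UNIV] infinite_UNIV_char_0[where 'a = real] by (auto simp: inj_on_def)
  obtain L p q X0 where X0: "finite X0" "\<And>s. s \<notin> X0 \<Longrightarrow> wpoly L p s \<noteq> 0 \<or> wpoly L q s \<noteq> 0"
    and ode: "\<And>s. \<exists>r. fps_of_poly (wpoly L p s) * fps_deriv (f s) + fps_of_poly (wpoly L q s) * f s = fps_of_poly r"
  proof (rule generic_ode[OF famf infR, of N])
    fix s assume "s \<in> range complex_of_real"
    then obtain t where "s = of_real t" by blast
    then show "\<exists>a b \<alpha> \<beta> c. \<alpha> \<noteq> 0 \<and> \<beta> \<noteq> 0 \<and> degree \<alpha> \<le> N \<and> degree \<beta> \<le> N + 1 \<and> degree c \<le> N \<and>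
      fps_of_poly \<beta> * f s = fps_of_poly \<alpha> * log_fps a b + fps_of_poly c"
      using logform[of t] by blast
  qed blast
  \<comment> \<open>The least value allowed by \<open>log_removed\<close> when \<open>L\<close> is
    the degree bound of \<open>wpoly L p s\<close>.\<close>
  define n where "n = (L + 1) * (N + 1) + N + 1"
  define g where "g s = (fps_deriv ^^ n) (fps_of_poly (pCons 0 (wpoly L p s) ^ (N + 1)) * f s)" for s
  \<comment> \<open>In this form \<open>g\<close> is built by operations that preserve polynomial
    dependence on the parameter.\<close>
  have g_alt: "g = (\<lambda>s. (fps_deriv ^^ n) ((fps_X * fps_of_poly (wpoly L p s)) ^ (N + 1) * f s))"
  proof -
    have "fps_of_poly (pCons 0 P ^ k) = (fps_X * fps_of_poly P) ^ k" for P :: "complex poly" and k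
      by (simp add: fps_of_poly_power fps_of_poly_pCons mult.commute)
    then show ?thesis by (simp only: g_def fun_eq_iff simp_thms)
  qed
  have famg: "poly_family g"
    unfolding g_alt by (intro poly_family_deriv_funpow poly_family_mult poly_family_power poly_family_const poly_family_wpoly famf)
  have convg: "fps_conv_radius (g s) \<ge> ereal (1 / (C * (1 + cmod s)))" for s
  proof -
    have "fps_conv_radius (f s) \<le> fps_conv_radius (fps_of_poly (pCons 0 (wpoly L p s) ^ (N + 1)) * f s)"
      by (rule order_trans[OF _ fps_conv_radius_mult]) simp
    also have "\<dots> \<le> fps_conv_radius (g s)" unfolding g_def by (rule fps_conv_radius_deriv_funpow)
    finally show ?thesis using convf[of s] by (rule order_trans[rotated])
  qed
  have rem: "(\<exists>\<epsilon>. degree \<epsilon> \<le> 4 * n \<and> fps_of_poly (lin2 (?h s) (?k s) ^ n) * g (of_real s) = fps_of_poly \<epsilon>) \<and>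
      (\<forall>m. \<not> fps_bdd_poly m (g (of_real s)))" if s: "of_real s \<notin> X0" for s
  proof -
    obtain \<alpha> \<beta> c where *: "\<alpha> \<noteq> 0" "\<beta> \<noteq> 0" "degree \<alpha> \<le> N" "degree \<beta> \<le> N + 1" "degree c \<le> N"
      "fps_of_poly \<beta> * f (of_real s) = fps_of_poly \<alpha> * log_fps (?h s) (?k s) + fps_of_poly c"
      "\<And>z. z \<noteq> 0 \<Longrightarrow> poly \<beta> z = 0 \<Longrightarrow> poly \<alpha> z \<noteq> 0"
      using logform[of s] by blast
    obtain r where r: "fps_of_poly (wpoly L p (of_real s)) * fps_deriv (f (of_real s)) +
        fps_of_poly (wpoly L q (of_real s)) * f (of_real s) = fps_of_poly r"
      using ode by blast
    show ?thesis
      using log_removed[OF hk(1,3) *(1-5) degree_wpoly *(6,7) r X0(2)[OF s], where n = n and g = "g (of_real s)"]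
      unfolding n_def g_def by auto
  qed
  \<comment> \<open>For real \<open>s\<close> outside \<open>X0\<close> the polynomial
    \<open>lin2 ^ n\<close> is a denominator of degree at most \<open>2 * n\<close>, with a
    numerator of degree at most \<open>4 * n\<close>; both bounds are uniform in
    \<open>s\<close>.\<close>
  obtain d X E where X: "finite X" and E: "\<And>i. degree (E i) \<le> i"
    and min: "\<And>s. s \<notin> X \<Longrightarrow> \<exists>\<gamma>. minimal_denominator (4 * n) (g s) \<gamma> \<and> degree \<gamma> = d \<and> coeff \<gamma> 0 = 1
        \<and> (\<forall>i. coeff \<gamma> i = poly (E i) s)"
  proof (rule generic_minimal_denominator[OF famg C convg, of "range complex_of_real - X0" "4 * n" "2 * n"])
    show "infinite (range complex_of_real - X0)" using infR X0(1) by simp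
    fix s assume "s \<in> range complex_of_real - X0"
    then obtain t where t: "s = of_real t" "of_real t \<notin> X0" by blast
    have "lin2 (?h t) (?k t) ^ n \<noteq> 0" by (simp add: lin2_nonzero)
    moreover have "degree (lin2 (?h t) (?k t) ^ n) \<le> 2 * n"
      using degree_power_le[of "lin2 (?h t) (?k t)" n] degree_lin2[of "?h t" "?k t"]
      by (meson le_trans mult_le_mono1)
    ultimately show "\<exists>\<gamma>. denominator_of (4 * n) (g s) \<gamma> \<and> degree \<gamma> \<le> 2 * n"
      using rem[OF t(2)] unfolding t(1) denominator_of_def fps_bdd_poly_iff by blast
  qed blast
  define Z where "Z = {s::real. of_real s \<in> X0 \<union> X}"
  have "finite Z" unfolding Z_def
    using finite_vimageI[of "X0 \<union> X" complex_of_real] X X0(1) by (simp add: vimage_def inj_def)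
  have key: "d > 0 \<and> (\<exists>m\<le>d. poly (E 1) (of_real s) = - (of_nat m * ?h s + of_nat (d - m) * ?k s) \<and>
      2 * poly (E 2) (of_real s) = (of_nat m * ?h s + of_nat (d - m) * ?k s)\<^sup>2
         - (of_nat m * (?h s)\<^sup>2 + of_nat (d - m) * (?k s)\<^sup>2))" if "s \<notin> Z" for s
  proof -
    have s: "of_real s \<notin> X0" "of_real s \<notin> X" using that by (auto simp: Z_def)
    obtain \<gamma> where \<gamma>: "minimal_denominator (4 * n) (g (of_real s)) \<gamma>" "degree \<gamma> = d" "coeff \<gamma> 0 = 1"
      "\<And>i. coeff \<gamma> i = poly (E i) (of_real s)" using min[OF s(2)] by blast
    obtain \<epsilon> where \<epsilon>: "fps_of_poly (lin2 (?h s) (?k s) ^ n) * g (of_real s) = fps_of_poly \<epsilon>"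
      using rem[OF s(1)] by blast
    obtain m k where mk: "\<gamma> = [:1, - ?h s:] ^ m * [:1, - ?k s:] ^ k" "degree \<gamma> = m + k"
      using minimal_denominator_lin2[OF hk(1,2) \<gamma>(1,3) \<epsilon>] by blast
    \<comment> \<open>A constant denominator would make \<open>g\<close> a polynomial, which the
      transcendence of the logarithm excludes.\<close>
    have "d \<noteq> 0"
    proof
      assume "d = 0"
      then have "\<gamma> = 1" using \<gamma>(2,3) by (metis degree_eq_zeroE coeff_pCons_0 pCons_one)
      then have "fps_bdd_poly (4 * n) (g (of_real s))"
        using \<gamma>(1) by (simp add: minimal_denominator_def denominator_of_def)
      then show False using rem[OF s(1)] by blast
    qed
    moreover have "k = d - m" "m \<le> d" using mk \<gamma>(2) by auto
    ultimately show ?thesis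
      using coeff_lin2_powers(2,3)[of "?h s" m "?k s" k] unfolding mk(1)[symmetric] \<gamma>(4) by blast
  qed
  have dense: "closure (- Z) = UNIV"
    using \<open>finite Z\<close> by (simp add: closure_complement empty_interior_finite)
  obtain s0 where "s0 \<notin> Z" using \<open>finite Z\<close> ex_new_if_finite infinite_UNIV_char_0 by blast
  then have "d > 0" using key by blast
  have rep: "P = [:coeff P 0, coeff P 1, coeff P 2:]" if "degree P \<le> 2" for P :: "complex poly"
    using that by (intro poly_eqI) (auto simp: coeff_pCons coeff_eq_0 numeral_2_eq_2 split: nat.split)
  define u0 u1 where "u0 = - Re (coeff (E 1) 0)" and "u1 = - Re (coeff (E 1) 1)"
  define v0 v1 v2 where "v0 = 2 * Re (coeff (E 2) 0)" and "v1 = 2 * Re (coeff (E 2) 1)" and "v2 = 2 * Re (coeff (E 2) 2)"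
  have E1: "Re (poly (E 1) (of_real s)) = - (u0 + u1 * s)" for s
  proof -
    have "degree (E 1) < 2" using E[of 1] by simp
    then show ?thesis
      by (subst rep) (auto simp: u0_def u1_def coeff_eq_0 algebra_simps)
  qed
  have E2: "2 * Re (poly (E 2) (of_real s)) = v0 + v1 * s + v2 * s\<^sup>2" for s
    by (subst rep[OF E]) (simp add: v0_def v1_def v2_def algebra_simps power2_eq_square)
  have keyR: "\<exists>m\<le>d. u0 + u1 * s = m * hp s + (d - m) * hm s \<and>
      v0 + v1 * s + v2 * s\<^sup>2 = (u0 + u1 * s)\<^sup>2 - (m * (hp s)\<^sup>2 + (d - m) * (hm s)\<^sup>2)" if s: "s \<notin> Z" for s
  proof -
    obtain m where m: "m \<le> d" "poly (E 1) (of_real s) = - (of_nat m * ?h s + of_nat (d - m) * ?k s)"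
      "2 * poly (E 2) (of_real s) = (of_nat m * ?h s + of_nat (d - m) * ?k s)\<^sup>2
         - (of_nat m * (?h s)\<^sup>2 + of_nat (d - m) * (?k s)\<^sup>2)"
      using key[OF s] by blast
    have 1: "u0 + u1 * s = m * hp s + (d - m) * hm s"
      using arg_cong[OF m(2), of Re] unfolding E1 by (simp add: Re_power2)
    moreover have "v0 + v1 * s + v2 * s\<^sup>2 = (m * hp s + (d - m) * hm s)\<^sup>2 - (m * (hp s)\<^sup>2 + (d - m) * (hm s)\<^sup>2)"
      using arg_cong[OF m(3), of Re] E2[of s] by (simp add: Re_power2 Im_power2)
    ultimately show ?thesis using m(1) by (intro exI[of _ m]) auto
  qed
  \<comment> \<open>\<open>\<mu> s\<close> recovers the multiplicity \<open>m\<close>, which may a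
    priori depend on \<open>s\<close>, from the first coefficient. It is continuous and takes
    integer values outside the finite set \<open>Z\<close>, hence everywhere, so it is
    constant.\<close>
  define \<mu> where "\<mu> s = (u0 + u1 * s - d * hm s) / (hp s - hm s)" for s
  have \<mu>: "\<mu> s = m" if "u0 + u1 * s = m * hp s + (d - m) * hm s" "m \<le> d" for s and m :: nat
  proof -
    have "u0 + u1 * s - d * hm s = m * (hp s - hm s)" using that by (simp add: of_nat_diff algebra_simps)
    then show ?thesis using sgn[of s] by (simp add: \<mu>_def)
  qed
  have cont\<mu>: "continuous_on UNIV \<mu>"
    unfolding \<mu>_def using sgn by (intro continuous_intros cont) (metis less_asym' less_trans right_minus_eq)
  have "\<mu> ` closure (- Z) \<subseteq> real ` {..d}"
  proof (rule image_closure_subset)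
    show "\<mu> ` (- Z) \<subseteq> real ` {..d}"
    proof
      fix r assume "r \<in> \<mu> ` (- Z)"
      then obtain s where s: "r = \<mu> s" "s \<notin> Z" by blast
      obtain m where "m \<le> d" "u0 + u1 * s = m * hp s + (d - m) * hm s" using keyR[OF s(2)] by blast
      then show "r \<in> real ` {..d}" using \<mu>[of s m] s(1) by auto
    qed
  qed (use cont\<mu> dense in \<open>auto intro: finite_imp_closed\<close>)
  then have fin: "\<mu> ` UNIV \<subseteq> real ` {..d}" unfolding dense .
  have "finite (\<mu> ` UNIV)" using finite_subset[OF fin] by simp
  then have "\<mu> constant_on UNIV"
    by (intro continuous_finite_range_constant cont\<mu> connected_UNIV)
  then obtain c where c: "\<And>s. \<mu> s = c" unfolding constant_on_def by blast
  then have "c \<in> real ` {..d}" using fin by auto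
  then obtain m where m: "m \<le> d" "\<And>s. \<mu> s = real m" using c by auto
  have p1: "u0 + u1 * s = m * hp s + (real d - m) * hm s" for s
    using m(2)[of s] sgn[of s] by (simp add: \<mu>_def field_simps)
  \<comment> \<open>Divide \<open>p1\<close> by \<open>s\<close> and let \<open>s\<close> tend to
    infinity along \<open>F\<close>.\<close>
  have u1: "u1 = m * a + (real d - m) * b"
    if F: "F \<noteq> bot" "(inverse \<longlongrightarrow> 0) F" "eventually (\<lambda>s. s \<noteq> 0) F"
      and l: "((\<lambda>s. hp s / s) \<longlongrightarrow> a) F" "((\<lambda>s. hm s / s) \<longlongrightarrow> b) F" for F :: "real filter" and a b :: real
  proof (rule tendsto_unique[OF F(1)])
    have e: "eventually (\<lambda>s. u0 * inverse s + u1 = m * (hp s / s) + (real d - m) * (hm s / s)) F"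
      using F(3)
    proof eventually_elim
      case (elim s)
      have "u0 * inverse s + u1 = (u0 + u1 * s) / s" using elim by (simp add: field_simps)
      then show ?case unfolding p1 by (simp add: add_divide_distrib)
    qed
    have "((\<lambda>s. u0 * inverse s + u1) \<longlongrightarrow> u0 * 0 + u1) F" by (intro tendsto_intros F)
    then show "((\<lambda>s. m * (hp s / s) + (real d - m) * (hm s / s)) \<longlongrightarrow> u1) F"
      using e by (auto intro: Lim_transform_eventually)
    show "((\<lambda>s. m * (hp s / s) + (real d - m) * (hm s / s)) \<longlongrightarrow> m * a + (real d - m) * b) F"
      by (intro tendsto_intros l)
  qed
  have "u1 = m * x + (real d - m) * y"
    by (rule u1[OF _ _ _ lims(1,2)])
       (auto intro: tendsto_inverse_0_at_top filterlim_ident eventually_not_equal_at_infinity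
         filter_leD[OF at_top_le_at_infinity])
  moreover have "u1 = m * y + (real d - m) * x"
    by (rule u1[OF _ _ _ lims(3,4)])
       (auto intro: tendsto_mono[OF at_bot_le_at_infinity tendsto_inverse_0] eventually_not_equal_at_infinity
         filter_leD[OF at_bot_le_at_infinity])
  \<comment> \<open>Passing from \<open>at_top\<close> to \<open>at_bot\<close> exchanges
    \<open>x\<close> and \<open>y\<close>, so both ends have the same multiplicity.\<close>
  ultimately have "(2 * real m - d) * (x - y) = 0" by (simp add: algebra_simps)
  then have dm: "real d = 2 * m" using \<open>x \<noteq> y\<close> by simp
  then have "m > 0" using \<open>d > 0\<close> by auto
  have "hp s + hm s = u0 / m + u1 / m * s" for s
    using p1[of s] \<open>m > 0\<close> by (simp add: dm field_simps)
  then show "\<exists>a b. \<forall>s. hp s + hm s = a + b * s" by blast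
  \<comment> \<open>With equal multiplicities the second coefficient yields the sum of squares;
    continuity covers the parameters in \<open>Z\<close>.\<close>
  have Q: "m * ((hp s)\<^sup>2 + (hm s)\<^sup>2) = (u0 + u1 * s)\<^sup>2 - (v0 + v1 * s + v2 * s\<^sup>2)" for s
  proof -
    define D where "D s = m * ((hp s)\<^sup>2 + (hm s)\<^sup>2) - ((u0 + u1 * s)\<^sup>2 - (v0 + v1 * s + v2 * s\<^sup>2))" for s
    have "D ` closure (- Z) \<subseteq> {0}"
    proof (rule image_closure_subset)
      show "continuous_on (closure (- Z)) D"
        unfolding D_def dense by (intro continuous_intros cont)
      have "D s = 0" if sZ: "s \<notin> Z" for s
      proof -
        obtain m' where m': "m' \<le> d" "u0 + u1 * s = m' * hp s + (d - m') * hm s"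
          "v0 + v1 * s + v2 * s\<^sup>2 = (u0 + u1 * s)\<^sup>2 - (m' * (hp s)\<^sup>2 + (d - m') * (hm s)\<^sup>2)"
          using keyR[OF sZ] by blast
        have "m' = m" using \<mu>[OF m'(2,1)] m(2) by simp
        moreover have "real (d - m) = m" using dm m(1) by (simp add: of_nat_diff)
        ultimately show ?thesis using m'(3) by (simp add: D_def algebra_simps)
      qed
      then show "D ` (- Z) \<subseteq> {0}" by auto
    qed auto
    then show ?thesis unfolding dense D_def by (auto simp: image_subset_iff)
  qed
  have "(hp s)\<^sup>2 + (hm s)\<^sup>2 = (u0\<^sup>2 - v0) / m + (2 * u0 * u1 - v1) / m * s + (u1\<^sup>2 - v2) / m * s\<^sup>2" for s
  proof -
    have e1: "(u0 + u1 * s)\<^sup>2 - (v0 + v1 * s + v2 * s\<^sup>2) = (u0\<^sup>2 - v0) + (2 * u0 * u1 - v1) * s + (u1\<^sup>2 - v2) * s\<^sup>2"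
      by (simp add: power2_eq_square algebra_simps)
    have e2: "(hp s)\<^sup>2 + (hm s)\<^sup>2 = m * ((hp s)\<^sup>2 + (hm s)\<^sup>2) / m" using \<open>m > 0\<close> by simp
    show ?thesis by (rule trans[OF e2]) (simp add: Q e1 add_divide_distrib del: of_nat_mult)
  qed
  then show "\<exists>a b c. \<forall>s. (hp s)\<^sup>2 + (hm s)\<^sup>2 = a + b * s + c * s\<^sup>2" by blast
qed

section \<open>Support functions and moments\<close>

text \<open>Right continuity at \<open>a\<close> and the left limit at \<open>b\<close> fix the end
  values of \<open>R\<close>, and monotonicity of the distribution function gives
  \<open>R' \<ge> 0\<close>. The density \<open>R'\<close> then has the same distribution function
  as \<open>\<mu>\<close>, which determines the measure.\<close>

lemma density_of_distribution_function:
  fixes \<mu> :: "real measure" and R R' :: "real \<Rightarrow> real"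
  assumes fin: "finite_borel_measure \<mu>" and "a < b"
    and null: "measure \<mu> {..a} = 0" "measure \<mu> {b..} = 0"
    and deriv: "\<And>t. (R has_real_derivative R' t) (at t)" and cont: "continuous_on UNIV R'"
    and cdf: "\<And>t. a < t \<Longrightarrow> t < b \<Longrightarrow> cdf \<mu> t = R t"
  shows "R a = 0" "R b = measure \<mu> UNIV"
    "\<mu> = density lborel (\<lambda>t. ennreal (R' t) * indicator {a..b} t)"
    "\<And>t. a \<le> t \<Longrightarrow> t \<le> b \<Longrightarrow> R' t \<ge> 0"
proof -
  interpret finite_borel_measure \<mu> by fact
  have contR: "isCont R t" for t using deriv DERIV_isCont by blast
  have "(cdf \<mu> \<longlongrightarrow> cdf \<mu> a) (at_right a)"
    using cdf_is_right_cont[of a] by (simp add: continuous_within)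
  moreover have "cdf \<mu> a = 0" using null by (simp add: cdf_def2)
  moreover have "eventually (\<lambda>t. cdf \<mu> t = R t) (at_right a)"
    using eventually_at_right_real[OF \<open>a < b\<close>] by eventually_elim (auto intro: cdf)
  ultimately have "(R \<longlongrightarrow> 0) (at_right a)"
    by (auto elim: Lim_transform_eventually)
  moreover have "(R \<longlongrightarrow> R a) (at_right a)"
    using contR[of a] by (simp add: isCont_def filterlim_at_split)
  ultimately show Ra: "R a = 0" using tendsto_unique trivial_limit_at_right_real by blast
  have "(cdf \<mu> \<longlongrightarrow> measure \<mu> {..<b}) (at_left b)" by (rule cdf_at_left)
  moreover have "eventually (\<lambda>t. cdf \<mu> t = R t) (at_left b)"
    using eventually_at_left_real[OF \<open>a < b\<close>] by eventually_elim (auto intro: cdf)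
  ultimately have "(R \<longlongrightarrow> measure \<mu> {..<b}) (at_left b)"
    by (auto elim: Lim_transform_eventually)
  moreover have "(R \<longlongrightarrow> R b) (at_left b)"
    using contR[of b] by (simp add: isCont_def filterlim_at_split)
  ultimately have Rb: "R b = measure \<mu> {..<b}" using tendsto_unique trivial_limit_at_left_real by blast
  \<comment> \<open>Sets beyond \<open>b\<close> carry no mass and can be added freely; this settles
    the end point \<open>b\<close> and all \<open>t > b\<close>.\<close>
  have tail: "measure \<mu> (S \<union> T) = measure \<mu> S" if "T \<subseteq> {b..}" "S \<in> sets borel" "T \<in> sets borel" for S T
  proof -
    have "measure \<mu> T \<le> measure \<mu> {b..}"
      using that by (intro finite_measure_mono) auto
    then have "measure \<mu> T = 0" using null(2) measure_nonneg[of \<mu> T] by linarith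
    moreover have "measure \<mu> (S \<union> T) \<le> measure \<mu> S + measure \<mu> T"
      using that by (intro measure_subadditive) auto
    moreover have "measure \<mu> S \<le> measure \<mu> (S \<union> T)"
      using that by (intro finite_measure_mono) auto
    ultimately show ?thesis by simp
  qed
  have "{..<b} \<union> {b..} = UNIV" by auto
  then show RU: "R b = measure \<mu> UNIV"
    using tail[of "{b..}" "{..<b}"] Rb by simp
  have cdf': "cdf \<mu> t = R t" if t: "a \<le> t" "t \<le> b" for t
  proof -
    consider "t = a" | "t = b" | "a < t" "t < b" using t by linarith
    then show ?thesis
    proof cases
      case 2
      have "{..<b} \<union> {b} = {..b}" by auto
      then show ?thesis using tail[of "{b}" "{..<b}"] Rb 2 by (simp add: cdf_def2)
    qed (use Ra \<open>cdf \<mu> a = 0\<close> cdf in auto)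
  qed
  have nonneg_open: "R' t \<ge> 0" if t: "a < t" "t < b" for t
  proof (rule ccontr)
    assume "\<not> ?thesis"
    then obtain d where d: "d > 0" "\<And>h. 0 < h \<Longrightarrow> h < d \<Longrightarrow> R (t + h) < R t"
      using DERIV_neg_dec_right[OF deriv[of t]] by (auto simp: not_le)
    define h where "h = min (d / 2) ((b - t) / 2)"
    have "h \<le> d / 2" unfolding h_def by (rule min.cobounded1)
    moreover have "h \<le> (b - t) / 2" unfolding h_def by (rule min.cobounded2)
    moreover from this have "t + h < b" using t by argo
    moreover have "0 < h" using d t by (simp add: h_def)
    ultimately have h: "0 < h" "h < d" "t + h < b" using d t by simp_all
    have "R t \<le> R (t + h)" using cdf_nondecreasing[of t "t + h"] cdf[of t] cdf[of "t + h"] t h by simp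
    with d(2)[OF h(1,2)] show False by simp
  qed
  show nonneg: "R' t \<ge> 0" if "a \<le> t" "t \<le> b" for t
  proof -
    have cl: "closure {a<..<b} = {a..b}" using \<open>a < b\<close> by simp
    have "R' ` closure {a<..<b} \<subseteq> {0..}"
      using nonneg_open cont by (intro image_closure_subset) (auto intro: continuous_on_subset)
    moreover have "R' t \<in> R' ` {a..b}" using that by simp
    ultimately show ?thesis unfolding cl by blast
  qed
  define \<nu> where "\<nu> = density lborel (\<lambda>t. ennreal (R' t) * indicator {a..b} t)"
  have [measurable]: "R' \<in> borel_measurable borel"
    using cont by (rule borel_measurable_continuous_onI)
  have sets\<nu>: "sets \<nu> = sets borel" by (simp add: \<nu>_def)
  have Ioc: "emeasure \<nu> {..t} = ennreal (cdf \<mu> t)" for t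
  proof -
    have "emeasure \<nu> {..t} = (\<integral>\<^sup>+ x. ennreal (R' x) * indicator {a..b} x * indicator {..t} x \<partial>lborel)"
      unfolding \<nu>_def by (subst emeasure_density) auto
    also have "\<dots> = (\<integral>\<^sup>+ x. ennreal (R' x) * indicator {a..min b t} x \<partial>lborel)"
      by (intro nn_integral_cong) (auto simp: indicator_def)
    also have "\<dots> = ennreal (cdf \<mu> t)"
    proof (cases "t < a")
      case True
      have "measure \<mu> {..t} \<le> measure \<mu> {..a}" using True by (intro finite_measure_mono) auto
      then have "cdf \<mu> t = 0" using null(1) measure_nonneg[of \<mu> "{..t}"] by (simp add: cdf_def2)
      then show ?thesis using True \<open>a < b\<close> by simp
    next
      case False
      have "(\<integral>\<^sup>+ x. ennreal (R' x) * indicator {a..min b t} x \<partial>lborel) = ennreal (R (min b t) - R a)"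
        using False \<open>a < b\<close> deriv nonneg by (intro nn_integral_FTC_Icc) auto
      also have "R (min b t) - R a = cdf \<mu> t"
      proof (cases "t \<le> b")
        case True
        then show ?thesis using False Ra cdf' by (simp add: min_def)
      next
        case tb: False
        have "{..b} \<union> {b<..t} = {..t}" using tb by auto
        moreover have "{b<..t} \<subseteq> {b..}" by auto
        ultimately have "cdf \<mu> t = cdf \<mu> b" using tail[of "{b<..t}" "{..b}"] by (simp add: cdf_def2)
        then show ?thesis using tb Ra cdf'[of b] \<open>a < b\<close> by (simp add: min_def)
      qed
      finally show ?thesis .
    qed
    finally show ?thesis .
  qed
  have "finite_measure \<nu>"
  proof (rule finite_measureI)
    have "emeasure \<nu> UNIV = (\<integral>\<^sup>+ x. ennreal (R' x) * indicator {a..b} x \<partial>lborel)"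
      unfolding \<nu>_def by (subst emeasure_density) auto
    also have "\<dots> = ennreal (R b - R a)"
      using \<open>a < b\<close> deriv nonneg by (intro nn_integral_FTC_Icc) auto
    finally show "emeasure \<nu> (space \<nu>) \<noteq> \<infinity>" by (simp add: \<nu>_def)
  qed
  then have fin\<nu>: "finite_borel_measure \<nu>"
    using sets\<nu> by (simp add: finite_borel_measure_def finite_borel_measure_axioms_def)
  have "\<mu> = \<nu>"
  proof (rule cdf_unique'[OF fin fin\<nu>], rule ext)
    fix t
    have "measure \<nu> {..t} = cdf \<mu> t" using Ioc[of t] cdf_nonneg by (simp add: measure_def)
    then show "cdf \<mu> t = cdf \<nu> t" by (simp add: cdf_def2)
  qed
  then show "\<mu> = density lborel (\<lambda>t. ennreal (R' t) * indicator {a..b} t)" by (simp add: \<nu>_def)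
qed

text \<open>For \<open>\<xi> \<noteq> 0\<close> the values \<open>\<xi> \<bullet> x\<close> on a
  bounded domain fill the open interval from \<open>- support_fun D (- \<xi>)\<close> to
  \<open>support_fun D \<xi>\<close>.\<close>

definition support_fun :: "'a::euclidean_space set \<Rightarrow> 'a \<Rightarrow> real" where
  "support_fun D \<xi> = (SUP x\<in>D. \<xi> \<bullet> x)"

locale bdd_domain =
  fixes D :: "'a::euclidean_space set"
  assumes open_D: "open D" and connected_D: "connected D" and nonempty_D: "D \<noteq> {}" and bounded_D: "bounded D"
begin

lemma bdd_inner: "bdd_above ((\<lambda>x. \<xi> \<bullet> x) ` D)" "bdd_below ((\<lambda>x. \<xi> \<bullet> x) ` D)"
proof -
  have "bounded ((\<lambda>x. \<xi> \<bullet> x) ` D)"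
    by (intro bounded_linear_image bounded_D bounded_linear_inner_right)
  then show "bdd_above ((\<lambda>x. \<xi> \<bullet> x) ` D)" "bdd_below ((\<lambda>x. \<xi> \<bullet> x) ` D)"
    by (auto intro: bounded_imp_bdd_above bounded_imp_bdd_below)
qed

lemma inner_le_support: "x \<in> D \<Longrightarrow> \<xi> \<bullet> x \<le> support_fun D \<xi>"
  unfolding support_fun_def by (rule cSUP_upper) (auto intro: bdd_inner)

lemma support_le: "(\<And>x. x \<in> D \<Longrightarrow> \<xi> \<bullet> x \<le> c) \<Longrightarrow> support_fun D \<xi> \<le> c"
  unfolding support_fun_def by (rule cSUP_least) (auto simp: nonempty_D)

lemma less_supportE:
  assumes "c < support_fun D \<xi>"
  obtains x where "x \<in> D" "c < \<xi> \<bullet> x"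
  using support_le[of \<xi> c] assms by (meson not_less)

text \<open>\<open>D\<close> is open, so \<open>x\<close> can be moved a little in the direction
  \<open>\<xi>\<close>.\<close>

lemma inner_less_support:
  assumes "\<xi> \<noteq> 0" "x \<in> D"
  shows "\<xi> \<bullet> x < support_fun D \<xi>"
proof -
  obtain e where e: "e > 0" "ball x e \<subseteq> D" using open_D assms(2) open_contains_ball by blast
  define y where "y = x + (e / (2 * norm \<xi>)) *\<^sub>R \<xi>"
  have "y \<in> ball x e" using e assms(1) by (simp add: y_def dist_norm)
  then have "\<xi> \<bullet> y \<le> support_fun D \<xi>" using e inner_le_support by blast
  moreover have "\<xi> \<bullet> y > \<xi> \<bullet> x" using e assms(1) by (simp add: y_def inner_right_distrib)
  ultimately show ?thesis by simp
qed

lemma neg_support_less_inner: "\<xi> \<noteq> 0 \<Longrightarrow> x \<in> D \<Longrightarrow> - support_fun D (-\<xi>) < \<xi> \<bullet> x"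
  using inner_less_support[of "-\<xi>" x] by simp

text \<open>The projection of the connected set \<open>D\<close> is an interval.\<close>

lemma hyperplane_meets:
  assumes "- support_fun D (-\<xi>) < t" "t < support_fun D \<xi>"
  shows "\<exists>x\<in>D. \<xi> \<bullet> x = t"
proof -
  obtain x where x: "x \<in> D" "t < \<xi> \<bullet> x" using assms(2) less_supportE by blast
  obtain y where y: "y \<in> D" "- t < (-\<xi>) \<bullet> y" using assms(1) less_supportE[of "-t" "-\<xi>"] by auto
  have "connected ((\<lambda>x. \<xi> \<bullet> x) ` D)"
    by (intro connected_continuous_image connected_D continuous_intros)
  then have "{\<xi> \<bullet> y..\<xi> \<bullet> x} \<subseteq> (\<lambda>x. \<xi> \<bullet> x) ` D"
    using x y by (intro connected_contains_Icc) auto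
  then have "t \<in> (\<lambda>x. \<xi> \<bullet> x) ` D" using x y by auto
  then show ?thesis by auto
qed

lemma support_scaleR: "c \<ge> 0 \<Longrightarrow> support_fun D (c *\<^sub>R \<xi>) = c * support_fun D \<xi>"
proof (rule antisym)
  assume "c \<ge> 0"
  then show "support_fun D (c *\<^sub>R \<xi>) \<le> c * support_fun D \<xi>"
    by (intro support_le) (auto intro: mult_left_mono inner_le_support)
  show "c * support_fun D \<xi> \<le> support_fun D (c *\<^sub>R \<xi>)"
  proof (cases "c = 0")
    case True
    then show ?thesis using nonempty_D by (auto simp: support_fun_def)
  next
    case False
    with \<open>c \<ge> 0\<close> have "c > 0" by simp
    have "support_fun D \<xi> \<le> support_fun D (c *\<^sub>R \<xi>) / c"
    proof (rule support_le)
      fix x assume "x \<in> D"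
      then show "\<xi> \<bullet> x \<le> support_fun D (c *\<^sub>R \<xi>) / c"
        using inner_le_support[of x "c *\<^sub>R \<xi>"] \<open>c > 0\<close> by (simp add: field_simps)
    qed
    then show ?thesis using \<open>c > 0\<close> by (simp add: field_simps)
  qed
qed

lemma continuous_support: "continuous_on UNIV (support_fun D)"
proof -
  obtain B where B: "\<And>x. x \<in> D \<Longrightarrow> norm x \<le> B" using bounded_D bounded_iff by blast
  have "B \<ge> 0" using B nonempty_D norm_ge_zero order_trans by blast
  have *: "support_fun D \<xi> \<le> support_fun D \<eta> + B * norm (\<xi> - \<eta>)" for \<xi> \<eta>
  proof (rule support_le)
    fix x assume x: "x \<in> D"
    have "\<xi> \<bullet> x = \<eta> \<bullet> x + (\<xi> - \<eta>) \<bullet> x" by (simp add: inner_diff_left)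
    also have "(\<xi> - \<eta>) \<bullet> x \<le> norm (\<xi> - \<eta>) * B"
      using norm_cauchy_schwarz[of "\<xi> - \<eta>" x] mult_left_mono[OF B[OF x], of "norm (\<xi> - \<eta>)"] by simp
    finally show "\<xi> \<bullet> x \<le> support_fun D \<eta> + B * norm (\<xi> - \<eta>)"
      using inner_le_support[OF x, of \<eta>] by (simp add: mult.commute)
  qed
  have "B-lipschitz_on UNIV (support_fun D)"
  proof (rule lipschitz_onI)
    fix x y
    show "dist (support_fun D x) (support_fun D y) \<le> B * dist x y"
      using *[of x y] *[of y x] by (simp add: dist_norm norm_minus_commute abs_le_iff)
  qed fact
  then show ?thesis by (rule lipschitz_on_continuous_on)
qed

text \<open>The push-forward of the volume on \<open>D\<close> under projection; its distribution
  function is the volume function.\<close>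

definition section_measure :: "'a \<Rightarrow> real measure" where
  "section_measure \<xi> = distr (restrict_space lborel D) borel (\<lambda>x. \<xi> \<bullet> x)"

lemma D_sets: "D \<in> sets borel" using open_D by simp

lemma emeasure_D: "emeasure lborel D < \<infinity>"
  using emeasure_bounded_finite[OF bounded_D] by simp

lemma measure_section:
  assumes "X \<in> sets borel"
  shows "measure (section_measure \<xi>) X = measure lebesgue (D \<inter> {x. \<xi> \<bullet> x \<in> X})"
proof -
  have [measurable]: "(\<lambda>x. \<xi> \<bullet> x) \<in> measurable (restrict_space lborel D) borel"
    by (intro measurable_restrict_space1) simp
  have set: "D \<inter> {x. \<xi> \<bullet> x \<in> X} \<in> sets borel"
    using D_sets measurable_sets[of "\<lambda>x. \<xi> \<bullet> x" borel borel X] assms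
    by (auto simp: vimage_def intro: sets.Int)
  have "measure (section_measure \<xi>) X = measure (restrict_space lborel D) ((\<lambda>x. \<xi> \<bullet> x) -` X \<inter> D)"
    unfolding section_measure_def using assms by (subst measure_distr) (auto simp: space_restrict_space)
  also have "\<dots> = measure lborel (D \<inter> {x. \<xi> \<bullet> x \<in> X})"
    using D_sets by (subst measure_restrict_space) (auto simp: vimage_def Int_commute)
  also have "\<dots> = measure lebesgue (D \<inter> {x. \<xi> \<bullet> x \<in> X})"
    using set by (simp add: measure_completion)
  finally show ?thesis .
qed

lemma finite_section: "finite_borel_measure (section_measure \<xi>)"
proof -
  have "(\<lambda>x. \<xi> \<bullet> x) \<in> measurable (restrict_space lborel D) borel"
    by (intro measurable_restrict_space1) simp
  moreover have "finite_measure (restrict_space lborel D)"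
    using emeasure_D D_sets by (intro finite_measure_restrict_space finite_measureI)
     (auto simp: emeasure_restrict_space)
  ultimately show ?thesis
    unfolding section_measure_def finite_borel_measure_def finite_borel_measure_axioms_def
    by (auto intro: finite_measure.finite_measure_distr)
qed

lemma integral_section:
  fixes \<phi> :: "real \<Rightarrow> 'b::{banach, second_countable_topology}"
  assumes [measurable]: "\<phi> \<in> borel_measurable borel"
  shows "(\<integral>t. \<phi> t \<partial>section_measure \<xi>) = (\<integral>x. indicator D x *\<^sub>R \<phi> (\<xi> \<bullet> x) \<partial>lborel)"
proof -
  have "(\<lambda>x. \<xi> \<bullet> x) \<in> measurable (restrict_space lborel D) borel"
    by (intro measurable_restrict_space1) simp
  then have "(\<integral>t. \<phi> t \<partial>section_measure \<xi>) = (\<integral>x. \<phi> (\<xi> \<bullet> x) \<partial>restrict_space lborel D)"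
    unfolding section_measure_def by (rule integral_distr) simp
  also have "\<dots> = (\<integral>x. indicator D x *\<^sub>R \<phi> (\<xi> \<bullet> x) \<partial>lborel)"
    using D_sets by (subst integral_restrict_space) auto
  finally show ?thesis .
qed

end

section \<open>Moments of the rational density in one direction\<close>

lemma remove_common_factors:
  fixes A0 B0 :: "complex poly"
  assumes "B0 \<noteq> 0"
  shows "\<exists>A B G. A0 = A * G \<and> B0 = B * G \<and> (\<forall>z. \<not> (poly A z = 0 \<and> poly B z = 0))"
  using assms
proof (induction "degree B0" arbitrary: A0 B0 rule: less_induct)
  case less
  show ?case
  proof (cases "\<exists>z. poly A0 z = 0 \<and> poly B0 z = 0")
    case True
    then obtain z A1 B1 where *: "A0 = [:-z, 1:] * A1" "B0 = [:-z, 1:] * B1"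
      unfolding poly_eq_0_iff_dvd by (meson dvdE)
    have "B1 \<noteq> 0" using less.prems * by auto
    then have "degree B1 < degree B0" unfolding * by (subst degree_mult_eq) auto
    then obtain A B G where "A1 = A * G" "B1 = B * G" "\<forall>z. \<not> (poly A z = 0 \<and> poly B z = 0)"
      using less.hyps \<open>B1 \<noteq> 0\<close> by blast
    then show ?thesis
      unfolding * by (intro exI[of _ A] exI[of _ B] exI[of _ "[:-z, 1:] * G"]) (simp only: mult_ac simp_thms)
  next
    case False
    then show ?thesis by (intro exI[of _ A0] exI[of _ B0] exI[of _ 1]) auto
  qed
qed

lemma poly_map_of_real: "poly (map_poly of_real p) (of_real x) = (of_real (poly p x) :: complex)"
  by (induction p) (auto simp: map_poly_pCons)

lemma degree_map_of_real: "degree (map_poly of_real p :: complex poly) = degree p"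
  by (rule degree_map_poly) simp

lemma map_poly_of_real_eq_0_iff: "map_poly of_real p = (0 :: complex poly) \<longleftrightarrow> p = 0"
  by (rule map_poly_eq_0_iff) auto

lemma poly_eq_sum_atMost: "degree p \<le> N \<Longrightarrow> poly p x = (\<Sum>i\<le>N. coeff p i * x ^ i)" for p :: "complex poly"
  unfolding poly_altdef by (rule sum.mono_neutral_left) (auto simp: coeff_eq_0)

context bdd_domain
begin

definition moment :: "'a \<Rightarrow> nat \<Rightarrow> real" where
  "moment \<xi> k = (\<integral>x. indicator D x *\<^sub>R (\<xi> \<bullet> x) ^ k \<partial>lborel)"

lemma support_interval: "\<xi> \<noteq> 0 \<Longrightarrow> - support_fun D (-\<xi>) < support_fun D \<xi>"
  using nonempty_D inner_less_support neg_support_less_inner by (metis all_not_in_conv less_trans)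

definition rational_volume :: "nat \<Rightarrow> bool" where
  "rational_volume N \<longleftrightarrow> (\<forall>\<xi>. \<xi> \<noteq> 0 \<longrightarrow> (\<exists>a b::real poly. degree a \<le> N \<and> degree b \<le> N \<and> (\<forall>t. poly b t \<noteq> 0) \<and>
     (\<forall>t. (\<exists>x\<in>D. \<xi> \<bullet> x = t) \<longrightarrow> measure lebesgue (D \<inter> {x. \<xi> \<bullet> x \<le> t}) = poly a t / poly b t)))"

lemma measure_section_null:
  assumes "\<xi> \<noteq> 0"
  shows "measure (section_measure \<xi>) {..- support_fun D (-\<xi>)} = 0"
    "measure (section_measure \<xi>) {support_fun D \<xi>..} = 0"
proof -
  have "D \<inter> {x. \<xi> \<bullet> x \<in> {..- support_fun D (-\<xi>)}} = {}" "D \<inter> {x. \<xi> \<bullet> x \<in> {support_fun D \<xi>..}} = {}"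
    using inner_less_support[OF assms] neg_support_less_inner[OF assms] by fastforce+
  then show "measure (section_measure \<xi>) {..- support_fun D (-\<xi>)} = 0"
    "measure (section_measure \<xi>) {support_fun D \<xi>..} = 0"
    by (simp_all add: measure_section)
qed

lemma measure_D_pos: "measure lebesgue D > 0"
proof -
  have "D \<in> lmeasurable" using bounded_D open_D by (rule lmeasurable_open)
  moreover have "\<not> negligible D" using open_not_negligible open_D nonempty_D by blast
  ultimately show ?thesis
    by (metis less_eq_real_def measure_nonneg negligible_iff_measure)
qed

text \<open>The density is the derivative of \<open>a / b\<close>, with denominator
  \<open>b * b\<close>, which accounts for the bound \<open>2 * N\<close>. Its numerator is nonzero
  because \<open>a / b\<close> grows from \<open>0\<close> to the volume of \<open>D\<close> across
  the interval.\<close>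

lemma rational_volume_density:
  assumes "rational_volume N" "\<xi> \<noteq> 0"
  obtains R R' :: "real poly" where
    "degree R \<le> 2 * N" "degree R' \<le> 2 * N" "\<And>t. poly R' t \<noteq> 0" "R \<noteq> 0"
    "\<And>k. ((\<lambda>t. t ^ k * (poly R t / poly R' t)) has_integral moment \<xi> k) {- support_fun D (-\<xi>)..support_fun D \<xi>}"
proof -
  let ?a = "- support_fun D (-\<xi>)" and ?b = "support_fun D \<xi>"
  obtain a b :: "real poly" where ab: "degree a \<le> N" "degree b \<le> N" "\<And>t. poly b t \<noteq> 0"
    "\<And>t. (\<exists>x\<in>D. \<xi> \<bullet> x = t) \<Longrightarrow> measure lebesgue (D \<inter> {x. \<xi> \<bullet> x \<le> t}) = poly a t / poly b t"
    using assms unfolding rational_volume_def by blast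
  define V where "V t = poly a t / poly b t" for t
  define R where "R = pderiv a * b - a * pderiv b"
  define R' where "R' = b * b"
  define r where "r t = poly R t / poly R' t" for t
  have dV: "(V has_real_derivative r t) (at t)" for t
    unfolding V_def r_def R_def R'_def
    by (rule derivative_eq_intros poly_DERIV ab)+ (simp add: power2_eq_square)
  have contr: "continuous_on UNIV r"
    unfolding r_def R'_def using ab(3) by (intro continuous_intros) auto
  have cdf: "cdf (section_measure \<xi>) t = V t" if "?a < t" "t < ?b" for t
    using ab(4)[OF hyperplane_meets[OF that]] by (simp add: cdf_def2 measure_section V_def)
  note d = density_of_distribution_function[where R = V and R' = r, OF finite_section[of \<xi>] support_interval[OF assms(2)]
      measure_section_null[OF assms(2)] dV contr]
  have dens: "V ?a = 0" "V ?b = measure (section_measure \<xi>) UNIV"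
    "section_measure \<xi> = density lborel (\<lambda>t. ennreal (r t) * indicator {?a..?b} t)"
    by (rule d(1-3), rule cdf, assumption+)+
  have r_nonneg: "r t \<ge> 0" if "?a \<le> t" "t \<le> ?b" for t
    by (rule d(4)[OF _ that]) (rule cdf)
  have [measurable]: "r \<in> borel_measurable borel"
    using contr by (rule borel_measurable_continuous_onI)
  have "((\<lambda>t. t ^ k * r t) has_integral moment \<xi> k) {?a..?b}" for k
  proof -
    have "moment \<xi> k = (\<integral>t. t ^ k \<partial>section_measure \<xi>)"
      unfolding moment_def by (subst integral_section) auto
    also have "\<dots> = (\<integral>t. t ^ k \<partial>density lborel (\<lambda>t. ennreal (r t * indicator {?a..?b} t)))"
    proof -
      have eq: "(\<lambda>t. ennreal (r t) * indicator {?a..?b} t) = (\<lambda>t. ennreal (r t * indicator {?a..?b} t))"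
        by (auto simp: fun_eq_iff split: split_indicator)
      have "section_measure \<xi> = density lborel (\<lambda>t. ennreal (r t * indicator {?a..?b} t))"
        by (rule trans[OF dens(3)]) (rule arg_cong[OF eq])
      then show ?thesis by (simp only:)
    qed
    also have "\<dots> = (\<integral>t. (r t * indicator {?a..?b} t) *\<^sub>R t ^ k \<partial>lborel)"
      by (rule integral_density) (auto simp: r_nonneg split: split_indicator)
    also have "\<dots> = (\<integral>t. indicator {?a..?b} t *\<^sub>R (t ^ k * r t) \<partial>lborel)"
      by (intro Bochner_Integration.integral_cong) auto
    finally have 1: "moment \<xi> k = (LINT t:{?a..?b}|lborel. t ^ k * r t)"
      by (simp add: set_lebesgue_integral_def)
    have "set_integrable lborel {?a..?b} (\<lambda>t. t ^ k * r t)"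
      by (intro borel_integrable_atLeastAtMost' continuous_intros continuous_on_subset[OF contr]) auto
    then show ?thesis
      unfolding 1 using set_borel_integral_eq_integral by (metis integrable_integral)
  qed
  moreover have "degree R \<le> N + N" unfolding R_def
    using ab degree_mult_le[of "pderiv a" b] degree_mult_le[of a "pderiv b"]
    by (intro degree_diff_le) (auto simp: degree_pderiv)
  moreover have "degree R' \<le> N + N"
    unfolding R'_def using ab degree_mult_le[of b b] by simp
  moreover have "R \<noteq> 0"
  proof
    assume "R = 0"
    then have "r t = 0" for t by (simp add: r_def)
    then have "\<forall>t. (V has_real_derivative 0) (at t)" using dV by simp
    then have "V ?a = V ?b" by (rule DERIV_isconst_all)
    moreover have "measure (section_measure \<xi>) UNIV = measure lebesgue D" by (simp add: measure_section)
    ultimately show False using dens(1,2) measure_D_pos by simp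
  qed
  ultimately show thesis using ab(3) unfolding r_def by (intro that[of R R']) (auto simp: R'_def)
qed

text \<open>After cancelling common factors, \<open>B\<close> times the density is \<open>A\<close>.
  Both sides are the integral of \<open>A(t) t ^ j\<close> between the ends: the left one expands
  \<open>B\<close> against the density into moments, the right one integrates \<open>A\<close> term
  by term.\<close>

lemma moment_relation:
  assumes "rational_volume N" "\<xi> \<noteq> 0"
  shows "\<exists>A B. A \<noteq> 0 \<and> B \<noteq> 0 \<and> degree A \<le> 2 * N \<and> degree B \<le> 2 * N \<and>
      (\<forall>z. \<not> (poly A z = 0 \<and> poly B z = 0)) \<and>
      (\<forall>j. (\<Sum>i\<le>2*N. coeff B i * complex_of_real (moment \<xi> (j + i))) =
         (\<Sum>i\<le>2*N. coeff A i * ((of_real (support_fun D \<xi>) ^ (i + j + 1)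
           - of_real (- support_fun D (-\<xi>)) ^ (i + j + 1)) / of_nat (i + j + 1))))"
proof -
  let ?a = "- support_fun D (-\<xi>)" and ?b = "support_fun D \<xi>"
  obtain R R' where R: "degree R \<le> 2 * N" "degree R' \<le> 2 * N" "\<And>t. poly R' t \<noteq> 0" "R \<noteq> 0"
    "\<And>k. ((\<lambda>t. t ^ k * (poly R t / poly R' t)) has_integral moment \<xi> k) {?a..?b}"
    using rational_volume_density[OF assms] by blast
  define A0 B0 where "A0 = (map_poly of_real R :: complex poly)" and "B0 = (map_poly of_real R' :: complex poly)"
  have "R' \<noteq> 0" using R(3)[of 0] by auto
  then have "A0 \<noteq> 0" "B0 \<noteq> 0" using R(4) by (simp_all add: A0_def B0_def map_poly_of_real_eq_0_iff)
  obtain A B G where G: "A0 = A * G" "B0 = B * G" "\<And>z. \<not> (poly A z = 0 \<and> poly B z = 0)"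
    using remove_common_factors[OF \<open>B0 \<noteq> 0\<close>, of A0] by blast
  have nz: "A \<noteq> 0" "B \<noteq> 0" "G \<noteq> 0" using G \<open>A0 \<noteq> 0\<close> \<open>B0 \<noteq> 0\<close> by auto
  have dA: "degree A \<le> 2 * N"
  proof -
    have "degree A \<le> degree A0" unfolding G using nz by (simp add: degree_mult_eq)
    then show ?thesis using R(1) by (simp add: A0_def degree_map_of_real)
  qed
  have dB: "degree B \<le> 2 * N"
  proof -
    have "degree B \<le> degree B0" unfolding G using nz by (simp add: degree_mult_eq)
    then show ?thesis using R(2) by (simp add: B0_def degree_map_of_real)
  qed
  have ratio: "poly B (of_real t) * of_real (poly R t / poly R' t) = poly A (of_real t)" for t
  proof -
    have 1: "of_real (poly R t) = poly A (of_real t) * poly G (of_real t)"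
      using arg_cong[OF G(1), of "\<lambda>p. poly p (of_real t)"] by (simp add: A0_def poly_map_of_real)
    have 2: "of_real (poly R' t) = poly B (of_real t) * poly G (of_real t)"
      using arg_cong[OF G(2), of "\<lambda>p. poly p (of_real t)"] by (simp add: B0_def poly_map_of_real)
    then have "poly B (of_real t) * poly G (of_real t) \<noteq> 0" using R(3)[of t] by (metis of_real_eq_0_iff)
    then show ?thesis by (simp add: 1 2)
  qed
  have "(\<Sum>i\<le>2*N. coeff B i * complex_of_real (moment \<xi> (j + i))) =
         (\<Sum>i\<le>2*N. coeff A i * ((of_real ?b ^ (i + j + 1) - of_real ?a ^ (i + j + 1)) / of_nat (i + j + 1)))" for j
  proof (rule has_integral_unique)
    let ?F = "\<lambda>t. poly A (of_real t) * of_real t ^ j :: complex"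
    have "((\<lambda>t. \<Sum>i\<le>2*N. coeff B i * of_real (t ^ (j + i) * (poly R t / poly R' t))) has_integral
        (\<Sum>i\<le>2*N. coeff B i * complex_of_real (moment \<xi> (j + i)))) {?a..?b}"
      by (intro has_integral_sum has_integral_mult_right has_integral_of_real R(5)) auto
    also have "(\<lambda>t. \<Sum>i\<le>2*N. coeff B i * of_real (t ^ (j + i) * (poly R t / poly R' t))) = ?F"
    proof
      fix t
      have e: "of_real (t ^ (j + i) * c) = of_real t ^ i * of_real c * (of_real t ^ j :: complex)" for i c
        by (simp add: power_add mult_ac)
      have "(\<Sum>i\<le>2*N. coeff B i * of_real (t ^ (j + i) * (poly R t / poly R' t))) =
        (\<Sum>i\<le>2*N. coeff B i * of_real t ^ i) * of_real (poly R t / poly R' t) * of_real t ^ j"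
        unfolding e sum_distrib_right by (simp only: mult.assoc)
      also have "\<dots> = ?F t" using ratio[of t] poly_eq_sum_atMost[OF dB, of "of_real t"] by simp
      finally show "(\<Sum>i\<le>2*N. coeff B i * of_real (t ^ (j + i) * (poly R t / poly R' t))) = ?F t" .
    qed
    finally show "(?F has_integral (\<Sum>i\<le>2*N. coeff B i * complex_of_real (moment \<xi> (j + i)))) {?a..?b}" .
    have pw: "((\<lambda>t. t ^ k) has_integral (?b ^ (k + 1) - ?a ^ (k + 1)) / real (k + 1)) {?a..?b}" for k
    proof -
      have "((\<lambda>t. t ^ k) has_integral ?b ^ (k + 1) / real (k + 1) - ?a ^ (k + 1) / real (k + 1)) {?a..?b}"
        using support_interval[OF assms(2)]
      proof (intro fundamental_theorem_of_calculus)
        fix t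
        have "((\<lambda>t. t ^ (k + 1) / real (k + 1)) has_real_derivative t ^ k) (at t within {?a..?b})"
          by (rule DERIV_cong[OF DERIV_cdivide[OF DERIV_pow[of "k + 1"]]]) (simp del: of_nat_Suc)
        then show "((\<lambda>t. t ^ (k + 1) / real (k + 1)) has_vector_derivative t ^ k) (at t within {?a..?b})"
          by (simp only: has_real_derivative_iff_has_vector_derivative)
      qed simp
      then show ?thesis by (simp only: diff_divide_distrib)
    qed
    have "((\<lambda>t. \<Sum>i\<le>2*N. coeff A i * of_real (t ^ (i + j))) has_integral
       (\<Sum>i\<le>2*N. coeff A i * of_real ((?b ^ (i + j + 1) - ?a ^ (i + j + 1)) / real (i + j + 1)))) {?a..?b}"
      by (intro has_integral_sum has_integral_mult_right has_integral_of_real pw) auto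
    also have "(\<lambda>t. \<Sum>i\<le>2*N. coeff A i * of_real (t ^ (i + j))) = ?F"
    proof
      fix t
      show "(\<Sum>i\<le>2*N. coeff A i * of_real (t ^ (i + j))) = ?F t"
        unfolding poly_eq_sum_atMost[OF dA] sum_distrib_right
        by (intro sum.cong refl) (simp add: power_add)
    qed
    finally show "(?F has_integral (\<Sum>i\<le>2*N. coeff A i * ((of_real ?b ^ (i + j + 1) - of_real ?a ^ (i + j + 1)) / of_nat (i + j + 1)))) {?a..?b}"
      by (simp only: of_real_divide of_real_diff of_real_power of_real_of_nat_eq)
  qed
  note rel = this
  show ?thesis
    by (rule exI[of _ A], rule exI[of _ B], intro conjI allI) (rule nz dA dB G(3) rel)+
qed

section \<open>Moments and support function along a line\<close>

lemma integrable_on_D: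
  fixes f :: "'a \<Rightarrow> real"
  assumes "continuous_on UNIV f"
  shows "integrable lborel (\<lambda>x. indicator D x *\<^sub>R f x)"
proof -
  have "compact (f ` closure D)"
    using assms bounded_D by (intro compact_continuous_image) (auto intro: continuous_on_subset)
  then have "bounded (f ` closure D)" by (rule compact_imp_bounded)
  then obtain B where B: "\<forall>y\<in>f ` closure D. norm y \<le> B" unfolding bounded_iff by blast
  show ?thesis
  proof (rule integrableI_bounded_set_indicator[where B = B])
    show "AE x in lborel. x \<in> D \<longrightarrow> norm (f x) \<le> B"
      using B closure_subset[of D] by (intro AE_I2) blast
  qed (use D_sets emeasure_D borel_measurable_continuous_onI[OF assms] in auto)
qed

text \<open>The binomial expansion of the moment in direction \<open>\<xi> + s \<eta>\<close>, as a
  complex polynomial so that \<open>s\<close> may leave the real line.\<close>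

definition line_moment :: "'a \<Rightarrow> 'a \<Rightarrow> nat \<Rightarrow> complex poly" where
  "line_moment \<xi> \<eta> j = (\<Sum>i\<le>j. monom (of_nat (j choose i) *
      of_real (\<integral>x. indicator D x *\<^sub>R ((\<eta> \<bullet> x) ^ i * (\<xi> \<bullet> x) ^ (j - i)) \<partial>lborel)) i)"

lemma poly_line_moment: "poly (line_moment \<xi> \<eta> j) (of_real s) = of_real (moment (\<xi> + s *\<^sub>R \<eta>) j)"
proof -
  have "moment (\<xi> + s *\<^sub>R \<eta>) j = (\<integral>x. (\<Sum>i\<le>j. (of_nat (j choose i) * s ^ i) *
      (indicator D x *\<^sub>R ((\<eta> \<bullet> x) ^ i * (\<xi> \<bullet> x) ^ (j - i)))) \<partial>lborel)"
    unfolding moment_def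
  proof (intro Bochner_Integration.integral_cong refl)
    fix x
    have "((\<xi> + s *\<^sub>R \<eta>) \<bullet> x) ^ j = (s * (\<eta> \<bullet> x) + \<xi> \<bullet> x) ^ j"
      by (simp add: inner_add_left add.commute)
    also have "\<dots> = (\<Sum>i\<le>j. of_nat (j choose i) * (s * (\<eta> \<bullet> x)) ^ i * (\<xi> \<bullet> x) ^ (j - i))"
      by (rule binomial_ring)
    finally show "indicator D x *\<^sub>R ((\<xi> + s *\<^sub>R \<eta>) \<bullet> x) ^ j = (\<Sum>i\<le>j. (of_nat (j choose i) * s ^ i) *
      (indicator D x *\<^sub>R ((\<eta> \<bullet> x) ^ i * (\<xi> \<bullet> x) ^ (j - i))))"
      by (simp add: sum_distrib_left power_mult_distrib mult_ac)
  qed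
  also have "\<dots> = (\<Sum>i\<le>j. (of_nat (j choose i) * s ^ i) *
     (\<integral>x. indicator D x *\<^sub>R ((\<eta> \<bullet> x) ^ i * (\<xi> \<bullet> x) ^ (j - i)) \<partial>lborel))"
    by (subst Bochner_Integration.integral_sum)
       (intro integrable_mult_right integrable_on_D continuous_intros, simp only: integral_mult_right_zero)
  finally show ?thesis
    by (simp add: line_moment_def poly_sum poly_monom mult_ac)
qed

text \<open>On \<open>D\<close> both inner products are bounded by \<open>C\<close>, so the binomial
  theorem gives the bound with \<open>K\<close> the volume of \<open>D\<close>, also for complex
  \<open>s\<close>.\<close>

lemma line_moment_growth:
  obtains K C where "C > 0" "\<And>j s. cmod (poly (line_moment \<xi> \<eta> j) s) \<le> K * (C * (1 + cmod s)) ^ j"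
proof -
  obtain B where B: "\<And>x. x \<in> D \<Longrightarrow> norm x \<le> B" using bounded_D bounded_iff by blast
  have "B \<ge> 0" using B nonempty_D norm_ge_zero order_trans by blast
  define C where "C = max (norm \<xi>) (norm \<eta>) * B + 1"
  have C: "C > 0" using \<open>B \<ge> 0\<close> by (simp add: C_def add_nonneg_pos le_max_iff_disj)
  have in1: "\<bar>\<xi> \<bullet> x\<bar> \<le> C" "\<bar>\<eta> \<bullet> x\<bar> \<le> C" if "x \<in> D" for x
  proof -
    have "norm \<zeta> * norm x \<le> max (norm \<xi>) (norm \<eta>) * B" if "\<zeta> \<in> {\<xi>, \<eta>}" for \<zeta>
      using B[OF \<open>x \<in> D\<close>] that by (intro mult_mono) (auto simp: le_max_iff_disj)
    then show "\<bar>\<xi> \<bullet> x\<bar> \<le> C" "\<bar>\<eta> \<bullet> x\<bar> \<le> C"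
      using Cauchy_Schwarz_ineq2[of \<xi> x] Cauchy_Schwarz_ineq2[of \<eta> x] unfolding C_def by fastforce+
  qed
  define K where "K = measure lborel D"
  have mb: "\<bar>\<integral>x. indicator D x *\<^sub>R ((\<eta> \<bullet> x) ^ i * (\<xi> \<bullet> x) ^ (j - i)) \<partial>lborel\<bar> \<le> K * C ^ j" if "i \<le> j" for i j
  proof -
    have "\<bar>\<integral>x. indicator D x *\<^sub>R ((\<eta> \<bullet> x) ^ i * (\<xi> \<bullet> x) ^ (j - i)) \<partial>lborel\<bar> \<le>
       (\<integral>x. \<bar>indicator D x *\<^sub>R ((\<eta> \<bullet> x) ^ i * (\<xi> \<bullet> x) ^ (j - i))\<bar> \<partial>lborel)"
      by (rule integral_abs_bound)
    also have "\<dots> \<le> (\<integral>x. indicator D x *\<^sub>R C ^ j \<partial>lborel)"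
    proof (rule integral_mono)
      show "integrable lborel (\<lambda>x. indicator D x *\<^sub>R C ^ j)" by (rule integrable_on_D) simp
      show "integrable lborel (\<lambda>x. \<bar>indicator D x *\<^sub>R ((\<eta> \<bullet> x) ^ i * (\<xi> \<bullet> x) ^ (j - i))\<bar>)"
        by (intro integrable_abs integrable_on_D continuous_intros)
      fix x
      have "\<bar>\<eta> \<bullet> x\<bar> ^ i * \<bar>\<xi> \<bullet> x\<bar> ^ (j - i) \<le> C ^ i * C ^ (j - i)" if "x \<in> D"
        using in1[OF that] C by (intro mult_mono power_mono) auto
      also have "C ^ i * C ^ (j - i) = C ^ j" using \<open>i \<le> j\<close> by (simp add: power_add[symmetric])
      finally show "\<bar>indicator D x *\<^sub>R ((\<eta> \<bullet> x) ^ i * (\<xi> \<bullet> x) ^ (j - i))\<bar> \<le> indicator D x *\<^sub>R C ^ j"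
        by (auto simp: indicator_def abs_mult power_abs)
    qed
    also have "\<dots> = K * C ^ j" using D_sets emeasure_D by (simp add: K_def)
    finally show ?thesis .
  qed
  show thesis
  proof (rule that[OF C])
    fix j s
    have "cmod (poly (line_moment \<xi> \<eta> j) s) \<le> (\<Sum>i\<le>j. (of_nat (j choose i) * (K * C ^ j)) * cmod s ^ i)"
      unfolding line_moment_def poly_sum poly_monom
    proof (intro order_trans[OF norm_sum] sum_mono)
      fix i assume i: "i \<in> {..j}"
      let ?I = "\<integral>x. indicator D x *\<^sub>R ((\<eta> \<bullet> x) ^ i * (\<xi> \<bullet> x) ^ (j - i)) \<partial>lborel"
      have "cmod (of_nat (j choose i) * of_real ?I * s ^ i) = of_nat (j choose i) * \<bar>?I\<bar> * cmod s ^ i"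
        by (simp only: norm_mult norm_power norm_of_nat norm_of_real)
      also have "\<dots> \<le> (of_nat (j choose i) * (K * C ^ j)) * cmod s ^ i"
        using i by (intro mult_right_mono mult_left_mono mb) auto
      finally show "cmod (of_nat (j choose i) * of_real ?I * s ^ i) \<le> (of_nat (j choose i) * (K * C ^ j)) * cmod s ^ i" .
    qed
    also have "\<dots> = K * C ^ j * (\<Sum>i\<le>j. of_nat (j choose i) * cmod s ^ i * 1 ^ (j - i))"
      by (simp add: sum_distrib_left mult_ac)
    also have "(\<Sum>i\<le>j. of_nat (j choose i) * cmod s ^ i * 1 ^ (j - i)) = (cmod s + 1) ^ j"
      by (rule binomial_ring[symmetric])
    finally show "cmod (poly (line_moment \<xi> \<eta> j) s) \<le> K * (C * (1 + cmod s)) ^ j"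
      by (simp add: power_mult_distrib add.commute mult.assoc)
  qed
qed

text \<open>The limits needed for the interval theorem come from homogeneity:
  \<open>support_fun D (\<xi> + s \<eta>) / s\<close> is the support function at
  \<open>\<xi> / s + \<eta>\<close> for \<open>s > 0\<close>. The line avoids the origin, so the
  interval is nondegenerate for each \<open>s\<close>.\<close>

lemma support_on_line:
  assumes rat: "rational_volume N" and "0 \<in> D" and line: "\<And>s. \<xi> + s *\<^sub>R \<eta> \<noteq> 0" and "\<eta> \<noteq> 0"
  defines "hp \<equiv> \<lambda>s. support_fun D (\<xi> + s *\<^sub>R \<eta>)" and "hm \<equiv> \<lambda>s. - support_fun D (- (\<xi> + s *\<^sub>R \<eta>))"
  shows "\<exists>a b. \<forall>s. hp s + hm s = a + b * s"
    and "\<exists>a b c. \<forall>s. (hp s)\<^sup>2 + (hm s)\<^sup>2 = a + b * s + c * s\<^sup>2"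
proof -
  obtain K C where KC: "C > 0" "\<And>j s. cmod (poly (line_moment \<xi> \<eta> j) s) \<le> K * (C * (1 + cmod s)) ^ j"
    using line_moment_growth by blast
  have pos: "support_fun D \<zeta> > 0" if "\<zeta> \<noteq> 0" for \<zeta>
    using inner_less_support[OF that \<open>0 \<in> D\<close>] by simp
  have contc: "continuous_on UNIV (\<lambda>s. support_fun D (f s))" if "continuous_on UNIV f" for f :: "real \<Rightarrow> 'a"
    using continuous_on_compose2[OF continuous_support that] by simp
  have top: "((\<lambda>s. support_fun D (\<sigma> *\<^sub>R (\<xi> + s *\<^sub>R \<eta>)) / s) \<longlongrightarrow> support_fun D (\<sigma> *\<^sub>R \<eta>)) at_top" for \<sigma> :: real
  proof -
    have "((\<lambda>s. support_fun D (\<sigma> *\<^sub>R (inverse s *\<^sub>R \<xi> + \<eta>))) \<longlongrightarrow> support_fun D (\<sigma> *\<^sub>R (0 *\<^sub>R \<xi> + \<eta>))) at_top"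
      by (intro continuous_on_tendsto_compose[OF continuous_support] tendsto_intros tendsto_inverse_0_at_top filterlim_ident) auto
    moreover have "eventually (\<lambda>s. support_fun D (\<sigma> *\<^sub>R (inverse s *\<^sub>R \<xi> + \<eta>)) = support_fun D (\<sigma> *\<^sub>R (\<xi> + s *\<^sub>R \<eta>)) / s) at_top"
      using eventually_gt_at_top[of 0]
    proof eventually_elim
      case (elim s)
      have "\<sigma> *\<^sub>R (inverse s *\<^sub>R \<xi> + \<eta>) = inverse s *\<^sub>R (\<sigma> *\<^sub>R (\<xi> + s *\<^sub>R \<eta>))"
        using elim by (simp add: scaleR_add_right mult.commute)
      moreover have "support_fun D (inverse s *\<^sub>R (\<sigma> *\<^sub>R (\<xi> + s *\<^sub>R \<eta>))) = inverse s * support_fun D (\<sigma> *\<^sub>R (\<xi> + s *\<^sub>R \<eta>))"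
        using elim by (intro support_scaleR) simp
      ultimately show ?case by (simp only: divide_inverse mult.commute)
    qed
    ultimately show ?thesis by (auto elim: Lim_transform_eventually)
  qed
  \<comment> \<open>Division by a negative \<open>s\<close> reverses the direction, which exchanges
    the upper and the lower end.\<close>
  have bot: "((\<lambda>s. support_fun D (\<sigma> *\<^sub>R (\<xi> + s *\<^sub>R \<eta>)) / s) \<longlongrightarrow> - support_fun D (- \<sigma> *\<^sub>R \<eta>)) at_bot" for \<sigma> :: real
  proof -
    have "(inverse \<longlongrightarrow> (0::real)) at_bot" by (rule tendsto_mono[OF at_bot_le_at_infinity tendsto_inverse_0])
    then have "((\<lambda>s. - support_fun D (- \<sigma> *\<^sub>R (inverse s *\<^sub>R \<xi> + \<eta>))) \<longlongrightarrow> - support_fun D (- \<sigma> *\<^sub>R (0 *\<^sub>R \<xi> + \<eta>))) at_bot"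
      by (intro tendsto_minus continuous_on_tendsto_compose[OF continuous_support] tendsto_intros) auto
    moreover have "eventually (\<lambda>s. - support_fun D (- \<sigma> *\<^sub>R (inverse s *\<^sub>R \<xi> + \<eta>)) = support_fun D (\<sigma> *\<^sub>R (\<xi> + s *\<^sub>R \<eta>)) / s) at_bot"
      using eventually_gt_at_bot[of 0]
    proof eventually_elim
      case (elim s)
      have "- \<sigma> *\<^sub>R (inverse s *\<^sub>R \<xi> + \<eta>) = (- inverse s) *\<^sub>R (\<sigma> *\<^sub>R (\<xi> + s *\<^sub>R \<eta>))"
        using elim by (simp add: scaleR_add_right mult.commute)
      moreover have "support_fun D ((- inverse s) *\<^sub>R (\<sigma> *\<^sub>R (\<xi> + s *\<^sub>R \<eta>))) = - inverse s * support_fun D (\<sigma> *\<^sub>R (\<xi> + s *\<^sub>R \<eta>))"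
        using elim by (intro support_scaleR) simp
      ultimately show ?case by (simp add: divide_inverse mult.commute del: scaleR_minus_left)
    qed
    ultimately show ?thesis by (auto elim: Lim_transform_eventually)
  qed
  note * = interval_ends_of_rational_densities[where M = "line_moment \<xi> \<eta>" and hp = hp and hm = hm and N = "2 * N"
      and x = "support_fun D \<eta>" and y = "- support_fun D (- \<eta>)", OF KC]
  have c: "continuous_on UNIV hp" "continuous_on UNIV hm"
    unfolding hp_def hm_def by (intro contc continuous_intros)+
  have sg: "hm s < 0" "0 < hp s" for s
    unfolding hp_def hm_def using pos[OF line[of s]] pos[of "- (\<xi> + s *\<^sub>R \<eta>)"] line[of s] by (auto simp del: minus_add_distrib)
  have rel: "\<exists>A B. A \<noteq> 0 \<and> B \<noteq> 0 \<and> degree A \<le> 2 * N \<and> degree B \<le> 2 * N \<and>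
      (\<forall>z. \<not> (poly A z = 0 \<and> poly B z = 0)) \<and>
      (\<forall>j. (\<Sum>i\<le>2*N. coeff B i * poly (line_moment \<xi> \<eta> (j + i)) (of_real s)) =
         (\<Sum>i\<le>2*N. coeff A i * ((of_real (hp s) ^ (i + j + 1) - of_real (hm s) ^ (i + j + 1)) / of_nat (i + j + 1))))" for s
    using moment_relation[OF rat line[of s]] unfolding poly_line_moment hp_def hm_def .
  have lims: "((\<lambda>s. hp s / s) \<longlongrightarrow> support_fun D \<eta>) at_top" "((\<lambda>s. hm s / s) \<longlongrightarrow> - support_fun D (-\<eta>)) at_top"
      "((\<lambda>s. hp s / s) \<longlongrightarrow> - support_fun D (-\<eta>)) at_bot" "((\<lambda>s. hm s / s) \<longlongrightarrow> support_fun D \<eta>) at_bot"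
    using top[of 1] tendsto_minus[OF top[of "-1"]] bot[of 1] tendsto_minus[OF bot[of "-1"]]
    by (simp_all add: hp_def hm_def)
  have ne: "support_fun D \<eta> \<noteq> - support_fun D (-\<eta>)"
    using pos[of \<eta>] pos[of "-\<eta>"] \<open>\<eta> \<noteq> 0\<close> by auto
  show "\<exists>a b. \<forall>s. hp s + hm s = a + b * s" "\<exists>a b c. \<forall>s. (hp s)\<^sup>2 + (hm s)\<^sup>2 = a + b * s + c * s\<^sup>2"
    using *[OF c sg rel lims ne] by blast+
qed

end

section \<open>Quadratic forms and caps of the ball\<close>

text \<open>The expansion on lines yields the parallelogram law, so polarization gives a bilinear
  form as in the Jordan-von Neumann theorem; Gram-Schmidt then provides an orthonormal
  basis.\<close>

lemma quadratic_on_lines_diagonalization: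
  fixes q :: "'a::euclidean_space \<Rightarrow> real"
  assumes hom: "\<And>c x. q (c *\<^sub>R x) = c\<^sup>2 * q x" and pos: "\<And>x. x \<noteq> 0 \<Longrightarrow> q x > 0"
    and lines: "\<And>x y. \<exists>a b c. \<forall>s. q (x + s *\<^sub>R y) = a + b * s + c * s\<^sup>2"
  obtains T :: "'a \<Rightarrow> 'a" where "linear T" "bij T" "\<And>x. q (T x) = (norm x)\<^sup>2"
proof -
  have lines': "\<exists>b. \<forall>s. q (x + s *\<^sub>R y) = q x + b * s + q y * s\<^sup>2" for x y
  proof -
    obtain a b c where f: "\<And>s. q (x + s *\<^sub>R y) = a + b * s + c * s\<^sup>2" using lines by metis
    obtain a' b' c' where g: "\<And>s. q (y + s *\<^sub>R x) = a' + b' * s + c' * s\<^sup>2" using lines by metis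
    have "a = q x" using f[of 0] by simp
    have "a' = q y" using g[of 0] by simp
    \<comment> \<open>By homogeneity the expansions along \<open>x + s y\<close> and
      \<open>y + s x\<close> are reversals of each other, which identifies the leading coefficient
      as \<open>q y\<close>.\<close>
    have "a * s\<^sup>2 + b * s + c = a' + b' * s + c' * s\<^sup>2" if "s \<noteq> 0" for s
    proof -
      have "y + s *\<^sub>R x = s *\<^sub>R (x + inverse s *\<^sub>R y)" using that by (simp add: scaleR_add_right add.commute)
      then have "q (y + s *\<^sub>R x) = s\<^sup>2 * (a + b * inverse s + c * (inverse s)\<^sup>2)" by (simp only: hom f)
      also have "\<dots> = a * s\<^sup>2 + b * s + c" using that by (simp add: field_simps power2_eq_square)
      finally show ?thesis unfolding g by simp
    qed
    from this[of 1] this[of "-1"] this[of 2] have "c = a'" by simp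
    with \<open>a = q x\<close> \<open>a' = q y\<close> show ?thesis using f by (intro exI[of _ b]) simp
  qed
  have even: "q (- x) = q x" for x using hom[of "-1" x] by simp
  have q0: "q 0 = 0" using hom[of 0 0] by simp
  define B where "B x y = (q (x + y) - q (x - y)) / 4" for x y
  have par: "q (x + y) + q (x - y) = 2 * q x + 2 * q y" for x y
  proof -
    obtain b where "\<And>s. q (x + s *\<^sub>R y) = q x + b * s + q y * s\<^sup>2" using lines' by metis
    from this[of 1] this[of "-1"] show ?thesis by simp
  qed
  have sym: "B x y = B y x" for x y
    using even[of "x - y"] by (simp add: B_def add.commute)
  have Bscale: "B x (s *\<^sub>R y) = s * B x y" for x y s
  proof -
    obtain b where b: "\<And>s. q (x + s *\<^sub>R y) = q x + b * s + q y * s\<^sup>2" using lines' by metis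
    show ?thesis using b[of s] b[of "-s"] b[of 1] b[of "-1"] by (simp add: B_def)
  qed
  have Badd: "B x y + B z y = B (x + z) y" for x y z
  proof -
    \<comment> \<open>Two parallelogram laws, centred at \<open>u + y\<close> and
      \<open>u - y\<close>; additivity follows with \<open>u\<close> and \<open>v\<close> the half
      sum and half difference of \<open>x\<close> and \<open>z\<close>.\<close>
    have half: "B (u + v) y + B (u - v) y = 2 * B u y" for u v
    proof -
      have e: "u + v + y = u + y + v" "u - v + y = u + y - v" "u + v - y = u - y + v" "u - v - y = u - y - v"
        by simp_all
      show ?thesis unfolding B_def e using par[of "u + y" v] par[of "u - y" v] by argo
    qed
    have B0: "B 0 y = 0" by (simp add: B_def even)
    have double: "B (u + u) y = 2 * B u y" for u using half[of u u] B0 by simp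
    define u v where "u = (1/2) *\<^sub>R (x + z)" and "v = (1/2) *\<^sub>R (x - z)"
    have "u + v = (1/2) *\<^sub>R ((x + z) + (x - z))" unfolding u_def v_def by (simp only: scaleR_add_right)
    then have uv: "u + v = x" by simp
    have "u - v = (1/2) *\<^sub>R ((x + z) - (x - z))" unfolding u_def v_def by (simp only: scaleR_diff_right)
    then have vu: "u - v = z" by simp
    have uu: "u + u = x + z" unfolding u_def by (simp flip: scaleR_left_distrib)
    show ?thesis using half[of u v] double[of u] unfolding uv vu uu by simp
  qed
  have bil: "bilinear B"
    unfolding bilinear_def
  proof (intro conjI allI)
    have add: "B x (y + z) = B x y + B x z" for x y z
      unfolding sym[of x] by (rule Badd[symmetric])
    show "linear (B x)" for x by (rule linearI) (simp_all add: Bscale add)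
    show "linear (\<lambda>x. B x y)" for y
      unfolding sym[of _ y] by (rule linearI) (simp_all add: Bscale add)
  qed
  interpret l: linear "\<lambda>x. B x y" for y using bil by (simp add: bilinear_def)
  interpret r: linear "B x" for x using bil by (simp add: bilinear_def)
  have Bq: "B x x = q x" for x using hom[of 2 x] q0 by (simp add: B_def scaleR_2)
  have onb: "\<exists>S. finite S \<and> card S = k \<and> (\<forall>s\<in>S. \<forall>t\<in>S. B s t = (if s = t then 1 else 0))" if "k \<le> DIM('a)" for k
    using that
  proof (induction k)
    case 0
    show ?case by (intro exI[of _ "{}"]) auto
  next
    case (Suc k)
    then obtain S where S: "finite S" "card S = k" "\<And>s t. s \<in> S \<Longrightarrow> t \<in> S \<Longrightarrow> B s t = (if s = t then 1 else 0)"
      by auto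
    have "dim (span S) < DIM('a)" using dim_le_card'[OF S(1)] S(2) Suc.prems by simp
    then have "span S \<noteq> UNIV" using dim_UNIV by (metis less_irrefl)
    then obtain v where v: "v \<notin> span S" by blast
    \<comment> \<open>Gram-Schmidt: subtract from \<open>v\<close> its \<open>B\<close>-projection
      to the span of \<open>S\<close>.\<close>
    define w where "w = v - (\<Sum>s\<in>S. B v s *\<^sub>R s)"
    have "(\<Sum>s\<in>S. B v s *\<^sub>R s) \<in> span S" by (intro span_sum span_scale span_base)
    then have ws: "w \<notin> span S" using v span_add[of w S "\<Sum>s\<in>S. B v s *\<^sub>R s"] by (auto simp: w_def)
    then have "w \<noteq> 0" using span_zero by metis
    have wt: "B w t = 0" if "t \<in> S" for t
    proof -
      have "B w t = B v t - (\<Sum>s\<in>S. B v s * B s t)"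
        by (simp add: w_def l.diff l.sum l.scale)
      also have "(\<Sum>s\<in>S. B v s * B s t) = (\<Sum>s\<in>S. if s = t then B v s else 0)"
        using S(3) that by (intro sum.cong) auto
      finally show ?thesis using that S(1) by simp
    qed
    define u where "u = (1 / sqrt (q w)) *\<^sub>R w"
    have "B u u = 1" using pos[OF \<open>w \<noteq> 0\<close>] by (simp add: u_def Bq hom power_divide)
    moreover have ut: "B u t = 0" if "t \<in> S" for t using wt[OF that] by (simp add: u_def l.scale)
    moreover have "B t u = 0" if "t \<in> S" for t using ut[OF that] by (subst sym)
    moreover have "u \<notin> S"
    proof
      assume "u \<in> S"
      then have "sqrt (q w) *\<^sub>R u \<in> span S" by (intro span_scale span_base)
      moreover have "sqrt (q w) *\<^sub>R u = w" using pos[OF \<open>w \<noteq> 0\<close>] by (simp add: u_def)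
      ultimately show False using ws by simp
    qed
    ultimately show ?case using S
      by (intro exI[of _ "insert u S"]) auto
  qed
  obtain S where S: "finite S" "card S = DIM('a)" and S3: "\<forall>s\<in>S. \<forall>t\<in>S. B s t = (if s = t then 1 else 0)"
    using onb[OF order.refl] by blast
  obtain f where f: "bij_betw f (Basis :: 'a set) S"
    using S(1,2) finite_same_card_bij[OF finite_Basis S(1)] by auto
  \<comment> \<open>\<open>T\<close> carries the standard basis to a \<open>B\<close>-orthonormal
    one, so that \<open>q\<close> pulls back to the squared norm.\<close>
  define T where "T x = (\<Sum>b\<in>Basis. (x \<bullet> b) *\<^sub>R f b)" for x
  have linT: "linear T"
    by (rule linearI) (simp_all add: T_def inner_add_left scaleR_add_left sum.distrib scaleR_sum_right)
  have qT: "q (T x) = (norm x)\<^sup>2" for x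
  proof -
    have "q (T x) = B (T x) (T x)" by (simp add: Bq)
    also have "\<dots> = (\<Sum>b\<in>Basis. \<Sum>b'\<in>Basis. (x \<bullet> b) * ((x \<bullet> b') * B (f b) (f b')))"
      unfolding T_def l.sum by (simp add: r.sum l.scale r.scale sum_distrib_left mult.left_commute)
    also have "\<dots> = (\<Sum>b\<in>Basis. \<Sum>b'\<in>Basis. if b = b' then (x \<bullet> b) * (x \<bullet> b') else 0)"
    proof (intro sum.cong refl)
      fix b b' :: 'a assume "b \<in> Basis" "b' \<in> Basis"
      then have "B (f b) (f b') = (if b = b' then 1 else 0)"
        using S3 f unfolding bij_betw_def inj_on_def by auto
      then show "(x \<bullet> b) * ((x \<bullet> b') * B (f b) (f b')) = (if b = b' then (x \<bullet> b) * (x \<bullet> b') else 0)" by simp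
    qed
    also have "\<dots> = x \<bullet> x" by (simp add: euclidean_inner[of x x])
    finally show ?thesis by (simp add: power2_norm_eq_inner)
  qed
  have "inj T"
    using linT qT q0 unfolding linear_injective_0[OF linT] by (metis norm_eq_zero power_eq_0_iff)
  then have "bij T" using linT linear_inj_imp_surj bij_def by blast
  with linT qT show thesis by (intro that)
qed

text \<open>Tonelli's theorem: the slice at height \<open>y\<close> is a ball of radius
  \<open>sqrt (1 - y\<^sup>2)\<close> in one dimension less.\<close>

lemma emeasure_cball_cap:
  fixes e :: "'a::euclidean_space"
  assumes e: "e \<in> Basis" and t: "t \<le> 1"
  shows "emeasure lborel (cball 0 1 \<inter> {x. e \<bullet> x \<le> t}) =
    (\<integral>\<^sup>+ y. ennreal (unit_ball_vol (real (DIM('a) - 1)) * sqrt (1 - y\<^sup>2) ^ (DIM('a) - 1)) * indicator {-1..t} y \<partial>lborel)"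
proof -
  interpret product_sigma_finite "\<lambda>_. lborel"
    by standard
  define A where "A = (Basis :: 'a set) - {e}"
  have A: "finite A" "e \<notin> A" "insert e A = Basis" "card A = DIM('a) - 1"
    using e by (auto simp: A_def)
  let ?P = "Pi\<^sub>M (insert e A) (\<lambda>_. lborel :: real measure)" and ?Q = "Pi\<^sub>M A (\<lambda>_. lborel :: real measure)"
  let ?X = "{f. sqrt (\<Sum>i\<in>insert e A. (f i)\<^sup>2) \<le> 1 \<and> f e \<le> t} \<inter> space ?P"
  let ?Y = "\<lambda>y. {f. sqrt (\<Sum>i\<in>A. (f i)\<^sup>2) \<le> sqrt (1 - y\<^sup>2)} \<inter> space ?Q"
  have meas[measurable]: "?X \<in> sets ?P" by measurable
  have "(lborel :: 'a measure) = distr ?P borel (\<lambda>f. \<Sum>b\<in>Basis. f b *\<^sub>R b)"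
    unfolding A(3) by (rule lborel_eq)
  also have "emeasure \<dots> (cball 0 1 \<inter> {x. e \<bullet> x \<le> t}) =
      emeasure ?P ({y. (\<Sum>b\<in>Basis. y b *\<^sub>R b :: 'a) \<in> cball 0 1 \<inter> {x. e \<bullet> x \<le> t}} \<inter> space ?P)"
    by (subst emeasure_distr) (auto simp: A(3) vimage_def)
  also have "{y. (\<Sum>b\<in>Basis. y b *\<^sub>R b :: 'a) \<in> cball 0 1 \<inter> {x. e \<bullet> x \<le> t}} \<inter> space ?P = ?X"
  proof -
    have "dist 0 (\<Sum>b\<in>Basis. y b *\<^sub>R b :: 'a) = sqrt (\<Sum>i\<in>Basis. (y i)\<^sup>2)" for y
      by (subst euclidean_dist_l2) (auto simp: L2_set_def)
    moreover have "e \<bullet> (\<Sum>b\<in>Basis. y b *\<^sub>R b) = y e" for y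
      using e by (simp add: inner_sum_right inner_Basis if_distrib cong: if_cong)
    ultimately show ?thesis by (auto simp: A(3))
  qed
  also have "emeasure ?P ?X = (\<integral>\<^sup>+ y. \<integral>\<^sup>+ x. indicator ?X (x(e := y)) \<partial>?Q \<partial>lborel)"
    using A(1,2) by (subst nn_integral_indicator[symmetric], simp, subst product_nn_integral_insert_rev) auto
  also have "\<dots> = (\<integral>\<^sup>+ y. \<integral>\<^sup>+ x. indicator {-1..t} y * indicator (?Y y) x \<partial>?Q \<partial>lborel)"
  proof (intro nn_integral_cong, goal_cases)
    case (1 y f)
    have *: "y \<in> {-1..1}" if "y ^ 2 + c \<le> 1" "c \<ge> 0" for c
    proof -
      have "y ^ 2 \<le> 1" using that by simp
      then show ?thesis by (simp add: abs_square_le_1 abs_le_iff)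
    qed
    have "(\<Sum>x\<in>A. (if x = e then y else f x)\<^sup>2) = (\<Sum>x\<in>A. (f x)\<^sup>2)"
      using A(2) by (intro sum.cong) auto
    then have s: "(\<Sum>i\<in>insert e A. ((f(e := y)) i)\<^sup>2) = y\<^sup>2 + (\<Sum>x\<in>A. (f x)\<^sup>2)"
      using A(1,2) by (simp add: fun_upd_def)
    have nn: "(\<Sum>x\<in>A. (f x)\<^sup>2) \<ge> 0" by (intro sum_nonneg) auto
    have iff: "sqrt (\<Sum>i\<in>insert e A. ((f(e := y)) i)\<^sup>2) \<le> 1 \<and> y \<le> t \<longleftrightarrow>
        y \<in> {-1..t} \<and> sqrt (\<Sum>x\<in>A. (f x)\<^sup>2) \<le> sqrt (1 - y\<^sup>2)"
      unfolding s using *[OF _ nn] nn by auto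
    have "f(e := y) \<in> space ?P" "f \<in> space ?Q"
      using 1 A(2) by (auto simp: space_PiM PiE_def extensional_def)
    then show ?case using iff by (auto simp: indicator_def)
  qed
  also have "\<dots> = (\<integral>\<^sup>+ y. indicator {-1..t} y * emeasure ?Q (?Y y) \<partial>lborel)"
    by (intro nn_integral_cong, subst nn_integral_cmult, simp, subst nn_integral_indicator) auto
  also have "\<dots> = (\<integral>\<^sup>+ y. ennreal (unit_ball_vol (real (DIM('a) - 1)) * sqrt (1 - y\<^sup>2) ^ (DIM('a) - 1)) * indicator {-1..t} y \<partial>lborel)"
  proof (intro nn_integral_cong_AE, goal_cases)
    case 1
    \<comment> \<open>The volume formula for the slices needs a positive radius, so the heights
      \<open>-1\<close> and \<open>1\<close> are discarded as a null set.\<close>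
    have "AE y in lborel. y \<notin> {-1, 1::real}"
      by (intro AE_not_in countable_imp_null_set_lborel) auto
    then show ?case
    proof eventually_elim
      case (elim y)
      show ?case
      proof (cases "y \<in> {-1..t}")
        case True
        with elim t have "- 1 < y" "y < 1" by auto
        then have "y\<^sup>2 < 1" by (simp add: abs_square_less_1)
        then have "emeasure ?Q (?Y y) = ennreal (unit_ball_vol (real (card A)) * sqrt (1 - y\<^sup>2) ^ card A)"
          by (intro emeasure_cball_aux A(1)) simp
        then show ?thesis using True by (simp add: A(4))
      qed simp
    qed
  qed
  finally show ?thesis .
qed

lemma poly_antiderivative: "\<exists>P :: real poly. pderiv P = p"
proof (rule exI)
  show "pderiv (\<Sum>i\<le>degree p. monom (coeff p i / real (i + 1)) (i + 1)) = p"
    by (rule poly_eqI) (auto simp: coeff_pderiv coeff_sum coeff_eq_0 if_distrib cong: if_cong simp del: of_nat_Suc)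
qed

text \<open>In odd dimension the exponent \<open>DIM('a) - 1\<close> is even, so the square root
  disappears from the slice volume and the integrand is a polynomial in the height.\<close>

lemma measure_ball_cap_poly:
  fixes e :: "'a::euclidean_space"
  assumes e: "e \<in> Basis" and odd: "odd DIM('a)"
  obtains P :: "real poly" where "\<And>t. -1 < t \<Longrightarrow> t \<le> 1 \<Longrightarrow> measure lebesgue (ball 0 1 \<inter> {x. e \<bullet> x \<le> t}) = poly P t"
proof -
  obtain k where k: "DIM('a) - 1 = 2 * k" using odd by (auto elim!: oddE)
  define c where "c = unit_ball_vol (real (DIM('a) - 1))"
  have c: "c \<ge> 0" by (simp add: c_def)
  define w where "w = smult c ([:1, 0, -1:] ^ k)"
  obtain W where W: "pderiv W = w" using poly_antiderivative by blast
  have w: "poly w y = c * sqrt (1 - y\<^sup>2) ^ (DIM('a) - 1)" if "-1 \<le> y" "y \<le> 1" for y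
  proof -
    have "\<bar>y\<bar> \<le> 1" using that by linarith
    then have "y\<^sup>2 \<le> 1" by (simp add: abs_square_le_1)
    then have "sqrt (1 - y\<^sup>2) ^ (2 * k) = (1 - y\<^sup>2) ^ k" unfolding power_mult by simp
    moreover have "poly [:1, 0, -1:] y = 1 - y\<^sup>2" by (simp add: power2_eq_square)
    then have "poly w y = c * (1 - y\<^sup>2) ^ k" unfolding w_def by (simp only: poly_smult poly_power)
    ultimately show ?thesis unfolding k by simp
  qed
  have "measure lebesgue (ball 0 1 \<inter> {x. e \<bullet> x \<le> t}) = poly (W - [:poly W (-1):]) t" if t: "-1 < t" "t \<le> 1" for t
  proof -
    have nonneg: "poly w y \<ge> 0" if "-1 \<le> y" "y \<le> t" for y
    proof -
      have "\<bar>y\<bar> \<le> 1" using that t by linarith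
      then show ?thesis using w[of y] that t c by (simp add: abs_square_le_1)
    qed
    have "emeasure lborel (cball 0 1 \<inter> {x. e \<bullet> x \<le> t}) = (\<integral>\<^sup>+ y. ennreal (poly w y) * indicator {-1..t} y \<partial>lborel)"
      unfolding emeasure_cball_cap[OF e t(2)] c_def[symmetric] using w t(2) by (intro nn_integral_cong) (auto simp: indicator_def)
    also have "\<dots> = ennreal (poly W t - poly W (-1))"
      using t nonneg by (intro nn_integral_FTC_Icc) (auto simp: W[symmetric] poly_DERIV intro!: borel_measurable_continuous_onI continuous_intros)
    finally have em: "emeasure lborel (cball 0 1 \<inter> {x. e \<bullet> x \<le> t}) = ennreal (poly W t - poly W (-1))" .
    have "poly W (-1) \<le> poly W t"
      using t nonneg W by (intro DERIV_nonneg_imp_nondecreasing[of "-1" t "poly W"]) (auto intro!: exI poly_DERIV)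
    with em have "measure lborel (cball 0 1 \<inter> {x. e \<bullet> x \<le> t}) = poly W t - poly W (-1)"
      by (simp add: measure_def)
    moreover have "closed {x. e \<bullet> x \<le> t}" by (rule closed_halfspace_le)
    ultimately have "measure lebesgue (cball 0 1 \<inter> {x. e \<bullet> x \<le> t}) = poly W t - poly W (-1)"
      by (subst measure_completion) auto
    moreover have "measure lebesgue (ball 0 1 \<inter> {x. e \<bullet> x \<le> t}) = measure lebesgue (cball 0 1 \<inter> {x. e \<bullet> x \<le> t})"
    proof (rule measure_negligible_symdiff)
      show "cball 0 1 \<inter> {x. e \<bullet> x \<le> t} \<in> lmeasurable"
        using \<open>closed {x. e \<bullet> x \<le> t}\<close> by (intro lmeasurable_compact closed_Int_compact compact_Int_closed) auto
      show "negligible (sym_diff (cball 0 1 \<inter> {x. e \<bullet> x \<le> t}) (ball 0 1 \<inter> {x. e \<bullet> x \<le> t}))"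
        by (rule negligible_subset[OF negligible_sphere[of 0 1]]) (auto simp: sphere_def)
    qed
    ultimately show ?thesis by simp
  qed
  then show thesis by (rule that)
qed

section \<open>Domains with the support function of the ball\<close>

text \<open>A first-order form of the smooth boundary with the derivative as an explicit function
  \<open>\<rho>'\<close>, convenient for transport by affine maps.\<close>

definition C1_boundary :: "'a::euclidean_space set \<Rightarrow> bool" where
  "C1_boundary D \<longleftrightarrow> (\<forall>p\<in>frontier D. \<exists>U \<rho> \<rho>'. open U \<and> p \<in> U \<and>
     (\<forall>x\<in>U. (\<rho> has_derivative \<rho>' x) (at x)) \<and> (\<forall>v. continuous_on U (\<lambda>x. \<rho>' x v)) \<and>
     (\<forall>x\<in>U. \<rho>' x \<noteq> (\<lambda>v. 0)) \<and> D \<inter> U = {x\<in>U. \<rho> x < (0::real)})"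

lemma C1_boundaryD:
  assumes "C1_boundary D" "p \<in> frontier D"
  shows "\<exists>U \<rho> \<rho>'. open U \<and> p \<in> U \<and> (\<forall>x\<in>U. (\<rho> has_derivative \<rho>' x) (at x)) \<and>
    (\<forall>v. continuous_on U (\<lambda>x. \<rho>' x v)) \<and> \<rho>' p \<noteq> (\<lambda>v. 0) \<and> D \<inter> U = {x\<in>U. \<rho> x < (0::real)}"
proof -
  obtain U \<rho> \<rho>' where *: "open U \<and> p \<in> U \<and>
     (\<forall>x\<in>U. (\<rho> has_derivative \<rho>' x) (at x)) \<and> (\<forall>v. continuous_on U (\<lambda>x. \<rho>' x v)) \<and>
     (\<forall>x\<in>U. \<rho>' x \<noteq> (\<lambda>v. 0)) \<and> D \<inter> U = {x\<in>U. \<rho> x < (0::real)}"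
    using bspec[OF assms(1)[unfolded C1_boundary_def] assms(2)] by (elim exE)
  show ?thesis
    by (rule exI[of _ U], rule exI[of _ \<rho>], rule exI[of _ \<rho>']) (use * in simp)
qed

lemma norm_add_sq: "(norm (x + y))\<^sup>2 = (norm x)\<^sup>2 + 2 * (x \<bullet> y) + (norm y)\<^sup>2"
  for x y :: "'a::real_inner"
  by (simp add: power2_norm_eq_inner inner_add_left inner_add_right inner_commute)

context bdd_domain
begin

text \<open>The support function in the direction of \<open>x\<close> itself gives
  \<open>x \<bullet> x < norm x\<close>.\<close>

lemma subset_ball_of_support:
  assumes "\<And>\<xi>. support_fun D \<xi> = norm \<xi>"
  shows "D \<subseteq> ball 0 1"
proof
  fix x assume "x \<in> D"
  show "x \<in> ball 0 1"
  proof (cases "x = 0")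
    case False
    then have "x \<bullet> x < norm x" using inner_less_support[OF False \<open>x \<in> D\<close>] assms by simp
    then have "norm x * norm x < norm x * 1" by (simp add: dot_square_norm power2_eq_square)
    then have "norm x < 1" using False by (subst (asm) mult_less_cancel_left_pos) auto
    then show ?thesis by simp
  qed simp
qed

text \<open>A point of the unit ball with \<open>u \<bullet> x\<close> close to \<open>1\<close> is
  close to \<open>u\<close>, and \<open>D\<close> contains such points because its support function
  at \<open>u\<close> is \<open>1\<close>.\<close>

lemma sphere_subset_frontier:
  assumes "\<And>\<xi>. support_fun D \<xi> = norm \<xi>"
  shows "sphere 0 1 \<subseteq> frontier D"
proof
  fix u :: 'a assume "u \<in> sphere 0 1"
  then have u: "norm u = 1" by simp
  have "u \<in> closure D"
    unfolding closure_approachable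
  proof (intro allI impI)
    fix e :: real assume "e > 0"
    have "1 - e\<^sup>2 / 2 < support_fun D u" using \<open>e > 0\<close> by (simp add: assms u)
    then obtain x where x: "x \<in> D" "1 - e\<^sup>2 / 2 < u \<bullet> x" by (rule less_supportE)
    have "norm x < 1" using subset_ball_of_support[OF assms] x(1) by auto
    then have "(norm x)\<^sup>2 < 1" by (simp add: abs_square_less_1)
    moreover have "(dist x u)\<^sup>2 = (norm x)\<^sup>2 + 1 - 2 * (u \<bullet> x)"
      using norm_add_sq[of x "- u"] u by (simp add: dist_norm inner_commute)
    ultimately have "(dist x u)\<^sup>2 < e\<^sup>2" using x(2) by argo
    then have "dist x u < e" using \<open>e > 0\<close> by (simp add: power_less_imp_less_base)
    then show "\<exists>y\<in>D. dist y u < e" using x(1) by blast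
  qed
  moreover have "u \<notin> D" using subset_ball_of_support[OF assms] u by auto
  ultimately show "u \<in> frontier D" using open_D by (simp add: frontier_def interior_open)
qed

text \<open>The open set \<open>D\<close> omits its frontier, so the value is not negative; a
  positive value would persist on a neighbourhood, which meets \<open>D\<close>.\<close>

lemma frontier_defining_function_zero:
  assumes "D \<inter> U = {x\<in>U. \<rho> x < (0::real)}" "open U" "x \<in> frontier D" "x \<in> U" "isCont \<rho> x"
  shows "\<rho> x = 0"
proof (rule antisym)
  have "x \<notin> D" using assms(3) open_D by (simp add: frontier_def interior_open)
  then have "\<not> \<rho> x < 0" using assms(1,4) by blast
  then show "\<rho> x \<ge> 0" by simp
  show "\<rho> x \<le> 0"
  proof (rule ccontr)
    assume "\<not> ?thesis"
    then have "eventually (\<lambda>y. \<rho> y > 0) (at x)"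
      using assms(5) unfolding isCont_def by (intro order_tendstoD(1)[of \<rho> "\<rho> x"]) auto
    then obtain W where W: "open W" "x \<in> W" "\<And>y. y \<in> W \<Longrightarrow> y \<noteq> x \<Longrightarrow> \<rho> y > 0"
      unfolding eventually_at_topological by blast
    have "x \<in> closure D" using assms(3) by (simp add: frontier_def)
    then have "D \<inter> (W \<inter> U) \<noteq> {}"
      using W assms(2,4) open_Int_closure_eq_empty[of "W \<inter> U" D] by (auto simp: Int_commute)
    then obtain y where y: "y \<in> D \<inter> U" "y \<in> W" by blast
    have "\<rho> y < 0" using y(1) unfolding assms(1) by simp
    then show False using W(3)[of y] y(2) \<open>\<not> \<rho> x \<le> 0\<close> by (cases "y = x") auto
  qed
qed

text \<open>\<open>\<rho>\<close> vanishes on the sphere near \<open>p\<close>, so its derivative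
  kills tangent vectors and hence not the normal \<open>p\<close>. The derivative along
  \<open>p\<close> keeps its sign nearby; running from a point of the ball along \<open>p\<close> to
  the sphere shows that \<open>\<rho>\<close> has a constant sign inside, and it is negative because
  \<open>D\<close> accumulates at \<open>p\<close>.\<close>

lemma fills_ball_near_sphere:
  assumes supp: "\<And>\<xi>. support_fun D \<xi> = norm \<xi>" and "C1_boundary D" and p: "norm p = 1"
  obtains e where "e > 0" "ball p e \<inter> ball 0 1 \<subseteq> D"
proof -
  have pf: "p \<in> frontier D" using sphere_subset_frontier[OF supp] p by auto
  obtain U \<rho> \<rho>' where *: "open U \<and> p \<in> U \<and> (\<forall>x\<in>U. (\<rho> has_derivative \<rho>' x) (at x)) \<and>
    (\<forall>v. continuous_on U (\<lambda>x. \<rho>' x v)) \<and> \<rho>' p \<noteq> (\<lambda>v. 0) \<and> D \<inter> U = {x\<in>U. \<rho> x < (0::real)}"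
    using C1_boundaryD[OF \<open>C1_boundary D\<close> pf] by (elim exE)
  then have U: "open U" "p \<in> U" and der: "\<And>x. x \<in> U \<Longrightarrow> (\<rho> has_derivative \<rho>' x) (at x)"
    and cont: "\<And>v. continuous_on U (\<lambda>x. \<rho>' x v)" and nz: "\<rho>' p \<noteq> (\<lambda>v. 0)"
    and DU: "D \<inter> U = {x\<in>U. \<rho> x < 0}"
    by simp_all
  have contr: "isCont \<rho> x" if "x \<in> U" for x
    using der[OF that] has_derivative_continuous by blast
  have rho0: "\<rho> x = 0" if "x \<in> U" "norm x = 1" for x
    using frontier_defining_function_zero[OF DU U(1) _ that(1) contr[OF that(1)]] sphere_subset_frontier[OF supp] that by auto
  have pp: "p \<bullet> p = 1" using p by (simp add: norm_eq_1)
  interpret lin: linear "\<rho>' p" using der[OF U(2)] has_derivative_linear by blast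
  have tangent: "\<rho>' p w = 0" if w: "p \<bullet> w = 0" "norm w = 1" for w
  proof -
    \<comment> \<open>A great circle through \<open>p\<close> with velocity \<open>w\<close>;
      \<open>\<rho>\<close> vanishes on it near the parameter \<open>0\<close>.\<close>
    define \<gamma> where "\<gamma> \<theta> = cos \<theta> *\<^sub>R p + sin \<theta> *\<^sub>R w" for \<theta> :: real
    have n\<gamma>: "norm (\<gamma> \<theta>) = 1" for \<theta>
    proof -
      have "(norm (\<gamma> \<theta>))\<^sup>2 = (cos \<theta>)\<^sup>2 + (sin \<theta>)\<^sup>2"
        unfolding \<gamma>_def norm_add_sq using p w by (simp add: power_mult_distrib)
      then have "(norm (\<gamma> \<theta>))\<^sup>2 = 1\<^sup>2" by simp
      then show ?thesis by (rule power2_eq_imp_eq) simp_all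
    qed
    have d\<gamma>: "(\<gamma> has_derivative (\<lambda>h. h *\<^sub>R w)) (at 0)"
      unfolding \<gamma>_def by (auto intro!: derivative_eq_intros)
    have "\<gamma> 0 = p" by (simp add: \<gamma>_def)
    have "((\<rho> \<circ> \<gamma>) has_derivative (\<rho>' p \<circ> (\<lambda>h. h *\<^sub>R w))) (at 0)"
      using d\<gamma> der[OF U(2)] \<open>\<gamma> 0 = p\<close> by (intro diff_chain_at) auto
    moreover have "((\<rho> \<circ> \<gamma>) has_derivative (\<lambda>h. 0)) (at 0)"
    proof (rule has_derivative_transform_within_open)
      show "((\<lambda>_. 0) has_derivative (\<lambda>h. 0)) (at (0::real))" by simp
      show "open (\<gamma> -` U)" unfolding \<gamma>_def using U(1)
        by (intro open_vimage continuous_intros)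
      show "0 \<in> \<gamma> -` U" using \<open>\<gamma> 0 = p\<close> U(2) by simp
      show "0 = (\<rho> \<circ> \<gamma>) \<theta>" if "\<theta> \<in> \<gamma> -` U" for \<theta>
        using rho0[of "\<gamma> \<theta>"] that n\<gamma> by simp
    qed
    ultimately have "(\<rho>' p \<circ> (\<lambda>h. h *\<^sub>R w)) = (\<lambda>h. 0)" by (rule has_derivative_unique)
    from fun_cong[OF this, of 1] show ?thesis by simp
  qed
  have "\<rho>' p p \<noteq> 0"
  proof
    assume 0: "\<rho>' p p = 0"
    have "\<rho>' p v = 0" for v
    proof -
      define w where "w = v - (p \<bullet> v) *\<^sub>R p"
      have pw: "p \<bullet> w = 0" by (simp add: w_def inner_diff_right pp)
      have "\<rho>' p w = 0"
      proof (cases "w = 0")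
        case False
        have "\<rho>' p w = norm w * \<rho>' p (w /\<^sub>R norm w)" using False by (simp add: lin.scale)
        also have "\<rho>' p (w /\<^sub>R norm w) = 0" using pw False by (intro tangent) auto
        finally show ?thesis by simp
      qed (simp add: lin.zero)
      moreover have "v = w + (p \<bullet> v) *\<^sub>R p" by (simp add: w_def)
      ultimately show ?thesis using 0 by (metis lin.add lin.scale mult_zero_right add_0 real_scaleR_def)
    qed
    then show False using nz by auto
  qed
  define \<sigma> where "\<sigma> = sgn (\<rho>' p p)"
  have \<sigma>: "\<sigma> = 1 \<or> \<sigma> = -1" "\<sigma> * \<rho>' p p > 0" using \<open>\<rho>' p p \<noteq> 0\<close> by (auto simp: \<sigma>_def sgn_if)
  have "open {x \<in> U. \<sigma> * \<rho>' x p \<in> {0<..}}"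
    using U(1) by (intro continuous_open_preimage[unfolded vimage_def Int_def, simplified] continuous_intros cont)
     auto
  then obtain e where e: "e > 0" "ball p e \<subseteq> {x \<in> U. \<sigma> * \<rho>' x p \<in> {0<..}}"
    using U(2) \<sigma>(2) unfolding open_contains_ball by auto
  \<comment> \<open>A point within \<open>d\<close> of \<open>p\<close> travels at most
    \<open>2 * d\<close> before it reaches the sphere, so \<open>3 * d \<le> e\<close> keeps the
    path in \<open>ball p e\<close>. The bound \<open>d \<le> 1 / 2\<close> gives
    \<open>p \<bullet> x \<ge> 1 / 2\<close>, which makes the length \<open>2 * d\<close>
    sufficient.\<close>
  define d where "d = min (e / 3) (1 / 2)"
  have d: "d > 0" "3 * d \<le> e" "d \<le> 1 / 2" using e(1) by (auto simp: d_def min_def)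
  have sign: "\<sigma> * \<rho> x < 0" if x: "x \<in> ball p d" "norm x < 1" for x
  proof -
    have xp: "norm (x - p) < d" using x(1) by (simp add: dist_norm norm_minus_commute)
    have "p \<bullet> x = 1 - p \<bullet> (p - x)" by (simp add: inner_diff_right pp)
    moreover have "p \<bullet> (p - x) \<le> norm (x - p)" using norm_cauchy_schwarz[of p "p - x"] p by (simp add: norm_minus_commute)
    ultimately have px: "p \<bullet> x \<ge> 1 / 2" using xp d(3) by linarith
    have nx: "1 - norm x < d" using xp norm_triangle_ineq2[of p x] p by (simp add: norm_minus_commute)
    define f where "f \<tau> = (norm (x + \<tau> *\<^sub>R p))\<^sup>2" for \<tau> :: real
    have f: "f \<tau> = (norm x)\<^sup>2 + 2 * \<tau> * (p \<bullet> x) + \<tau>\<^sup>2" for \<tau>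
      unfolding f_def norm_add_sq using p by (simp add: inner_commute)
    have f0: "f 0 < 1" using x(2) by (simp add: f abs_square_less_1)
    have "1 - (norm x)\<^sup>2 = (1 - norm x) * (1 + norm x)" by (simp add: power2_eq_square algebra_simps)
    also have "\<dots> \<le> d * 2" using nx x(2) d(1) by (intro mult_mono) auto
    finally have "1 \<le> (norm x)\<^sup>2 + 2 * d" by simp
    also have "2 * d \<le> 2 * (2 * d) * (p \<bullet> x)" using px d(1) by simp
    finally have "1 \<le> f (2 * d)" unfolding f by (simp add: add_increasing2)
    moreover have "continuous_on {0..2 * d} f" unfolding f_def by (intro continuous_intros)
    ultimately obtain \<tau> where \<tau>: "0 \<le> \<tau>" "\<tau> \<le> 2 * d" "f \<tau> = 1"
      using IVT'[of f 0 1 "2 * d"] f0 d(1) by auto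
    have "\<tau> \<noteq> 0" using \<tau>(3) f0 by auto
    with \<tau> have "0 < \<tau>" by simp
    have seg: "x + s *\<^sub>R p \<in> ball p e" if "0 \<le> s" "s \<le> \<tau>" for s
    proof -
      have "norm (x + s *\<^sub>R p - p) \<le> norm (x - p) + norm (s *\<^sub>R p)"
        using norm_triangle_ineq[of "x - p" "s *\<^sub>R p"] by (simp add: algebra_simps)
      also have "\<dots> < d + 2 * d" using xp that \<tau>(2) p by simp
      finally show ?thesis using d(2) by (simp add: dist_norm norm_minus_commute)
    qed
    have "\<exists>z>0. z < \<tau> \<and> \<rho> (x + \<tau> *\<^sub>R p) - \<rho> (x + 0 *\<^sub>R p) = (\<tau> - 0) * \<rho>' (x + z *\<^sub>R p) p"
    proof (rule MVT2[OF \<open>0 < \<tau>\<close>])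
      fix s assume s: "0 \<le> s" "s \<le> \<tau>"
      have inU: "x + s *\<^sub>R p \<in> U" using seg[OF s] e(2) by auto
      have "((\<lambda>s. x + s *\<^sub>R p) has_derivative (\<lambda>h. h *\<^sub>R p)) (at s)"
        by (auto intro!: derivative_eq_intros)
      from diff_chain_at[OF this der[OF inU]]
      have "((\<lambda>s. \<rho> (x + s *\<^sub>R p)) has_derivative (\<lambda>h. \<rho>' (x + s *\<^sub>R p) (h *\<^sub>R p))) (at s)"
        by (simp add: o_def)
      moreover have "\<rho>' (x + s *\<^sub>R p) (h *\<^sub>R p) = \<rho>' (x + s *\<^sub>R p) p * h" for h
        using linear_cmul[OF has_derivative_linear[OF der[OF inU]]] by simp
      ultimately show "((\<lambda>s. \<rho> (x + s *\<^sub>R p)) has_real_derivative \<rho>' (x + s *\<^sub>R p) p) (at s)"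
        by (simp add: has_field_derivative_def)
    qed
    then obtain z where z: "0 < z" "z < \<tau>" "\<rho> (x + \<tau> *\<^sub>R p) - \<rho> x = \<tau> * \<rho>' (x + z *\<^sub>R p) p" by auto
    have "norm (x + \<tau> *\<^sub>R p) = 1" using \<tau>(3) unfolding f_def
      by (metis norm_ge_zero one_power2 power2_eq_imp_eq zero_le_one)
    then have "\<rho> (x + \<tau> *\<^sub>R p) = 0" using seg[of \<tau>] e(2) \<tau>(1) by (intro rho0) auto
    then have "\<rho> x = - (\<tau> * \<rho>' (x + z *\<^sub>R p) p)" using z(3) by simp
    then have "\<sigma> * \<rho> x = - (\<tau> * (\<sigma> * \<rho>' (x + z *\<^sub>R p) p))" by simp
    moreover have "\<sigma> * \<rho>' (x + z *\<^sub>R p) p > 0" using seg[of z] z e(2) by auto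
    ultimately show ?thesis using \<open>0 < \<tau>\<close> by simp
  qed
  \<comment> \<open>A point of \<open>D\<close> near \<open>p\<close> rules out
    \<open>\<sigma> = -1\<close>.\<close>
  have "p \<in> closure D" using pf by (simp add: frontier_def)
  then obtain x where x: "x \<in> D" "dist x p < d" using d(1) unfolding closure_approachable by blast
  have inU: "y \<in> U" if "y \<in> ball p d" for y
  proof -
    have "ball p d \<subseteq> ball p e" using d by (intro subset_ball) linarith
    then show ?thesis using that e(2) by blast
  qed
  have "x \<in> D \<inter> U" using x inU[of x] by (simp add: dist_commute)
  then have "\<rho> x < 0" unfolding DU by simp
  moreover have "norm x < 1" using subset_ball_of_support[OF supp] x(1) by auto
  then have "\<sigma> * \<rho> x < 0" using x by (intro sign) (auto simp: dist_commute)
  ultimately have "\<sigma> = 1" using \<sigma>(1) by auto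
  have "ball p d \<inter> ball 0 1 \<subseteq> D"
  proof
    fix y assume y: "y \<in> ball p d \<inter> ball 0 1"
    then have "\<rho> y < 0" using sign[of y] \<open>\<sigma> = 1\<close> by simp
    then have "y \<in> D \<inter> U" unfolding DU using y inU[of y] by simp
    then show "y \<in> D" by simp
  qed
  with d(1) show thesis by (rule that)
qed

text \<open>\<open>E - closure D\<close> is open and null, hence empty, so a point of
  \<open>E\<close> outside \<open>D\<close> is a boundary point. Near it \<open>\<rho>\<close> is at
  most \<open>0\<close>, its value there; this local maximum contradicts the nonzero derivative.
  Slits are thus excluded.\<close>

lemma no_hole_of_measure_zero:
  assumes "C1_boundary D" "open E" "D \<subseteq> E" "negligible (E - D)"
  shows "D = E"
proof (rule ccontr)
  assume "D \<noteq> E"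
  then obtain p where p: "p \<in> E" "p \<notin> D" using assms(3) by blast
  have "open (E - closure D)" using assms(2) by (simp add: open_Diff)
  moreover have "negligible (E - closure D)"
    by (rule negligible_subset[OF assms(4)]) (use closure_subset in blast)
  ultimately have sub: "E \<subseteq> closure D" using open_not_negligible by blast
  then have pf: "p \<in> frontier D" using p open_D by (auto simp: frontier_def interior_open)
  obtain U \<rho> \<rho>' where *: "open U \<and> p \<in> U \<and> (\<forall>x\<in>U. (\<rho> has_derivative \<rho>' x) (at x)) \<and>
    (\<forall>v. continuous_on U (\<lambda>x. \<rho>' x v)) \<and> \<rho>' p \<noteq> (\<lambda>v. 0) \<and> D \<inter> U = {x\<in>U. \<rho> x < (0::real)}"
    using C1_boundaryD[OF assms(1) pf] by (elim exE)
  then have U: "open U" "p \<in> U" and der: "\<And>x. x \<in> U \<Longrightarrow> (\<rho> has_derivative \<rho>' x) (at x)"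
    and cont: "\<And>v. continuous_on U (\<lambda>x. \<rho>' x v)" and nz: "\<rho>' p \<noteq> (\<lambda>v. 0)"
    and DU: "D \<inter> U = {x\<in>U. \<rho> x < 0}"
    by simp_all
  have "eventually (\<lambda>x. x \<in> E \<inter> U) (nhds p)"
    using assms(2) U p by (intro eventually_nhds_in_open) auto
  then have "eventually (\<lambda>x. \<rho> x \<le> \<rho> p) (nhds p)"
  proof eventually_elim
    case (elim x)
    have "isCont \<rho> x" "isCont \<rho> p" using der U(2) elim has_derivative_continuous by blast+
    have "\<rho> p = 0" using frontier_defining_function_zero[OF DU U(1) pf U(2) \<open>isCont \<rho> p\<close>] .
    moreover have "\<rho> x \<le> 0"
    proof (cases "x \<in> D")
      case True
      then have "x \<in> D \<inter> U" using elim by simp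
      then show ?thesis unfolding DU by simp
    next
      case False
      then have "x \<in> frontier D" using sub elim open_D by (auto simp: frontier_def interior_open)
      then show ?thesis using frontier_defining_function_zero[OF DU U(1) _ _ \<open>isCont \<rho> x\<close>] elim by simp
    qed
    ultimately show ?case by simp
  qed
  then obtain e where "e > 0" "\<And>y. y \<in> ball p e \<Longrightarrow> \<rho> y \<le> \<rho> p"
    unfolding eventually_nhds_metric by (auto simp: dist_commute)
  then have "\<rho>' p = (\<lambda>v. 0)"
    using differential_zero_maxmin[of p "ball p e" \<rho> "\<rho>' p"] der[OF U(2)] by auto
  with nz show False by simp
qed

text \<open>Near \<open>- e\<close> the domain fills the ball, so low caps coincide and
  \<open>a = P * b\<close> holds on an interval, hence identically. Then all caps have equal volume
  and \<open>ball 0 1 - D\<close> is null.\<close>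

theorem ball_of_support:
  fixes a b :: "real poly"
  assumes supp: "\<And>\<xi>. support_fun D \<xi> = norm \<xi>" and C1: "C1_boundary D" and odd: "odd DIM('a)"
    and e: "e \<in> Basis" and b: "\<And>t. poly b t \<noteq> 0"
    and vol: "\<And>t. \<exists>x\<in>D. e \<bullet> x = t \<Longrightarrow> measure lebesgue (D \<inter> {x. e \<bullet> x \<le> t}) = poly a t / poly b t"
  shows "D = ball 0 1"
proof (rule no_hole_of_measure_zero[OF C1])
  have ne: "norm e = 1" using e by simp
  show sub: "D \<subseteq> ball 0 1" by (rule subset_ball_of_support[OF supp])
  obtain P :: "real poly" where P: "\<And>t. -1 < t \<Longrightarrow> t \<le> 1 \<Longrightarrow> measure lebesgue (ball 0 1 \<inter> {x. e \<bullet> x \<le> t}) = poly P t"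
    using measure_ball_cap_poly[OF e odd] by blast
  have V: "measure lebesgue (D \<inter> {x. e \<bullet> x \<le> t}) = poly a t / poly b t" if "-1 < t" "t < 1" for t
    using that by (intro vol hyperplane_meets) (simp_all add: supp ne)
  obtain r where r: "r > 0" "ball (- e) r \<inter> ball 0 1 \<subseteq> D"
    using fills_ball_near_sphere[OF supp C1, of "- e"] ne by auto
  \<comment> \<open>A point of the unit ball with \<open>e \<bullet> x \<le> t\<close> has squared
    distance less than \<open>2 + 2 * t\<close> from \<open>- e\<close>, which is below
    \<open>r\<^sup>2\<close> for \<open>t < -1 + \<delta>\<close>.\<close>
  define \<delta> where "\<delta> = min (r\<^sup>2 / 2) 1"
  have \<delta>: "\<delta> > 0" "\<delta> \<le> 1" "2 * \<delta> \<le> r\<^sup>2" using r(1) by (auto simp: \<delta>_def min_def)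
  have cap: "D \<inter> {x. e \<bullet> x \<le> t} = ball 0 1 \<inter> {x. e \<bullet> x \<le> t}" if t: "t < -1 + \<delta>" for t
  proof -
    have "x \<in> D" if x: "x \<in> ball 0 1" "e \<bullet> x \<le> t" for x
    proof -
      have "(dist (- e) x)\<^sup>2 = (norm x)\<^sup>2 + 1 + 2 * (e \<bullet> x)"
        using norm_add_sq[of x e] ne by (simp add: dist_norm inner_commute add.commute norm_minus_commute)
      moreover have "(norm x)\<^sup>2 < 1" using x(1) by (simp add: abs_square_less_1)
      ultimately have "(dist (- e) x)\<^sup>2 < r\<^sup>2" using x(2) t \<delta>(3) by linarith
      then have "dist (- e) x < r" using r(1) by (simp add: power_less_imp_less_base)
      then show ?thesis using r(2) x(1) by auto
    qed
    then show ?thesis using sub by auto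
  qed
  have "poly (a - P * b) t = 0" if "t \<in> {-1<..<-1+\<delta>}" for t
    using V[of t] P[of t] cap[of t] that \<delta> b[of t] by (simp add: field_simps)
  then have "{-1<..<-1+\<delta>} \<subseteq> {t. poly (a - P * b) t = 0}" by blast
  moreover have "infinite {-1<..<-1+\<delta>}" using \<delta>(1) by simp
  ultimately have "infinite {t. poly (a - P * b) t = 0}" using infinite_super by blast
  then have "a - P * b = 0" using poly_roots_finite by blast
  then have ab: "poly a t / poly b t = poly P t" for t using b[of t] by (simp add: field_simps)
  have Dm: "D \<inter> {x. e \<bullet> x \<le> t} \<in> lmeasurable" "ball 0 1 \<inter> {x. e \<bullet> x \<le> t} \<in> lmeasurable" for t
  proof -
    have "{x. e \<bullet> x \<le> t} \<in> sets lebesgue"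
      using closed_halfspace_le[of e t] by (simp add: borel_closed sets_completionI_sets)
    then show "D \<inter> {x. e \<bullet> x \<le> t} \<in> lmeasurable" "ball 0 1 \<inter> {x. e \<bullet> x \<le> t} \<in> lmeasurable"
      using bounded_D open_D by (intro fmeasurable_Int_fmeasurable lmeasurable_open; simp)+
  qed
  have slab: "negligible ((ball 0 1 - D) \<inter> {x. e \<bullet> x \<le> t})" if "-1 < t" "t < 1" for t
  proof -
    have "(ball 0 1 - D) \<inter> {x. e \<bullet> x \<le> t} = ball 0 1 \<inter> {x. e \<bullet> x \<le> t} - D \<inter> {x. e \<bullet> x \<le> t}" by auto
    moreover have "measure lebesgue (ball 0 1 \<inter> {x. e \<bullet> x \<le> t} - D \<inter> {x. e \<bullet> x \<le> t}) = 0"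
      using sub V[OF that] P[of t] ab that
      by (subst measurable_measure_Diff[OF Dm(2) fmeasurableD[OF Dm(1)]]) auto
    ultimately show ?thesis
      using fmeasurable.Diff[OF Dm(2) Dm(1)] by (simp add: negligible_iff_measure)
  qed
  \<comment> \<open>The volume formula is available for \<open>t < 1\<close>, so the ball is
    exhausted by countably many slabs.\<close>
  have "ball 0 1 - D \<subseteq> (\<Union>k. (ball 0 1 - D) \<inter> {x. e \<bullet> x \<le> 1 - 1 / real (k + 2)})"
  proof
    fix x assume x: "x \<in> ball 0 1 - D"
    have "e \<bullet> x < 1" using x norm_cauchy_schwarz[of e x] ne by simp
    then obtain k where "1 / real (Suc k) < 1 - e \<bullet> x" using nat_approx_posE[of "1 - e \<bullet> x"] by auto
    moreover have "1 / real (k + 2) \<le> 1 / real (Suc k)" by (simp add: frac_le)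
    ultimately have "e \<bullet> x \<le> 1 - 1 / real (k + 2)" by linarith
    then show "x \<in> (\<Union>k. (ball 0 1 - D) \<inter> {x. e \<bullet> x \<le> 1 - 1 / real (k + 2)})" using x by blast
  qed
  moreover have "negligible (\<Union>k. (ball 0 1 - D) \<inter> {x. e \<bullet> x \<le> 1 - 1 / real (k + 2)})"
  proof (rule negligible_countable_Union)
    fix S assume "S \<in> range (\<lambda>k. (ball 0 1 - D) \<inter> {x. e \<bullet> x \<le> 1 - 1 / real (k + 2)})"
    then obtain k where S: "S = (ball 0 1 - D) \<inter> {x. e \<bullet> x \<le> 1 - 1 / real (k + 2)}" by blast
    have "-1 < 1 - 1 / real (k + 2)" "1 - 1 / real (k + 2) < 1" by (simp_all add: field_simps)
    then show "negligible S" unfolding S by (rule slab)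
  qed simp
  ultimately show "negligible (ball 0 1 - D)" by (rule negligible_subset[rotated])
qed simp

end

section \<open>Reduction to the ball\<close>

context bdd_domain
begin

lemma support_difference_scaleR:
  "support_fun D (c *\<^sub>R \<xi>) - support_fun D (- (c *\<^sub>R \<xi>)) = c * (support_fun D \<xi> - support_fun D (- \<xi>))"
proof (cases "c \<ge> 0")
  case True
  then show ?thesis using support_scaleR[of c \<xi>] support_scaleR[of c "- \<xi>"] by (simp add: algebra_simps)
next
  case False
  then show ?thesis using support_scaleR[of "- c" \<xi>] support_scaleR[of "- c" "- \<xi>"] by (simp add: algebra_simps)
qed

lemma support_sum_scaleR:
  "support_fun D (c *\<^sub>R \<xi>) + support_fun D (- (c *\<^sub>R \<xi>)) = \<bar>c\<bar> * (support_fun D \<xi> + support_fun D (- \<xi>))"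
proof (cases "c \<ge> 0")
  case True
  then show ?thesis using support_scaleR[of c \<xi>] support_scaleR[of c "- \<xi>"] by (simp add: algebra_simps)
next
  case False
  then show ?thesis using support_scaleR[of "- c" \<xi>] support_scaleR[of "- c" "- \<xi>"] by (simp add: algebra_simps)
qed

text \<open>The function is homogeneous and affine on lines that avoid the origin. For independent
  vectors additivity follows by comparing the lines through \<open>\<xi>\<close> along
  \<open>\<eta>\<close> and through \<open>\<eta>\<close> along \<open>\<xi>\<close>; for dependent
  ones homogeneity is enough.\<close>

lemma linear_support_difference:
  assumes rat: "rational_volume N" and "0 \<in> D"
  shows "linear (\<lambda>\<xi>. support_fun D \<xi> - support_fun D (- \<xi>))"
proof -
  define \<sigma> where "\<sigma> \<xi> = support_fun D \<xi> - support_fun D (- \<xi>)" for \<xi>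
  have hom: "\<sigma> (c *\<^sub>R \<xi>) = c * \<sigma> \<xi>" for c \<xi>
    unfolding \<sigma>_def by (rule support_difference_scaleR)
  have line: "\<exists>a b. \<forall>s. \<sigma> (\<xi> + s *\<^sub>R \<eta>) = a + b * s" if "\<eta> \<noteq> 0" "\<And>s. \<xi> + s *\<^sub>R \<eta> \<noteq> 0" for \<xi> \<eta>
    using support_on_line(1)[OF rat \<open>0 \<in> D\<close> that(2,1)] by (simp add: \<sigma>_def)
  have "\<sigma> (\<xi> + \<eta>) = \<sigma> \<xi> + \<sigma> \<eta>" for \<xi> \<eta>
  proof (cases "\<xi> = 0 \<or> (\<exists>s. \<xi> + s *\<^sub>R \<eta> = 0)")
    case True
    then consider "\<xi> = 0" | s where "\<xi> = (- s) *\<^sub>R \<eta>" by (auto simp: add_eq_0_iff2)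
    then show ?thesis
    proof cases
      case 2
      then have "\<xi> + \<eta> = (1 - s) *\<^sub>R \<eta>" by (simp add: algebra_simps)
      then show ?thesis unfolding 2 using hom[of "1 - s" \<eta>] hom[of "- s" \<eta>] by (simp add: algebra_simps)
    qed (use hom[of 0 0] in simp)
  next
    case False
    then have ind: "\<eta> \<noteq> 0 \<Longrightarrow> \<eta> + s *\<^sub>R \<xi> \<noteq> 0" for s
      by (metis add.commute add_cancel_left_left inverse_zero scaleR_add_right scaleR_left_commute
          scaleR_scaleR scaleR_zero_left scaleR_zero_right right_inverse scaleR_one)
    show ?thesis
    proof (cases "\<eta> = 0")
      case nz: False
      obtain a b where ab: "\<And>s. \<sigma> (\<xi> + s *\<^sub>R \<eta>) = a + b * s"
        using line[of \<eta> \<xi>] nz False by blast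
      obtain a' b' where ab': "\<And>s. \<sigma> (\<eta> + s *\<^sub>R \<xi>) = a' + b' * s"
        using line[of \<xi> \<eta>] ind[OF nz] False by blast
      \<comment> \<open>The points \<open>\<eta> + 2 \<xi>\<close> and
        \<open>\<xi> + \<eta> / 2\<close>, one on each line, are proportional; with the common point
        \<open>\<xi> + \<eta>\<close> this gives \<open>b' = a\<close>.\<close>
      have "2 * a + b = a' + 2 * b'"
      proof -
        have "\<eta> + 2 *\<^sub>R \<xi> = 2 *\<^sub>R (\<xi> + (1/2) *\<^sub>R \<eta>)" by (simp add: scaleR_add_right add.commute)
        then have "\<sigma> (\<eta> + 2 *\<^sub>R \<xi>) = 2 * \<sigma> (\<xi> + (1/2) *\<^sub>R \<eta>)" by (simp only: hom)
        then show ?thesis unfolding ab ab' by simp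
      qed
      moreover have "a + b = a' + b'" using ab[of 1] ab'[of 1] by (simp add: add.commute)
      moreover have "a = \<sigma> \<xi>" "a' = \<sigma> \<eta>" using ab[of 0] ab'[of 0] by simp_all
      ultimately show ?thesis using ab[of 1] by simp
    qed (use hom[of 0 0] in simp)
  qed
  then show ?thesis using hom unfolding \<sigma>_def[symmetric] by (intro linearI) auto
qed

text \<open>The squared half-width equals half of \<open>hp\<^sup>2 + hm\<^sup>2\<close> minus a
  quarter of \<open>(hp + hm)\<^sup>2\<close>, both quadratic along a line. Lines through the origin
  are settled by homogeneity.\<close>

lemma width_on_lines:
  assumes rat: "rational_volume N" and "0 \<in> D"
  defines "q \<equiv> \<lambda>\<xi>. ((support_fun D \<xi> + support_fun D (- \<xi>)) / 2)\<^sup>2"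
  shows "\<exists>a b c. \<forall>s. q (\<xi> + s *\<^sub>R \<eta>) = a + b * s + c * s\<^sup>2"
proof -
  have hom: "q (c *\<^sub>R \<zeta>) = c\<^sup>2 * q \<zeta>" for c \<zeta>
    unfolding q_def support_sum_scaleR by (simp add: power_mult_distrib power_divide)
  consider "\<eta> = 0" | t where "\<xi> = t *\<^sub>R \<eta>" | "\<eta> \<noteq> 0" "\<And>s. \<xi> + s *\<^sub>R \<eta> \<noteq> 0"
    by (metis eq_neg_iff_add_eq_0 scaleR_minus_left)
  then show ?thesis
  proof cases
    case 1
    then show ?thesis by (intro exI[of _ "q \<xi>"] exI[of _ 0]) simp
  next
    case 2
    have "q (\<xi> + s *\<^sub>R \<eta>) = t\<^sup>2 * q \<eta> + (2 * t * q \<eta>) * s + q \<eta> * s\<^sup>2" for s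
    proof -
      have "\<xi> + s *\<^sub>R \<eta> = (t + s) *\<^sub>R \<eta>" by (simp add: 2 scaleR_add_left)
      then have "q (\<xi> + s *\<^sub>R \<eta>) = (t + s)\<^sup>2 * q \<eta>" by (simp only: hom)
      then show ?thesis by (simp add: power2_eq_square algebra_simps)
    qed
    then show ?thesis by blast
  next
    case 3
    obtain a b where 1: "\<And>s. support_fun D (\<xi> + s *\<^sub>R \<eta>) + - support_fun D (- (\<xi> + s *\<^sub>R \<eta>)) = a + b * s"
      using support_on_line(1)[OF rat \<open>0 \<in> D\<close> 3(2,1)] by blast
    obtain a' b' c' where 2: "\<And>s. (support_fun D (\<xi> + s *\<^sub>R \<eta>))\<^sup>2 + (- support_fun D (- (\<xi> + s *\<^sub>R \<eta>)))\<^sup>2 = a' + b' * s + c' * s\<^sup>2"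
      using support_on_line(2)[OF rat \<open>0 \<in> D\<close> 3(2,1)] by blast
    have id: "((x + y) / 2)\<^sup>2 = (2 * (x\<^sup>2 + (- y)\<^sup>2) - (x + - y)\<^sup>2) / 4" for x y :: real
      by (simp add: power2_eq_square field_simps)
    have "q (\<xi> + s *\<^sub>R \<eta>) = (2 * a' - a\<^sup>2) / 4 + ((2 * b' - 2 * a * b) / 4) * s + ((2 * c' - b\<^sup>2) / 4) * s\<^sup>2" for s
      unfolding q_def id 1 2 by (simp add: power2_eq_square field_simps)
    then show ?thesis by blast
  qed
qed

text \<open>The support function is the sum of its odd part, a linear form
  \<open>c \<bullet> \<xi>\<close>, and its even part, the root of the positive quadratic form
  \<open>q\<close>, which \<open>T\<close> turns into the norm.\<close>

lemma support_normal_form: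
  assumes rat: "rational_volume N" and "0 \<in> D"
  obtains T :: "'a \<Rightarrow> 'a" and c where "linear T" "bij T" "\<And>\<eta>. support_fun D (T \<eta>) = c \<bullet> T \<eta> + norm \<eta>"
proof -
  define q where "q \<xi> = ((support_fun D \<xi> + support_fun D (- \<xi>)) / 2)\<^sup>2" for \<xi>
  have nonneg: "support_fun D \<xi> \<ge> 0" for \<xi>
    using inner_le_support[OF \<open>0 \<in> D\<close>, of \<xi>] by simp
  have hom: "q (c *\<^sub>R \<zeta>) = c\<^sup>2 * q \<zeta>" for c \<zeta>
    unfolding q_def support_sum_scaleR by (simp add: power_mult_distrib power_divide)
  have pos: "q \<xi> > 0" if "\<xi> \<noteq> 0" for \<xi>
    using inner_less_support[OF that \<open>0 \<in> D\<close>] nonneg[of "- \<xi>"] by (simp add: q_def add_pos_nonneg)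
  have lines: "\<exists>a b c. \<forall>s. q (x + s *\<^sub>R y) = a + b * s + c * s\<^sup>2" for x y
    using width_on_lines[OF assms, of x y] by (simp only: q_def)
  obtain T :: "'a \<Rightarrow> 'a" where T: "linear T" "bij T" "\<And>x. q (T x) = (norm x)\<^sup>2"
  proof (rule quadratic_on_lines_diagonalization[of q, OF hom pos lines])
    fix T :: "'a \<Rightarrow> 'a" assume T: "linear T" "bij T" "\<And>x. q (T x) = (norm x)\<^sup>2"
    then show ?thesis by (intro that)
  qed
  interpret lin: linear "\<lambda>\<xi>. support_fun D \<xi> - support_fun D (- \<xi>)"
    by (rule linear_support_difference[OF assms])
  define c where "c = (\<Sum>b\<in>Basis. ((support_fun D b - support_fun D (- b)) / 2) *\<^sub>R b)"
  have c: "c \<bullet> \<xi> = (support_fun D \<xi> - support_fun D (- \<xi>)) / 2" for \<xi>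
  proof -
    have "support_fun D \<xi> - support_fun D (- \<xi>) = (\<Sum>b\<in>Basis. (\<xi> \<bullet> b) * (support_fun D b - support_fun D (- b)))"
      using lin.sum[of "\<lambda>b. (\<xi> \<bullet> b) *\<^sub>R b" Basis] by (simp add: euclidean_representation lin.scale)
    then show ?thesis
      unfolding c_def inner_sum_left by (simp add: sum_divide_distrib inner_commute[of \<xi>] mult.commute)
  qed
  have "support_fun D (T \<eta>) = c \<bullet> T \<eta> + norm \<eta>" for \<eta>
  proof -
    have "(support_fun D (T \<eta>) + support_fun D (- T \<eta>)) / 2 = norm \<eta>"
    proof (rule power2_eq_imp_eq)
      show "((support_fun D (T \<eta>) + support_fun D (- T \<eta>)) / 2)\<^sup>2 = (norm \<eta>)\<^sup>2"
        using T(3)[of \<eta>] by (simp only: q_def)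
    qed (use nonneg[of "T \<eta>"] nonneg[of "- T \<eta>"] in simp_all)
    then show ?thesis unfolding c by argo
  qed
  with T(1,2) show thesis by (rule that)
qed

section \<open>Affine images: domains, boundaries and volumes\<close>

lemma affine_image:
  assumes "linear A" "surj A"
  shows "bdd_domain ((\<lambda>x. A (x - v)) ` D)"
proof -
  have eq: "(\<lambda>x. A (x - v)) ` D = A ` ((\<lambda>x. x - v) ` D)" by (simp add: image_comp o_def)
  show ?thesis unfolding eq
  proof
    show "open (A ` (\<lambda>x. x - v) ` D)"
      by (rule open_surjective_linear_image[OF open_translation_subtract[OF open_D] assms])
    show "connected (A ` (\<lambda>x. x - v) ` D)"
      by (intro connected_linear_image[OF assms(1)] connected_continuous_image continuous_intros connected_D)
    show "A ` (\<lambda>x. x - v) ` D \<noteq> {}" using nonempty_D by simp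
    show "bounded (A ` (\<lambda>x. x - v) ` D)"
      using assms bounded_D by (intro bounded_linear_image bounded_translation_minus) (auto simp: linear_conv_bounded_linear)
  qed
qed

end

text \<open>Local defining functions are composed with the inverse affine map
  \<open>G\<close>.\<close>

lemma C1_boundary_affine_image:
  fixes D :: "'a::euclidean_space set"
  assumes D: "open D" "has_smooth_boundary D" and A: "linear A" "linear A'" "\<And>x. A (A' x) = x" "\<And>x. A' (A x) = x"
  shows "C1_boundary ((\<lambda>x. A (x - v)) ` D)"
proof -
  define F where "F x = A (x - v)" for x
  define G where "G y = A' y + v" for y
  have FG: "F (G y) = y" "G (F x) = x" for x y using A by (simp_all add: F_def G_def)
  have contG: "continuous_on S G" for S
    unfolding G_def using A(2) by (intro continuous_intros linear_continuous_on) (auto simp: linear_conv_bounded_linear)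
  have img: "F ` S = G -` S" for S using FG by (auto simp: image_iff) metis
  have openF: "open (F ` S)" if "open S" for S
    unfolding img using that contG by (intro open_vimage)
  have dG: "(G has_derivative A') (at y)" for y
    unfolding G_def using A(2) by (auto intro!: derivative_eq_intros linear_imp_has_derivative)
  show ?thesis
    unfolding C1_boundary_def F_def[symmetric]
  proof
    fix p assume p: "p \<in> frontier (F ` D)"
    have "G p \<in> closure D"
    proof -
      have "G ` closure (F ` D) \<subseteq> closure D"
        using FG closure_subset[of D] by (intro image_closure_subset contG) auto
      then show ?thesis using p by (auto simp: frontier_def)
    qed
    moreover have "p \<notin> F ` D" using p openF[OF D(1)] by (simp add: frontier_def interior_open)
    then have "G p \<notin> D" unfolding img by simp
    ultimately have "G p \<in> frontier D" using D(1) by (simp add: frontier_def interior_open)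
    then have "\<exists>U \<rho>. open U \<and> G p \<in> U \<and> smooth_on \<rho> U \<and>
        (\<forall>x\<in>U. frechet_derivative \<rho> (at x) \<noteq> (\<lambda>v. 0)) \<and> D \<inter> U = {x\<in>U. \<rho> x < 0}"
      using D(2) unfolding has_smooth_boundary_def by (rule bspec[rotated])
    then obtain U \<rho> where U: "open U \<and> G p \<in> U \<and> smooth_on \<rho> U \<and>
        (\<forall>x\<in>U. frechet_derivative \<rho> (at x) \<noteq> (\<lambda>v. 0)) \<and> D \<inter> U = {x\<in>U. \<rho> x < 0}"
      by (elim exE)
    then have "Ck_on (Suc 0) \<rho> U" unfolding smooth_on_def by blast
    then have diff: "\<And>x. x \<in> U \<Longrightarrow> \<rho> differentiable (at x)"
      and cont: "\<And>v. continuous_on U (\<lambda>x. frechet_derivative \<rho> (at x) v)" by simp_all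
    define \<rho>' where "\<rho>' y w = frechet_derivative \<rho> (at (G y)) (A' w)" for y w
    have "open (F ` U)" "p \<in> F ` U" using U openF by (auto simp: img)
    moreover have "((\<lambda>y. \<rho> (G y)) has_derivative \<rho>' y) (at y)" if "y \<in> F ` U" for y
    proof -
      have "(\<rho> has_derivative frechet_derivative \<rho> (at (G y))) (at (G y))"
        using diff[of "G y"] that unfolding img by (simp add: frechet_derivative_works)
      from diff_chain_at[OF dG this] show ?thesis by (simp add: o_def \<rho>'_def[abs_def])
    qed
    moreover have "continuous_on (F ` U) (\<lambda>y. \<rho>' y w)" for w
      unfolding \<rho>'_def by (rule continuous_on_compose2[OF cont contG]) (auto simp: img)
    moreover have "\<rho>' y \<noteq> (\<lambda>w. 0)" if "y \<in> F ` U" for y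
    proof
      assume "\<rho>' y = (\<lambda>w. 0)"
      then have "frechet_derivative \<rho> (at (G y)) w = 0" for w
        using A(4)[of w] unfolding \<rho>'_def fun_eq_iff by metis
      then have "frechet_derivative \<rho> (at (G y)) = (\<lambda>w. 0)" by blast
      moreover have "G y \<in> U" using that unfolding img by simp
      ultimately show False using U by blast
    qed
    moreover have "F ` D \<inter> F ` U = {y \<in> F ` U. \<rho> (G y) < 0}"
    proof -
      have "F ` D \<inter> F ` U = G -` (D \<inter> U)" unfolding img by auto
      also have "D \<inter> U = {x\<in>U. \<rho> x < 0}" using U by simp
      finally show ?thesis unfolding img by auto
    qed
    ultimately show "\<exists>U \<rho> \<rho>'. open U \<and> p \<in> U \<and> (\<forall>x\<in>U. (\<rho> has_derivative \<rho>' x) (at x)) \<and>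
      (\<forall>v. continuous_on U (\<lambda>x. \<rho>' x v)) \<and> (\<forall>x\<in>U. \<rho>' x \<noteq> (\<lambda>v. 0)) \<and> F ` D \<inter> U = {x\<in>U. \<rho> x < (0::real)}"
      by (intro exI[of _ "F ` U"] exI[of _ "\<lambda>y. \<rho> (G y)"] exI[of _ \<rho>']) simp
  qed
qed

lemma nn_integral_lborel_translate:
  fixes f :: "'a::euclidean_space \<Rightarrow> ennreal"
  assumes [measurable]: "f \<in> borel_measurable borel"
  shows "(\<integral>\<^sup>+ x. f (c + x) \<partial>lborel) = (\<integral>\<^sup>+ x. f x \<partial>lborel)"
proof -
  have "(\<integral>\<^sup>+ x. f x \<partial>distr lborel borel ((+) c)) = (\<integral>\<^sup>+ x. f (c + x) \<partial>lborel)"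
    by (rule nn_integral_distr) measurable
  then show ?thesis by (simp add: lborel_distr_plus)
qed

text \<open>Tonelli's theorem gives the uniqueness of translation-invariant measures, applied here to the
  pull-back of Lebesgue measure under \<open>A'\<close>.\<close>

lemma measure_linear_isomorphism_image:
  fixes A A' :: "'a::euclidean_space \<Rightarrow> 'a"
  assumes A: "linear A" "linear A'" "\<And>x. A (A' x) = x" "\<And>x. A' (A x) = x"
  obtains \<delta> where "\<And>S. S \<in> sets borel \<Longrightarrow> measure lebesgue (A ` S) = \<delta> * measure lebesgue S"
proof -
  have [measurable]: "A' \<in> borel_measurable borel"
    using A(2) by (intro borel_measurable_continuous_onI linear_continuous_on) (simp add: linear_conv_bounded_linear)
  define B where "B = cbox (0::'a) One"
  have [measurable]: "B \<in> sets borel" by (simp add: B_def)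
  have B1: "emeasure lborel B = 1" by (simp add: B_def emeasure_lborel_cbox)
  \<comment> \<open>The volume of the reflected image of the unit cube under \<open>A\<close>; it
    plays the role of the absolute determinant.\<close>
  define K where "K = emeasure lborel {z. - A' z \<in> B}"
  have key: "emeasure lborel (A ` S) = K * emeasure lborel S" if [measurable]: "S \<in> sets borel" for S
  proof -
    let ?S = "\<lambda>x. indicator S x :: ennreal" and ?B = "\<lambda>x. indicator B x :: ennreal"
    have img: "A ` S = {z. A' z \<in> S}" using A(3,4) by (auto simp: image_iff) metis
    have [measurable]: "{z. A' z \<in> S} \<in> sets borel" "{z. - A' z \<in> B} \<in> sets borel" by measurable
    have "emeasure lborel (A ` S) = (\<integral>\<^sup>+ z. ?S (A' z) * (\<integral>\<^sup>+ y. ?B y \<partial>lborel) \<partial>lborel)"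
      unfolding img using B1 by (simp add: nn_integral_indicator[symmetric] indicator_def[abs_def] of_bool_def cong: if_cong del: nn_integral_indicator)
    also have "\<dots> = (\<integral>\<^sup>+ z. (\<integral>\<^sup>+ y. ?S (A' z) * ?B (- A' z + y) \<partial>lborel) \<partial>lborel)"
    proof (rule nn_integral_cong)
      fix z
      have "(\<integral>\<^sup>+ y. ?B (- A' z + y) \<partial>lborel) = (\<integral>\<^sup>+ y. ?B y \<partial>lborel)"
        by (rule nn_integral_lborel_translate) measurable
      moreover have "(\<integral>\<^sup>+ y. ?S (A' z) * ?B (- A' z + y) \<partial>lborel) = ?S (A' z) * (\<integral>\<^sup>+ y. ?B (- A' z + y) \<partial>lborel)"
        by (rule nn_integral_cmult) measurable
      ultimately show "?S (A' z) * (\<integral>\<^sup>+ y. ?B y \<partial>lborel) = (\<integral>\<^sup>+ y. ?S (A' z) * ?B (- A' z + y) \<partial>lborel)"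
        by simp
    qed
    also have "\<dots> = (\<integral>\<^sup>+ y. (\<integral>\<^sup>+ z. ?S (A' z) * ?B (- A' z + y) \<partial>lborel) \<partial>lborel)"
      by (rule lborel_pair.Fubini'[symmetric]) measurable
    \<comment> \<open>Translating \<open>z\<close> by \<open>A y\<close> replaces
      \<open>A' z\<close> by \<open>A' z + y\<close>.\<close>
    also have "\<dots> = (\<integral>\<^sup>+ y. (\<integral>\<^sup>+ z. ?S (A' z + y) * ?B (- A' z) \<partial>lborel) \<partial>lborel)"
    proof (rule nn_integral_cong)
      fix y
      have "(\<integral>\<^sup>+ z. ?S (A' z) * ?B (- A' z + y) \<partial>lborel) = (\<integral>\<^sup>+ z. ?S (A' (A y + z)) * ?B (- A' (A y + z) + y) \<partial>lborel)"
        by (rule nn_integral_lborel_translate[symmetric]) measurable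
      also have "\<dots> = (\<integral>\<^sup>+ z. ?S (A' z + y) * ?B (- A' z) \<partial>lborel)"
        using A(4) by (simp add: linear_add[OF A(2)] add.commute)
      finally show "(\<integral>\<^sup>+ z. ?S (A' z) * ?B (- A' z + y) \<partial>lborel) = (\<integral>\<^sup>+ z. ?S (A' z + y) * ?B (- A' z) \<partial>lborel)" .
    qed
    also have "\<dots> = (\<integral>\<^sup>+ z. (\<integral>\<^sup>+ y. ?S (A' z + y) * ?B (- A' z) \<partial>lborel) \<partial>lborel)"
      by (rule lborel_pair.Fubini') measurable
    also have "\<dots> = (\<integral>\<^sup>+ z. emeasure lborel S * ?B (- A' z) \<partial>lborel)"
    proof (rule nn_integral_cong)
      fix z
      have "(\<integral>\<^sup>+ y. ?S (A' z + y) \<partial>lborel) = (\<integral>\<^sup>+ y. ?S y \<partial>lborel)"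
        by (rule nn_integral_lborel_translate) measurable
      moreover have "(\<integral>\<^sup>+ y. ?S (A' z + y) * ?B (- A' z) \<partial>lborel) = (\<integral>\<^sup>+ y. ?S (A' z + y) \<partial>lborel) * ?B (- A' z)"
        by (rule nn_integral_multc) measurable
      ultimately show "(\<integral>\<^sup>+ y. ?S (A' z + y) * ?B (- A' z) \<partial>lborel) = emeasure lborel S * ?B (- A' z)"
        by simp
    qed
    also have "\<dots> = emeasure lborel S * (\<integral>\<^sup>+ z. ?B (- A' z) \<partial>lborel)"
      by (rule nn_integral_cmult) measurable
    also have "(\<integral>\<^sup>+ z. ?B (- A' z) \<partial>lborel) = (\<integral>\<^sup>+ z. indicator {z. - A' z \<in> B} z \<partial>lborel)"
      by (rule nn_integral_cong) (simp add: indicator_def)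
    also have "\<dots> = K"
      unfolding K_def by (rule nn_integral_indicator) measurable
    also have "emeasure lborel S * K = K * emeasure lborel S" by (rule mult.commute)
    finally show ?thesis .
  qed
  \<comment> \<open>For \<open>S = B\<close> the formula says that \<open>K\<close> is the volume of
    a bounded set.\<close>
  have "bounded B" by (simp add: B_def)
  then have "bounded (A ` B)" using A(1) by (intro bounded_linear_image) (simp_all add: linear_conv_bounded_linear)
  then have "emeasure lborel (A ` B) < \<infinity>" by (rule emeasure_bounded_finite)
  then have "K < \<infinity>" using key[of B] B1 by simp
  then obtain \<delta> where \<delta>: "K = ennreal \<delta>" "\<delta> \<ge> 0" by (cases K) auto
  show thesis
  proof (rule that)
    fix S :: "'a set" assume S: "S \<in> sets borel"
    have "A ` S = {z. A' z \<in> S}" using A(3,4) by (auto simp: image_iff) metis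
    then have "A ` S \<in> sets borel" using measurable_sets[of A' borel borel S] S by (simp add: vimage_def)
    then have "measure lebesgue (A ` S) = measure lborel (A ` S)" by (simp add: measure_completion)
    also have "\<dots> = \<delta> * measure lborel S"
      using key[OF S] \<delta> by (simp add: measure_def enn2real_mult)
    also have "measure lborel S = measure lebesgue S" using S by (simp add: measure_completion)
    finally show "measure lebesgue (A ` S) = \<delta> * measure lebesgue S" .
  qed
qed

text \<open>Normalizing \<open>\<xi>\<close> substitutes \<open>(t + w) / norm \<xi>\<close> for
  \<open>t\<close>, which preserves degree bounds. The shift \<open>w\<close> prepares for
  translations of \<open>D\<close>.\<close>

lemma rational_in_direction:
  fixes D :: "(real ^ 'n) set"
  assumes vol: "\<forall>(\<xi>, t) \<in> volume_domain D.
           volume_function D \<xi> t = sphere_poly_eval m a \<xi> t / sphere_poly_eval k b \<xi> t"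
    and nz: "\<forall>\<xi> \<in> sphere 0 1. \<forall>t. sphere_poly_eval k b \<xi> t \<noteq> 0"
    and "\<xi> \<noteq> 0"
  obtains P Q :: "real poly" where "degree P \<le> max m k" "degree Q \<le> max m k" "\<And>t. poly Q t \<noteq> 0"
    "\<And>t. \<exists>x\<in>D. \<xi> \<bullet> x = t + w \<Longrightarrow> measure lebesgue (D \<inter> {x. \<xi> \<bullet> x \<le> t + w}) = poly P t / poly Q t"
proof -
  define u where "u = \<xi> /\<^sub>R norm \<xi>"
  have u: "u \<in> sphere 0 1" using \<open>\<xi> \<noteq> 0\<close> by (simp add: u_def)
  define l where "l = [:w / norm \<xi>, 1 / norm \<xi>:]"
  have l: "poly l t = (t + w) / norm \<xi>" for t by (simp add: l_def add_divide_distrib)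
  have dl: "degree l \<le> 1" by (simp add: l_def)
  have ev: "poly (pcompose (\<Sum>i\<le>n. monom (c i u) i) l) t = sphere_poly_eval n c u ((t + w) / norm \<xi>)" for n c t
    by (simp add: poly_pcompose sphere_poly_eval_def poly_sum poly_monom l)
  have deg: "degree (pcompose (\<Sum>i\<le>n. monom (c i u) i) l) \<le> max m k" if "n \<le> max m k" for n and c :: "nat \<Rightarrow> real ^ 'n \<Rightarrow> real"
  proof -
    have "degree (pcompose (\<Sum>i\<le>n. monom (c i u) i) l) \<le> degree (\<Sum>i\<le>n. monom (c i u) i) * degree l"
      by (rule degree_pcompose_le)
    also have "\<dots> \<le> n * 1" using dl
      by (intro mult_mono degree_sum_le) (auto intro: order_trans[OF degree_monom_le])
    finally show ?thesis using that by simp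
  qed
  have n0: "norm \<xi> > 0" using \<open>\<xi> \<noteq> 0\<close> by simp
  show thesis
  proof (rule that[of "pcompose (\<Sum>i\<le>m. monom (a i u) i) l" "pcompose (\<Sum>i\<le>k. monom (b i u) i) l"])
    fix t
    show "poly (pcompose (\<Sum>i\<le>k. monom (b i u) i) l) t \<noteq> 0" unfolding ev using nz u by blast
    assume "\<exists>x\<in>D. \<xi> \<bullet> x = t + w"
    then have "(u, (t + w) / norm \<xi>) \<in> volume_domain D"
      using u n0 by (auto simp: volume_domain_def u_def divide_inverse mult.commute)
    then have "volume_function D u ((t + w) / norm \<xi>) =
       poly (pcompose (\<Sum>i\<le>m. monom (a i u) i) l) t / poly (pcompose (\<Sum>i\<le>k. monom (b i u) i) l) t"
      unfolding ev using vol by blast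
    moreover have "{x. u \<bullet> x \<le> (t + w) / norm \<xi>} = {x. \<xi> \<bullet> x \<le> t + w}"
      using n0 by (auto simp: u_def field_simps)
    ultimately show "measure lebesgue (D \<inter> {x. \<xi> \<bullet> x \<le> t + w}) =
       poly (pcompose (\<Sum>i\<le>m. monom (a i u) i) l) t / poly (pcompose (\<Sum>i\<le>k. monom (b i u) i) l) t"
      by (simp only: volume_function_def)
  qed (auto intro: deg)
qed

theorem corollary1p6:
  fixes D :: "(real ^ 'n) set"
    and a b :: "nat \<Rightarrow> real ^ 'n \<Rightarrow> real"
    and m k :: nat
  assumes "odd CARD('n)"
    and "bounded_domain D"
    and "has_smooth_boundary D"
    and "sphere_poly_coeffs m a"
    and "sphere_poly_coeffs k b"
    and "\<forall>(\<xi>, t) \<in> volume_domain D.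
           volume_function D \<xi> t = sphere_poly_eval m a \<xi> t / sphere_poly_eval k b \<xi> t"
    and "\<forall>\<xi> \<in> sphere 0 1. \<forall>t. sphere_poly_eval k b \<xi> t \<noteq> 0"
    and "\<forall>\<xi> \<in> sphere 0 1. b k \<xi> \<noteq> 0"
  shows "is_ellipsoid D"
proof -
  interpret bdd_domain D
    using assms(2) by (simp add: bounded_domain_def bdd_domain_def)
  note rat = rational_in_direction[OF assms(6,7)]
  obtain x0 where x0: "x0 \<in> D" using nonempty_D by blast
  \<comment> \<open>The moment argument needs the origin inside the domain, so that the ends of all
    intervals have opposite signs.\<close>
  define D0 where "D0 = (\<lambda>x. x - x0) ` D"
  interpret D0: bdd_domain D0
    using affine_image[of "\<lambda>x. x" x0] by (simp add: D0_def linear_ident)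
  have ratD0: "D0.rational_volume (max m k)"
    unfolding D0.rational_volume_def
  proof (intro allI impI)
    fix \<xi> :: "real ^ 'n" assume "\<xi> \<noteq> 0"
    obtain P Q :: "real poly" where PQ: "degree P \<le> max m k" "degree Q \<le> max m k" "\<And>t. poly Q t \<noteq> 0"
      "\<And>t. \<exists>x\<in>D. \<xi> \<bullet> x = t + \<xi> \<bullet> x0 \<Longrightarrow> measure lebesgue (D \<inter> {x. \<xi> \<bullet> x \<le> t + \<xi> \<bullet> x0}) = poly P t / poly Q t"
      using rat[OF \<open>\<xi> \<noteq> 0\<close>, of "\<xi> \<bullet> x0"] by blast
    have "measure lebesgue (D0 \<inter> {x. \<xi> \<bullet> x \<le> t}) = poly P t / poly Q t" if "\<exists>x\<in>D0. \<xi> \<bullet> x = t" for t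
    proof -
      have "D0 \<inter> {x. \<xi> \<bullet> x \<le> t} = (\<lambda>x. x - x0) ` (D \<inter> {x. \<xi> \<bullet> x \<le> t + \<xi> \<bullet> x0})"
        by (auto simp: D0_def inner_diff_right)
      moreover have "\<exists>x\<in>D. \<xi> \<bullet> x = t + \<xi> \<bullet> x0" using that by (auto simp: D0_def inner_diff_right)
      ultimately show ?thesis using PQ(4)[of t] by (simp add: measure_translation_subtract)
    qed
    then show "\<exists>a b. degree a \<le> max m k \<and> degree b \<le> max m k \<and> (\<forall>t. poly b t \<noteq> 0) \<and>
        (\<forall>t. (\<exists>x\<in>D0. \<xi> \<bullet> x = t) \<longrightarrow> measure lebesgue (D0 \<inter> {x. \<xi> \<bullet> x \<le> t}) = poly a t / poly b t)"
      using PQ(1-3) by blast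
  qed
  have "0 \<in> D0" using x0 by (auto simp: D0_def)
  obtain T :: "real ^ 'n \<Rightarrow> real ^ 'n" and c
    where T: "linear T" "bij T" "\<And>\<eta>. support_fun D0 (T \<eta>) = c \<bullet> T \<eta> + norm \<eta>"
  proof (rule D0.support_normal_form[OF ratD0 \<open>0 \<in> D0\<close>])
    fix T :: "real ^ 'n \<Rightarrow> real ^ 'n" and c
    assume T: "linear T" "bij T" "\<And>\<eta>. support_fun D0 (T \<eta>) = c \<bullet> T \<eta> + norm \<eta>"
    show thesis by (rule that[OF T])
  qed
  \<comment> \<open>The support function of an image under the adjoint at \<open>\<eta>\<close> is
    that of the original set at \<open>T \<eta>\<close>, so \<open>A\<close> produces the support
    function of the ball.\<close>
  define A where "A = adjoint T"
  have A: "linear A" "\<And>x y. x \<bullet> A y = T x \<bullet> y"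
    using T(1) by (simp_all add: A_def adjoint_linear adjoint_works)
  have "inj A"
    unfolding linear_injective_0[OF A(1)]
  proof (intro allI impI)
    fix y assume "A y = 0"
    then have "T x \<bullet> y = 0" for x using A(2)[of x y] by simp
    moreover obtain x where "T x = y" using T(2) by (metis bij_pointE)
    ultimately show "y = 0" by (metis inner_eq_zero_iff)
  qed
  then obtain A' where A': "linear A'" "\<And>x. A (A' x) = x" "\<And>x. A' (A x) = x"
    using linear_injective_isomorphism[OF A(1)] by blast
  have "surj A" using A'(2) by (rule surjI)
  \<comment> \<open>\<open>c\<close> is the centre read off in coordinates with origin
    \<open>x0\<close>; \<open>v\<close> is the centre of the ellipsoid.\<close>
  define v where "v = x0 + c"
  define D1 where "D1 = (\<lambda>x. A (x - v)) ` D"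
  interpret D1: bdd_domain D1
    unfolding D1_def by (rule affine_image[OF A(1) \<open>surj A\<close>])
  have supp: "support_fun D1 \<eta> = norm \<eta>" for \<eta>
  proof (rule antisym)
    show "support_fun D1 \<eta> \<le> norm \<eta>"
    proof (rule D1.support_le)
      fix y assume "y \<in> D1"
      then obtain x where x: "x \<in> D" "y = A (x - v)" by (auto simp: D1_def)
      have "T \<eta> \<bullet> (x - x0) \<le> support_fun D0 (T \<eta>)"
        using x(1) by (intro D0.inner_le_support) (auto simp: D0_def)
      then show "\<eta> \<bullet> y \<le> norm \<eta>" unfolding x(2) A(2) T(3) v_def
        by (simp add: inner_diff_right inner_add_right inner_commute)
    qed
    have "support_fun D0 (T \<eta>) \<le> support_fun D1 \<eta> + c \<bullet> T \<eta>"
    proof (rule D0.support_le)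
      fix z assume "z \<in> D0"
      then obtain x where x: "x \<in> D" "z = x - x0" by (auto simp: D0_def)
      have "\<eta> \<bullet> A (x - v) \<le> support_fun D1 \<eta>"
        using x(1) by (intro D1.inner_le_support) (auto simp: D1_def)
      then show "T \<eta> \<bullet> z \<le> support_fun D1 \<eta> + c \<bullet> T \<eta>" unfolding x(2) A(2) v_def
        by (simp add: inner_diff_right inner_add_right inner_commute)
    qed
    then show "norm \<eta> \<le> support_fun D1 \<eta>" unfolding T(3) by simp
  qed
  have C1: "C1_boundary D1"
    unfolding D1_def by (rule C1_boundary_affine_image[OF open_D assms(3) A(1) A'])
  obtain e :: "real ^ 'n" where e: "e \<in> Basis" using nonempty_Basis by blast
  have "T e \<noteq> 0" using e T(1,2) by (metis bij_is_inj linear_injective_0 nonzero_Basis)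
  \<comment> \<open>The direction \<open>e\<close> for the image \<open>D1\<close> corresponds to
    \<open>T e\<close> for \<open>D\<close>; the volumes differ by the constant factor
    \<open>\<delta>\<close> below.\<close>
  obtain P Q :: "real poly" where PQ: "degree P \<le> max m k" "degree Q \<le> max m k" "\<And>t. poly Q t \<noteq> 0"
      "\<And>t. \<exists>x\<in>D. T e \<bullet> x = t + T e \<bullet> v \<Longrightarrow> measure lebesgue (D \<inter> {x. T e \<bullet> x \<le> t + T e \<bullet> v}) = poly P t / poly Q t"
    using rat[OF \<open>T e \<noteq> 0\<close>, of "T e \<bullet> v"] by blast
  obtain \<delta> where \<delta>: "\<And>S. S \<in> sets borel \<Longrightarrow> measure lebesgue (A ` S) = \<delta> * measure lebesgue S"
    using measure_linear_isomorphism_image[OF A(1) A'] by blast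
  have "D1 = ball 0 1"
  proof (rule D1.ball_of_support[OF supp C1 _ e PQ(3)])
    show "odd DIM(real ^ 'n)" using assms(1) by simp
    fix t assume ex: "\<exists>x\<in>D1. e \<bullet> x = t"
    have eq: "D1 \<inter> {y. e \<bullet> y \<le> t} = A ` ((\<lambda>x. x - v) ` (D \<inter> {x. T e \<bullet> x \<le> t + T e \<bullet> v}))"
      by (auto simp: D1_def A(2) inner_diff_right)
    define X where "X = D \<inter> {x. T e \<bullet> x \<le> t + T e \<bullet> v}"
    have X: "X \<in> sets borel"
      unfolding X_def by (intro sets.Int borel_open borel_closed open_D closed_halfspace_le)
    have "(\<lambda>x. x - v) ` X = (\<lambda>x. x + v) -` X"
      by (auto simp: image_iff intro!: bexI[of _ "_ + v"])
    moreover have "(\<lambda>x. x + v) -` X \<in> sets borel"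
      using measurable_sets[of "\<lambda>x. x + v" borel borel X] X by simp
    ultimately have "(\<lambda>x. x - v) ` X \<in> sets borel" by (simp only:)
    then have "measure lebesgue (D1 \<inter> {y. e \<bullet> y \<le> t}) = \<delta> * measure lebesgue (D \<inter> {x. T e \<bullet> x \<le> t + T e \<bullet> v})"
      unfolding eq X_def[symmetric] by (simp add: \<delta> measure_translation_subtract)
    moreover have "\<exists>x\<in>D. T e \<bullet> x = t + T e \<bullet> v" using ex by (auto simp: D1_def A(2) inner_diff_right)
    ultimately show "measure lebesgue (D1 \<inter> {y. e \<bullet> y \<le> t}) = poly (smult \<delta> P) t / poly Q t"
      using PQ(4)[of t] by simp
  qed
  moreover have "D = (\<lambda>y. v + A' y) ` D1"
    by (auto simp: D1_def A'(3) image_comp image_iff)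
  moreover have "bij A'" using A'(2,3) by (intro o_bij[of A]) (auto simp: fun_eq_iff)
  ultimately show ?thesis
    unfolding is_ellipsoid_def using A'(1) by (intro exI[of _ A'] exI[of _ v]) simp
qed

end
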